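(* Let $N\ge1$ be an integer and let $\mathbf c$ be a rectifiable and open curve in $\mathbb R^{N+1}$, parameterized in arc-length by $\mathbf c:[0,L]\to\mathbb R^{N+1}$, with $L=\mathcal L(\mathbf c)$ its length and $I_L=(0,L)$. Then for every exponent $p>1$ $$\mathcal F_p^{\mathrm{opt}}(\mathbf c)<\infty\iff\mathbf c\in W^{2,p}(I_L,\mathbb R^{N+1}),$$ and in that case $$\mathcal F_p^{\mathrm{opt}}(\mathbf c)=\int_0^L\|\ddot{\mathbf c}(s)\|^p\,ds .$$
   Context: Inscribed polygonals and modulus. A polygonal $P$ is inscribed in $\mathbf c$, written $P\ll\mathbf c$, if there is a finite partition $0=t_0<t_1<\dots<t_n=L$ such that $P$ is the polygonal with consecutive vertices $\mathbf c(t_0),\dots,\mathbf c(t_n)$. The modulus $\mu_{\mathbf c}(P)$ is the maximum of the diameters of the arcs of $\mathbf c$ determined by consecutive vertices of $P$. $\{P_h\}\ll\mathbf c$ means that $\{P_h\}$ is a sequence of polygonals each inscribed in $\mathbf c$. Optimal $p$-rotation. A piecewise smooth curve is a curve whose arc-length parameterization $g$ has $\dot g$ continuous and piecewise $C^1$; its scalar curvature is $\|\ddot g\|$, its total curvature is $\int\|\ddot g\|\,ds$ and its $p$-energy is $\int\|\ddot g\|^p\,ds$. Let $P$ be an open polygonal given by $n$ non-degenerate consecutive segments $\mathbf v_1,\dots,\mathbf v_n$ of lengths $\ell_i>0$, with turning (exterior) angle $\theta_i=\arccos\big(\frac{\mathbf v_i\bullet\mathbf v_{i+1}}{\ell_i\ell_{i+1}}\big)\in[0,\pi]$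 at the common vertex $v_i$ of $\mathbf v_i$ and $\mathbf v_{i+1}$, $i=1,\dots,n-1$. For each $i$ let $e_i$ be the minimum of the $p$-energy among piecewise smooth curves that start at the middle point of $\mathbf v_i$ with tangent $\mathbf v_i/\ell_i$, end at the middle point of $\mathbf v_{i+1}$ with tangent $\mathbf v_{i+1}/\ell_{i+1}$, and have total curvature equal to $\theta_i$ ($e_i=+\infty$ if $\theta_i=\pi$). The optimal $p$-rotation is $\mathbf k_p^{\mathrm{opt}}(P):=\sum_{i=1}^{n-1}e_i$. Finally $$\mathcal F_p^{\mathrm{opt}}(\mathbf c):=\inf\Big\{\liminf_{h\to\infty}\mathbf k_p^{\mathrm{opt}}(P_h)\ \Big|\ \{P_h\}\ll\mathbf c,\ \mu_{\mathbf c}(P_h)\to0\Big\}.$$ *)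

theory Defs
  imports "HOL-Analysis.Analysis"
begin

section \<open>Curves\<close>

definition is_partition :: "real \<Rightarrow> real \<Rightarrow> real list \<Rightarrow> bool" where
  "is_partition a b ts \<longleftrightarrow> ts \<noteq> [] \<and> sorted_wrt (<) ts \<and> hd ts = a \<and> last ts = b"

definition curve_length :: "(real \<Rightarrow> 'a::metric_space) \<Rightarrow> real \<Rightarrow> real \<Rightarrow> ennreal" where
  "curve_length c a b =
     (SUP ts \<in> {ts. is_partition a b ts}.
        ennreal (\<Sum>i<length ts - 1. dist (c (ts ! i)) (c (ts ! Suc i))))"

text \<open>The case \<open>t = L\<close> contains rectifiability, and says that \<open>L\<close> is the length of the curve.\<close>

definition arclength_parameterized :: "(real \<Rightarrow> 'a::metric_space) \<Rightarrow> real \<Rightarrow> bool" where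
  "arclength_parameterized c L \<longleftrightarrow>
     0 \<le> L \<and> continuous_on {0..L} c \<and> (\<forall>t\<in>{0..L}. curve_length c 0 t = ennreal t)"


section \<open>Piecewise smooth curves and their energies\<close>

text \<open>On each closed piece the derivative extends continuously to both end points. This is
  stronger than \<open>piecewise_C1_differentiable_on\<close>, which puts no condition on the derivative
  near the break points.\<close>

definition piecewise_C1 :: "(real \<Rightarrow> 'a::real_normed_vector) \<Rightarrow> real \<Rightarrow> real \<Rightarrow> bool" where
  "piecewise_C1 f a b \<longleftrightarrow>
     (\<exists>ts. is_partition a b ts \<and>
        (\<forall>i<length ts - 1. \<exists>D. continuous_on {ts ! i..ts ! Suc i} D \<and>
           (\<forall>x\<in>{ts ! i..ts ! Suc i}.
              (f has_vector_derivative D x) (at x within {ts ! i..ts ! Suc i}))))"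

definition tangent :: "real \<Rightarrow> (real \<Rightarrow> 'a::real_normed_vector) \<Rightarrow> real \<Rightarrow> 'a" where
  "tangent len g s = vector_derivative g (at s within {0..len})"

text \<open>Meaningful away from the finitely many break points of the tangent.\<close>

definition acceleration :: "real \<Rightarrow> (real \<Rightarrow> 'a::real_normed_vector) \<Rightarrow> real \<Rightarrow> 'a" where
  "acceleration len g s = vector_derivative (tangent len g) (at s within {0..len})"

text \<open>For a \<open>C\<^sup>1\<close> curve, being parameterized by arc length means having unit speed.\<close>

definition piecewise_smooth_curve :: "real \<Rightarrow> (real \<Rightarrow> 'a::real_normed_vector) \<Rightarrow> bool" where
  "piecewise_smooth_curve len g \<longleftrightarrow>
     0 < len \<and>
     (\<forall>s\<in>{0..len}. g differentiable (at s within {0..len}) \<and> norm (tangent len g s) = 1) \<and>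
     continuous_on {0..len} (tangent len g) \<and>
     piecewise_C1 (tangent len g) 0 len"

definition total_curvature :: "real \<Rightarrow> (real \<Rightarrow> 'a::real_normed_vector) \<Rightarrow> ennreal" where
  "total_curvature len g = (\<integral>\<^sup>+s\<in>{0..len}. ennreal (norm (acceleration len g s)) \<partial>lebesgue)"

definition p_energy :: "real \<Rightarrow> real \<Rightarrow> (real \<Rightarrow> 'a::real_normed_vector) \<Rightarrow> ennreal" where
  "p_energy p len g = (\<integral>\<^sup>+s\<in>{0..len}. ennreal (norm (acceleration len g s) powr p) \<partial>lebesgue)"


section \<open>Optimal rotation of a polygonal\<close>

definition turning_angle :: "'a::real_inner \<Rightarrow> 'a \<Rightarrow> 'a \<Rightarrow> real" where
  "turning_angle x y z = arccos (((y - x) \<bullet> (z - y)) / (norm (y - x) * norm (z - y)))"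

definition rounds_corner ::
    "'a::real_inner \<Rightarrow> 'a \<Rightarrow> 'a \<Rightarrow> real \<Rightarrow> (real \<Rightarrow> 'a) \<Rightarrow> bool" where
  "rounds_corner x y z len g \<longleftrightarrow>
     piecewise_smooth_curve len g \<and>
     g 0 = midpoint x y \<and> tangent len g 0 = (1 / norm (y - x)) *\<^sub>R (y - x) \<and>
     g len = midpoint y z \<and> tangent len g len = (1 / norm (z - y)) *\<^sub>R (z - y) \<and>
     total_curvature len g = ennreal (turning_angle x y z)"

text \<open>The minimum is written as an infimum.\<close>

definition corner_energy :: "real \<Rightarrow> 'a::real_inner \<Rightarrow> 'a \<Rightarrow> 'a \<Rightarrow> ennreal" where
  "corner_energy p x y z =
     (if turning_angle x y z = pi then \<infinity>
      else (INF (len, g) \<in> {(len, g). rounds_corner x y z len g}. p_energy p len g))"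

text \<open>A polygonal is represented by the list of its consecutive vertices. Repeated consecutive
  vertices are merged, so that only the non-degenerate segments count: even a curve parameterized
  by arc length may take the same value at two consecutive points of a partition.\<close>

definition optimal_rotation :: "real \<Rightarrow> 'a::real_inner list \<Rightarrow> ennreal" where
  "optimal_rotation p P =
     (let V = remdups_adj P
      in \<Sum>i<length V - 2. corner_energy p (V ! i) (V ! (i + 1)) (V ! (i + 2)))"


section \<open>The relaxed energy\<close>

text \<open>A polygonal inscribed in \<open>c\<close> is given by a partition \<open>ts\<close> of \<open>{0..L}\<close>; its vertices are
  \<open>map c ts\<close>. The modulus depends on the partition and not only on the vertices.\<close>

definition modulus :: "(real \<Rightarrow> 'a::metric_space) \<Rightarrow> real list \<Rightarrow> real" where
  "modulus c ts = Max ((\<lambda>i. diameter (c ` {ts ! i..ts ! Suc i})) ` {..<length ts - 1})"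

definition relaxed_energy :: "real \<Rightarrow> real \<Rightarrow> (real \<Rightarrow> 'a::real_inner) \<Rightarrow> ennreal" where
  "relaxed_energy p L c =
     Inf {liminf (\<lambda>h. optimal_rotation p (map c (T h))) | T :: nat \<Rightarrow> real list.
            (\<forall>h. is_partition 0 L (T h)) \<and> (\<lambda>h. modulus c (T h)) \<longlonglongrightarrow> 0}"


section \<open>Sobolev functions on an open set of reals\<close>

definition test_function :: "real set \<Rightarrow> (real \<Rightarrow> real) \<Rightarrow> bool" where
  "test_function I \<phi> \<longleftrightarrow>
     (\<forall>k x. (deriv ^^ k) \<phi> field_differentiable (at x)) \<and>
     compact (closure {x. \<phi> x \<noteq> 0}) \<and> closure {x. \<phi> x \<noteq> 0} \<subseteq> I"

definition locally_integrable :: "real set \<Rightarrow> (real \<Rightarrow> 'a::euclidean_space) \<Rightarrow> bool" where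
  "locally_integrable I u \<longleftrightarrow> (\<forall>K. compact K \<and> K \<subseteq> I \<longrightarrow> set_integrable lebesgue K u)"

definition has_weak_deriv ::
    "nat \<Rightarrow> real set \<Rightarrow> (real \<Rightarrow> 'a::euclidean_space) \<Rightarrow> (real \<Rightarrow> 'a) \<Rightarrow> bool" where
  "has_weak_deriv k I u v \<longleftrightarrow>
     locally_integrable I u \<and> locally_integrable I v \<and>
     (\<forall>\<phi>. test_function I \<phi> \<longrightarrow>
        (LINT x:I|lebesgue. (deriv ^^ k) \<phi> x *\<^sub>R u x) =
        (- 1) ^ k *\<^sub>R (LINT x:I|lebesgue. \<phi> x *\<^sub>R v x))"

text \<open>Any two weak derivatives agree almost everywhere on \<open>I\<close>; this chooses a representative.\<close>

definition weak_deriv ::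
    "nat \<Rightarrow> real set \<Rightarrow> (real \<Rightarrow> 'a::euclidean_space) \<Rightarrow> real \<Rightarrow> 'a" where
  "weak_deriv k I u = (SOME v. has_weak_deriv k I u v)"

definition in_Lp :: "real \<Rightarrow> real set \<Rightarrow> (real \<Rightarrow> 'a::euclidean_space) \<Rightarrow> bool" where
  "in_Lp p I u \<longleftrightarrow>
     u \<in> borel_measurable (lebesgue_on I) \<and>
     integrable (lebesgue_on I) (\<lambda>x. norm (u x) powr p)"

definition sobolev :: "nat \<Rightarrow> real \<Rightarrow> real set \<Rightarrow> (real \<Rightarrow> 'a::euclidean_space) set" where
  "sobolev k p I =
     {u. in_Lp p I u \<and> (\<forall>j\<in>{1..k}. \<exists>v. has_weak_deriv j I u v \<and> in_Lp p I v)}"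

end

theory Submission
  imports Defs
begin

text \<open>
  Lower bound. A curve rounding a corner with total curvature equal to the turning angle keeps its
  tangent in the wedge of the two directions, hence has length at most half the sum of the two
  sides; by Jensen its energy is at least the \<open>p\<close>-th power of the angle divided by the \<open>(p - 1)\<close>-st
  power of that length. The directions of fine inscribed polygonals therefore satisfy a discrete
  Sobolev bound. They converge to a tangent of \<open>c\<close>, which inherits the bound on every partition, and
  the slopes of the tangent on dyadic intervals form an \<open>L\<^sup>p\<close>-bounded martingale whose limit is the
  second derivative (a theorem of F. Riesz).

  Upper bound. Round the corners of the polygonals of uniform partitions by circular arcs. Their
  energy is asymptotically the sum of the \<open>p\<close>-th powers of the second differences of \<open>c\<close>, suitably
  scaled, which Jensen bounds by the energy of \<open>c\<close>.
\<close>

section \<open>Power inequalities and integrals\<close>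

text \<open>The modulus only controls diameters in space, while the estimates need short parameter
  intervals; an arc-length curve cannot linger near a point, and a grid argument makes this uniform.
  Equality also demands that no constant be lost. In the lower bound the length allotted to a corner
  is half the sum of its sides, so the corners inside an interval telescope to its length up to a
  vanishing error, and every \<open>M\<close> above the relaxed energy bounds the energy of the
  density. In the upper bound all losses are collected in one factor
  \<open>r powr (2 - 4 * p)\<close>, with \<open>r\<close> tending to 1. The chords of a polygonal
  are shorter than the arcs they cut off, so its direction integrates to \<open>c\<close> only up to
  the missing length; rectifiability makes this small. The constraint on total curvature is what
  makes the lower bound possible: for \<open>p > 1\<close> energy scales like a negative power of
  length, so a long detour could otherwise make a corner cheap. Since \<open>weak_deriv\<close> is a
  choice among densities, the equality also rests on uniqueness of the weak second
  derivative.\<close>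

lemma powr_tangent_line:
  fixes p x l :: real
  assumes "p > 1" "x \<ge> 0" "l \<ge> 0"
  shows "l powr p + p * l powr (p - 1) * (x - l) \<le> x powr p"
proof (cases "l = 0")
  case True
  then show ?thesis using assms by simp
next
  case False
  then have l: "l > 0" using assms by simp
  have eq: "l powr p = l * l powr (p - 1)" using l by (simp add: powr_diff)
  show ?thesis
  proof (cases "x = 0")
    case True
    have "1 * l powr p \<le> p * l powr p" using assms by (intro mult_right_mono) auto
    then show ?thesis using True assms l eq by (simp add: algebra_simps)
  next
    case False
    \<comment> \<open>Convexity and the derivative are used on the open half-line; this is why
      \<open>l = 0\<close> and \<open>x = 0\<close> were split off.\<close>
    have "convex_on {0<..} (\<lambda>x. x powr p)"
      using assms by (intro powr_convex) simp
    moreover have "((\<lambda>x. x powr p) has_field_derivative p * l powr (p - 1)) (at l within {0<..})"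
      using l by (auto intro!: derivative_eq_intros simp: powr_diff field_simps)
    ultimately have "x powr p - l powr p \<ge> p * l powr (p - 1) * (x - l)"
      using l False assms
      by (intro convex_on_imp_above_tangent[of "{0<..}"]) (auto simp: interior_open)
    then show ?thesis by simp
  qed
qed

text \<open>The tangent line at \<open>l = D / h\<close> gives the bound; for \<open>h = 0\<close>, letting \<open>l\<close> grow forces \<open>D = 0\<close>.\<close>

lemma powr_le_of_tangent_lines:
  fixes p h D E :: real
  assumes p: "p > 1" and h: "h \<ge> 0" and D: "D \<ge> 0"
    and E: "\<And>l. l \<ge> 0 \<Longrightarrow> h * l powr p + p * l powr (p - 1) * (D - h * l) \<le> E"
  shows "D powr p \<le> E * h powr (p - 1)"
proof (cases "D = 0")
  case True
  have "0 \<le> E" using E[of 0] p by (simp add: True)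
  then show ?thesis using True by simp
next
  case False
  then have D: "D > 0" using D by simp
  show ?thesis
  proof (cases "h = 0")
    case True
    have "p * l powr (p - 1) * D \<le> E" if "l \<ge> 0" for l
      using E[OF that] True by simp
    \<comment> \<open>This \<open>l\<close> makes the left-hand side equal to the absolute value of
      \<open>E\<close> plus 1.\<close>
    from this[of "((\<bar>E\<bar> + 1) / (p * D)) powr (1 / (p - 1))"] have "\<bar>E\<bar> + 1 \<le> E"
      using p D by (simp add: powr_powr)
    then show ?thesis by linarith
  next
    case False
    then have h: "h > 0" using h by simp
    have "h * (D / h) powr p \<le> E" using E[of "D / h"] h D by simp
    then have "h * (D / h) powr p * h powr (p - 1) \<le> E * h powr (p - 1)"
      by (intro mult_right_mono) simp_all
    moreover have "h * (D / h) powr p * h powr (p - 1) = D powr p"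
      using h D by (simp add: powr_divide powr_diff)
    ultimately show ?thesis by simp
  qed
qed

text \<open>Solving the tangent line at \<open>l\<close> for \<open>norm (a s)\<close> bounds it by
  an affine function of the integrable \<open>p\<close>-th power. Integrating this majorant and then
  choosing the best \<open>l\<close> gives Hoelder's inequality for a gauge integral.\<close>

lemma norm_integral_powr_le:
  fixes a :: "real \<Rightarrow> 'a::euclidean_space"
  assumes p: "p > 1" and xy: "x \<le> y" and a: "(a has_integral D) {x..y}"
    and e: "(\<lambda>s. norm (a s) powr p) integrable_on {x..y}"
  shows "norm D powr p \<le> integral {x..y} (\<lambda>s. norm (a s) powr p) * (y - x) powr (p - 1)"
proof (rule powr_le_of_tangent_lines[OF p])
  show "0 \<le> y - x" "0 \<le> norm D" using xy by auto
next
  fix l :: real assume l: "l \<ge> 0"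
  let ?E = "integral {x..y} (\<lambda>s. norm (a s) powr p)"
  have E: "((\<lambda>s. norm (a s) powr p) has_integral ?E) {x..y}" using e by blast
  show "(y - x) * l powr p + p * l powr (p - 1) * (norm D - (y - x) * l) \<le> ?E"
  proof (cases "l = 0")
    case True
    then show ?thesis using p by (simp add: integral_nonneg[OF e])
  next
    case False
    then have l: "l > 0" using l by simp
    define k where "k = p * l powr (p - 1)"
    have k: "k > 0" using l p by (simp add: k_def)
    have le: "norm (a s) \<le> (norm (a s) powr p - l powr p) / k + l" for s
      using powr_tangent_line[OF p, of "norm (a s)" l] l k
      by (simp add: k_def[symmetric] field_simps)
    have int: "((\<lambda>s. (norm (a s) powr p - l powr p) / k + l) has_integral
        ((?E - (y - x) *\<^sub>R (l powr p)) / k + (y - x) *\<^sub>R l)) {x..y}"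
      using xy has_integral_const_real[of l x y] has_integral_const_real[of "l powr p" x y]
      by (intro has_integral_add has_integral_divide has_integral_diff E) auto
    have "norm D \<le> (?E - (y - x) * (l powr p)) / k + (y - x) * l"
      using integral_norm_bound_integral[of a "{x..y}" "\<lambda>s. (norm (a s) powr p - l powr p) / k + l"]
        a int le by (auto simp: has_integral_iff)
    then have "k * norm D \<le> k * ((?E - (y - x) * (l powr p)) / k + (y - x) * l)"
      using k by simp
    also have "\<dots> = ?E - (y - x) * (l powr p) + k * ((y - x) * l)"
      using k by (simp add: distrib_left)
    finally show ?thesis by (simp add: k_def[symmetric] algebra_simps)
  qed
qed

text \<open>Apply the tangent line to each slope \<open>a i / h i\<close> and weight it by
  \<open>h i\<close>: this is discrete Jensen. It merges all corners that a polygonal makes inside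
  one interval.\<close>

lemma sum_powr_le:
  fixes a h :: "'i \<Rightarrow> real"
  assumes p: "p > 1" and "finite I" and a: "\<And>i. i \<in> I \<Longrightarrow> a i \<ge> 0" and h: "\<And>i. i \<in> I \<Longrightarrow> h i > 0"
  shows "(\<Sum>i\<in>I. a i) powr p \<le> (\<Sum>i\<in>I. a i powr p / h i powr (p - 1)) * (\<Sum>i\<in>I. h i) powr (p - 1)"
proof (rule powr_le_of_tangent_lines[OF p])
  show "0 \<le> sum h I" using h by (force intro: sum_nonneg)
  show "0 \<le> sum a I" using a by (force intro: sum_nonneg)
next
  fix l :: real assume l: "l \<ge> 0"
  have "h i * l powr p + p * l powr (p - 1) * (a i - h i * l) \<le> a i powr p / h i powr (p - 1)"
    if i: "i \<in> I" for i
  proof -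
    have "h i * (l powr p + p * l powr (p - 1) * (a i / h i - l)) \<le> h i * (a i / h i) powr p"
      using powr_tangent_line[OF p, of "a i / h i" l] a[OF i] h[OF i] l by simp
    moreover have "h i * (a i / h i) powr p = a i powr p / h i powr (p - 1)"
      using h[OF i] a[OF i] by (simp add: powr_divide powr_diff)
    moreover have "h i * (l powr p + p * l powr (p - 1) * (a i / h i - l))
        = h i * l powr p + p * l powr (p - 1) * (a i - h i * l)"
      using h[OF i] by (simp add: field_simps)
    ultimately show ?thesis by simp
  qed
  then have "(\<Sum>i\<in>I. h i * l powr p + p * l powr (p - 1) * (a i - h i * l))
      \<le> (\<Sum>i\<in>I. a i powr p / h i powr (p - 1))"
    by (rule sum_mono)
  then show "sum h I * l powr p + p * l powr (p - 1) * (sum a I - sum h I * l)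
      \<le> (\<Sum>i\<in>I. a i powr p / h i powr (p - 1))"
    by (simp add: sum.distrib sum_distrib_left sum_distrib_right sum_subtractf algebra_simps)
qed

section \<open>Passing between nonnegative Lebesgue integrals and gauge integrals\<close>

lemma set_nn_integral_eq_integral:
  fixes f :: "'a::euclidean_space \<Rightarrow> real"
  assumes "\<And>x. x \<in> S \<Longrightarrow> 0 \<le> f x" "f integrable_on S"
  shows "(\<integral>\<^sup>+x\<in>S. ennreal (f x) \<partial>lebesgue) = ennreal (integral S f)"
  using nn_integral_has_integral_lebesgue'[of S f "integral S f"] assms
  by (simp add: nn_integral_completion has_integral_integral)

lemma integrable_on_of_nn_integral:
  fixes f :: "'a::euclidean_space \<Rightarrow> real"
  assumes m: "f \<in> borel_measurable (lebesgue_on S)" and S: "S \<in> sets lebesgue"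
    and nn: "\<And>x. x \<in> S \<Longrightarrow> 0 \<le> f x"
    and fin: "(\<integral>\<^sup>+x\<in>S. ennreal (f x) \<partial>lebesgue) < \<infinity>"
  shows "f integrable_on S"
proof -
  have "integrable (lebesgue_on S) f"
  proof (rule integrableI_bounded[OF m])
    have "(\<integral>\<^sup>+x. ennreal (norm (f x)) \<partial>lebesgue_on S) = (\<integral>\<^sup>+x\<in>S. ennreal (f x) \<partial>lebesgue)"
      using S nn by (subst nn_integral_restrict_space) (auto intro!: nn_integral_cong simp: indicator_def)
    then show "(\<integral>\<^sup>+x. ennreal (norm (f x)) \<partial>lebesgue_on S) < \<infinity>" using fin by simp
  qed
  then show ?thesis by (rule integrable_on_lebesgue_on[OF _ S])
qed

lemma has_integral_measurable:
  fixes f :: "'a::euclidean_space \<Rightarrow> 'b::euclidean_space"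
  assumes "f integrable_on S" "S \<in> sets lebesgue"
  shows "f \<in> borel_measurable (lebesgue_on S)"
  using has_integral_implies_lebesgue_measurable[OF integrable_integral[OF assms(1)]] assms(2)
  by (simp add: borel_measurable_restrict_space_iff mult.commute)

section \<open>Lower bound for the energy of a rounded corner\<close>

text \<open>Sum to product: half of \<open>A + B\<close> and half the distance of \<open>A\<close>
  and \<open>B\<close> are both at most \<open>t / 2\<close>, and the cosine decreases there. With
  \<open>A\<close>, \<open>B\<close> the angles of a unit vector to two directions enclosing the
  angle \<open>t\<close>, this bounds its inner product with their sum from below.\<close>

lemma cos_add_cos_ge:
  fixes A B t :: real
  assumes "A + B \<le> t" "0 \<le> A" "0 \<le> B" "t \<le> pi"
  shows "1 + cos t \<le> cos A + cos B"
proof -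
  have "cos A + cos B = 2 * (cos ((A + B) / 2) * cos ((A - B) / 2))"
    by (simp add: cos_plus_cos field_simps)
  moreover have "1 + cos t = 2 * (cos (t / 2) * cos (t / 2))"
    using cos_double_cos[of "t / 2"] by (simp add: power2_eq_square)
  moreover have "cos (t / 2) \<le> cos ((A + B) / 2)"
    using assms by (intro cos_monotone_0_pi_le) auto
  moreover have "cos (t / 2) \<le> cos (\<bar>A - B\<bar> / 2)"
    using assms by (intro cos_monotone_0_pi_le) auto
  moreover have "cos (\<bar>A - B\<bar> / 2) = cos ((A - B) / 2)"
    using cos_abs_real[of "(A - B) / 2"] by (simp add: abs_divide)
  moreover have "0 \<le> cos (t / 2)" using assms by (intro cos_ge_zero) auto
  ultimately show ?thesis by (simp add: mult_mono)
qed

text \<open>Strictly inside a piece the derivative within the closed piece is an ordinary one, so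
  only the break points have to be excepted.\<close>

lemma finite_deriv_exceptions:
  assumes "piecewise_C1 f a b"
  obtains S where "finite S" "\<And>s. s \<in> {a..b} - S \<Longrightarrow> \<exists>D. (f has_vector_derivative D) (at s)"
proof -
  obtain ts where ts: "is_partition a b ts" and D: "\<And>i. i < length ts - 1 \<Longrightarrow>
      \<exists>D. continuous_on {ts ! i..ts ! Suc i} D \<and> (\<forall>x\<in>{ts ! i..ts ! Suc i}.
              (f has_vector_derivative D x) (at x within {ts ! i..ts ! Suc i}))"
    using assms unfolding piecewise_C1_def by blast
  have "\<exists>D. (f has_vector_derivative D) (at s)" if s: "s \<in> {a..b} - set ts" for s
  proof -
    \<comment> \<open>\<open>Max J\<close> is the last break point before \<open>s\<close>, hence
      the index of the piece around \<open>s\<close>.\<close>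
    define J where "J = {j. j < length ts \<and> ts ! j < s}"
    have ne: "ts \<noteq> []" and srt: "sorted_wrt (<) ts" and h: "ts ! 0 = a" and l: "ts ! (length ts - 1) = b"
      using ts by (auto simp: is_partition_def hd_conv_nth last_conv_nth)
    have "a \<in> set ts" "b \<in> set ts"
      using ne h l nth_mem[of 0 ts] nth_mem[of "length ts - 1" ts] by auto
    then have sab: "a < s" "s < b" using s by (auto simp: order.strict_iff_order)
    have fJ: "finite J" and J0: "0 \<in> J" using ne h sab by (auto simp: J_def)
    define i where "i = Max J"
    have iJ: "i \<in> J" using fJ J0 unfolding i_def by (metis Max_in empty_iff)
    have "i \<noteq> length ts - 1" using iJ l sab by (auto simp: J_def)
    then have i: "i < length ts - 1" using iJ by (auto simp: J_def)
    have "Suc i \<notin> J" using Max_ge[OF fJ, of "Suc i"] by (auto simp: i_def)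
    then have "s \<le> ts ! Suc i" using i by (auto simp: J_def)
    moreover have "s \<noteq> ts ! Suc i" using s i by auto
    ultimately have si: "s \<in> {ts ! i<..<ts ! Suc i}" using iJ by (auto simp: J_def)
    obtain D' where "(f has_vector_derivative D' s) (at s within {ts ! i..ts ! Suc i})"
      using D[OF i] si by (meson atLeastAtMost_iff greaterThanLessThan_iff less_imp_le)
    then show ?thesis using si by (auto simp: at_within_Icc_at)
  qed
  then show ?thesis using that[of "set ts"] by blast
qed

text \<open>As \<open>d\<close> is orthogonal to \<open>t\<close>, only the component of
  \<open>u\<close> orthogonal to \<open>t\<close> contributes. The square root is the one in the
  derivative of \<open>arccos\<close>, so the angle between \<open>t\<close> and \<open>u\<close>
  changes at most at speed \<open>norm d\<close>.\<close>

lemma inner_deriv_le: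
  fixes t u d :: "'a::real_inner"
  assumes "norm t = 1" "norm u = 1" "t \<bullet> d = 0"
  shows "\<bar>d \<bullet> u\<bar> \<le> norm d * sqrt (1 - (t \<bullet> u)\<^sup>2)"
proof -
  have "d \<bullet> u = d \<bullet> (u - (t \<bullet> u) *\<^sub>R t)"
    using assms by (simp add: inner_diff_right inner_commute)
  moreover have "(norm (u - (t \<bullet> u) *\<^sub>R t))\<^sup>2 = 1 - (t \<bullet> u)\<^sup>2"
  proof -
    have "u \<bullet> u = 1" "t \<bullet> t = 1" using assms by (auto simp: norm_eq_sqrt_inner)
    then show ?thesis
      unfolding power2_norm_eq_inner by (simp add: inner_diff_left inner_diff_right inner_commute power2_eq_square)
  qed
  then have "norm (u - (t \<bullet> u) *\<^sub>R t) = sqrt (1 - (t \<bullet> u)\<^sup>2)"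
    by (metis norm_ge_zero real_sqrt_unique)
  ultimately show ?thesis using Cauchy_Schwarz_ineq2[of d "u - (t \<bullet> u) *\<^sub>R t"] by simp
qed

text \<open>Scaling the cosine by \<open>q < 1\<close> keeps \<open>arccos\<close> differentiable.\<close>

lemma angle_change_le_length:
  fixes T a :: "real \<Rightarrow> 'a::euclidean_space"
  assumes xy: "x \<le> y" and fin: "finite S" and cont: "continuous_on {x..y} T"
    and unit: "\<And>s. s \<in> {x..y} \<Longrightarrow> norm (T s) = 1" and u: "norm u = 1"
    and deriv: "\<And>s. s \<in> {x<..<y} - S \<Longrightarrow> (T has_vector_derivative a s) (at s)"
    and int: "(\<lambda>s. norm (a s)) integrable_on {x..y}"
  shows "\<bar>arccos (T y \<bullet> u) - arccos (T x \<bullet> u)\<bar> \<le> integral {x..y} (\<lambda>s. norm (a s))"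
proof -
  let ?I = "integral {x..y} (\<lambda>s. norm (a s))"
  have bd: "\<bar>T s \<bullet> u\<bar> \<le> 1" if "s \<in> {x..y}" for s
    using Cauchy_Schwarz_ineq2[of "T s" u] unit[OF that] u by simp
  \<comment> \<open>A curve of unit vectors is orthogonal to its derivative: differentiate the
    constant squared norm.\<close>
  have orth: "T s \<bullet> a s = 0" if s: "s \<in> {x<..<y} - S" for s
  proof -
    have "((\<lambda>s. T s \<bullet> T s) has_derivative (\<lambda>h. T s \<bullet> (h *\<^sub>R a s) + (h *\<^sub>R a s) \<bullet> T s)) (at s)"
      using deriv[OF s] unfolding has_vector_derivative_def by (auto intro!: derivative_eq_intros)
    moreover have "((\<lambda>s. T s \<bullet> T s) has_derivative (\<lambda>h. 0)) (at s)"
    proof (rule has_derivative_transform_within_open[of "\<lambda>_. 1" _ _ _ "{x<..<y}"])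
      show "1 = T z \<bullet> T z" if "z \<in> {x<..<y}" for z
        using unit[of z] that by (auto simp: norm_eq_sqrt_inner)
    qed (use s in auto)
    ultimately have "(\<lambda>h. T s \<bullet> (h *\<^sub>R a s) + (h *\<^sub>R a s) \<bullet> T s) = (\<lambda>h. 0)"
      by (rule has_derivative_unique)
    from fun_cong[OF this, of 1] show ?thesis by (simp add: inner_commute)
  qed
  have q: "\<bar>arccos (q * (T y \<bullet> u)) - arccos (q * (T x \<bullet> u))\<bar> \<le> ?I" if q: "0 < q" "q < 1" for q
  proof -
    define F where "F = (\<lambda>s. arccos (q * (T s \<bullet> u)))"
    define F' where "F' = (\<lambda>s. inverse (- sqrt (1 - (q * (T s \<bullet> u))\<^sup>2)) * (q * (a s \<bullet> u)))"
    have lt: "\<bar>q * (T s \<bullet> u)\<bar> < 1" if "s \<in> {x..y}" for s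
    proof -
      have "\<bar>q * (T s \<bullet> u)\<bar> \<le> q * 1"
        unfolding abs_mult using bd[OF that] q by (intro mult_mono) auto
      then show ?thesis using q by simp
    qed
    have F: "(F has_vector_derivative F' s) (at s)" if s: "s \<in> {x<..<y} - S" for s
    proof -
      have "((\<lambda>s. T s \<bullet> u) has_real_derivative a s \<bullet> u) (at s)"
        using deriv[OF s] unfolding has_vector_derivative_def has_field_derivative_def
        by (auto intro!: derivative_eq_intros simp: mult.commute)
      then have "((\<lambda>s. q * (T s \<bullet> u)) has_real_derivative q * (a s \<bullet> u)) (at s)"
        by (rule DERIV_cmult)
      moreover have "DERIV arccos (q * (T s \<bullet> u)) :> inverse (- sqrt (1 - (q * (T s \<bullet> u))\<^sup>2))"
        using lt[of s] s by (intro DERIV_arccos) auto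
      ultimately show ?thesis unfolding F_def F'_def
        by (metis DERIV_chain2 has_real_derivative_iff_has_vector_derivative)
    qed
    have "continuous_on {x..y} F" unfolding F_def
    proof (intro continuous_on_arccos continuous_intros cont ballI conjI)
      show "-1 \<le> q * (T s \<bullet> u)" "q * (T s \<bullet> u) \<le> 1" if "s \<in> {x..y}" for s
        using lt[OF that] by auto
    qed
    then have int': "(F' has_integral (F y - F x)) {x..y}"
      by (intro fundamental_theorem_of_calculus_interior_strong[OF fin xy F])
    have le: "norm (F' s) \<le> norm (a s)" if s: "s \<in> {x<..<y} - S" for s
    proof -
      have s': "s \<in> {x..y}" using s by auto
      have pos: "0 < 1 - (q * (T s \<bullet> u))\<^sup>2" using lt[OF s'] by (simp add: abs_square_less_1)
      \<comment> \<open>The factor \<open>q\<close> is absorbed here: \<open>q^2 * (1 - x^2)\<close>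
        is at most \<open>1 - (q * x)^2\<close> because \<open>q < 1\<close>.\<close>
      have "q * sqrt (1 - (T s \<bullet> u)\<^sup>2) = sqrt (q\<^sup>2 * (1 - (T s \<bullet> u)\<^sup>2))"
        using q by (simp add: real_sqrt_mult)
      also have "\<dots> \<le> sqrt (1 - (q * (T s \<bullet> u))\<^sup>2)"
        using q by (simp add: algebra_simps power_mult_distrib abs_square_le_1)
      finally have "q * sqrt (1 - (T s \<bullet> u)\<^sup>2) \<le> sqrt (1 - (q * (T s \<bullet> u))\<^sup>2)" .
      then have "norm (a s) * (q * sqrt (1 - (T s \<bullet> u)\<^sup>2)) \<le> norm (a s) * sqrt (1 - (q * (T s \<bullet> u))\<^sup>2)"
        by (rule mult_left_mono) simp
      moreover have "q * \<bar>a s \<bullet> u\<bar> \<le> q * (norm (a s) * sqrt (1 - (T s \<bullet> u)\<^sup>2))"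
        using inner_deriv_le[OF unit[OF s'] u orth[OF s]] q by (intro mult_left_mono) auto
      ultimately have "q * \<bar>a s \<bullet> u\<bar> \<le> norm (a s) * sqrt (1 - (q * (T s \<bullet> u))\<^sup>2)"
        by (simp add: mult.left_commute)
      then show ?thesis using pos q by (simp add: F'_def abs_mult field_simps)
    qed
    \<comment> \<open>At the exceptional points the bound by \<open>norm (a s)\<close> may fail;
      changing the integrand there leaves the integral alone.\<close>
    define F'' where "F'' = (\<lambda>s. if s \<in> S \<union> {x, y} then 0 else F' s)"
    have "(F'' has_integral (F y - F x)) {x..y}"
      by (rule has_integral_spike_finite[OF _ _ int', of "S \<union> {x,y}"]) (use fin in \<open>auto simp: F''_def\<close>)
    moreover have "norm (F'' s) \<le> norm (a s)" if "s \<in> {x..y}" for s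
      using le[of s] that by (cases "s \<in> S \<union> {x, y}") (auto simp: F''_def)
    ultimately have "norm (F y - F x) \<le> ?I"
      using integral_norm_bound_integral[of F'' "{x..y}" "\<lambda>s. norm (a s)"] int
      by (metis has_integral_iff)
    then show ?thesis by (simp add: F_def)
  qed
  have lim: "((\<lambda>q. arccos (q * z)) \<longlongrightarrow> arccos z) (at_left 1)" if "\<bar>z\<bar> \<le> 1" for z :: real
  proof -
    have "continuous_on {0..1} (\<lambda>q. arccos (q * z))"
    proof (intro continuous_on_arccos continuous_intros ballI conjI)
      fix q :: real assume "q \<in> {0..1}"
      then have "\<bar>q * z\<bar> \<le> 1" using that by (auto simp: abs_mult intro!: mult_le_one)
      then show "- 1 \<le> q * z" "q * z \<le> 1" by auto
    qed
    then have "((\<lambda>q. arccos (q * z)) \<longlongrightarrow> arccos (1 * z)) (at 1 within {0..1})"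
      unfolding continuous_on_def by (rule bspec) simp
    then show ?thesis by (simp add: at_within_Icc_at_left)
  qed
  have "((\<lambda>q. \<bar>arccos (q * (T y \<bullet> u)) - arccos (q * (T x \<bullet> u))\<bar>) \<longlongrightarrow>
      \<bar>arccos (T y \<bullet> u) - arccos (T x \<bullet> u)\<bar>) (at_left 1)"
    using bd xy by (intro tendsto_rabs tendsto_diff lim) auto
  moreover have "eventually (\<lambda>q. \<bar>arccos (q * (T y \<bullet> u)) - arccos (q * (T x \<bullet> u))\<bar> \<le> ?I) (at_left (1::real))"
    unfolding eventually_at_left_field using q zero_less_one by blast
  ultimately show ?thesis using tendsto_upperbound trivial_limit_at_left_real by blast
qed

lemma turning_angle_bounds: "0 \<le> turning_angle x y z" "turning_angle x y z \<le> pi"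
  and cos_turning_angle: "cos (turning_angle x y z) = ((y - x) \<bullet> (z - y)) / (norm (y - x) * norm (z - y))"
proof -
  have "\<bar>((y - x) \<bullet> (z - y)) / (norm (y - x) * norm (z - y))\<bar> \<le> 1"
    using Cauchy_Schwarz_ineq2[of "y - x" "z - y"]
    by (cases "norm (y - x) * norm (z - y) = 0") (auto simp: abs_divide divide_le_eq_1)
  note * = this[unfolded abs_le_iff]
  show "0 \<le> turning_angle x y z" "turning_angle x y z \<le> pi"
    "cos (turning_angle x y z) = ((y - x) \<bullet> (z - y)) / (norm (y - x) * norm (z - y))"
    unfolding turning_angle_def using * by (auto intro!: arccos_lbound arccos_ubound cos_arccos)
qed

text \<open>Up to time \<open>s\<close> the tangent has spent part of the total curvature on leaving
  \<open>u\<close>, and it needs the rest to reach \<open>v\<close>; so its angles to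
  \<open>u\<close> and \<open>v\<close> add up to at most the turning angle, and its inner product
  with \<open>u + v\<close> is at least \<open>1 + cos th\<close>. The displacement between the
  midpoints has inner product \<open>(norm (y - x) + norm (z - y)) / 2 * (1 + cos th)\<close> with
  \<open>u + v\<close>. Dividing by \<open>1 + cos th > 0\<close> bounds the length. The energy
  bound is Jensen applied to the total curvature.\<close>

lemma rounding_bounds:
  fixes g :: "real \<Rightarrow> 'a::euclidean_space"
  assumes r: "rounds_corner x y z len g" and xy: "x \<noteq> y" "y \<noteq> z" and th: "turning_angle x y z < pi"
  shows "len \<le> (norm (y - x) + norm (z - y)) / 2"
    and "p > 1 \<Longrightarrow> ennreal (turning_angle x y z powr p / len powr (p - 1)) \<le> p_energy p len g"
proof -
  define T where "T = tangent len g"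
  define a where "a = acceleration len g"
  define u where "u = (1 / norm (y - x)) *\<^sub>R (y - x)"
  define v where "v = (1 / norm (z - y)) *\<^sub>R (z - y)"
  define th where "th = turning_angle x y z"
  have len: "0 < len" and unit: "\<And>s. s \<in> {0..len} \<Longrightarrow> norm (T s) = 1"
    and cont: "continuous_on {0..len} T" and pc: "piecewise_C1 T 0 len"
    and dif: "\<And>s. s \<in> {0..len} \<Longrightarrow> g differentiable (at s within {0..len})"
    using r by (auto simp: rounds_corner_def piecewise_smooth_curve_def T_def)
  have ends: "T 0 = u" "T len = v" "g 0 = midpoint x y" "g len = midpoint y z"
    and tc: "total_curvature len g = ennreal th"
    using r by (auto simp: rounds_corner_def T_def u_def v_def th_def)
  have nu: "norm u = 1" and nv: "norm v = 1" using xy by (auto simp: u_def v_def)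
  have uv: "u \<bullet> v = cos th" unfolding th_def cos_turning_angle by (simp add: u_def v_def)
  have thb: "0 \<le> th" "th < pi" using th turning_angle_bounds by (auto simp: th_def)
  obtain S where S: "finite S" "\<And>s. s \<in> {0..len} - S \<Longrightarrow> \<exists>D. (T has_vector_derivative D) (at s)"
    using finite_deriv_exceptions[OF pc] by blast
  have deriv: "(T has_vector_derivative a s) (at s)" if s: "s \<in> {0<..<len} - S" for s
  proof -
    have "a s = vector_derivative T (at s)"
      using s by (simp add: a_def acceleration_def T_def at_within_Icc_at)
    moreover have "s \<in> {0..len} - S" using s by auto
    ultimately show ?thesis using S(2)[of s] by (auto simp: vector_derivative_at)
  qed
  \<comment> \<open>The acceleration is measurable because it is gauge integrable; this turns the
    nonnegative integrals of the definitions into ordinary ones.\<close>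
  have "(a has_integral T len - T 0) {0..len}"
    by (rule fundamental_theorem_of_calculus_interior_strong[OF S(1)]) (use len deriv cont in auto)
  then have am: "a \<in> borel_measurable (lebesgue_on {0..len})"
    by (intro has_integral_measurable) auto
  have tc': "(\<integral>\<^sup>+s\<in>{0..len}. ennreal (norm (a s)) \<partial>lebesgue) = ennreal th"
    using tc by (simp add: total_curvature_def a_def)
  have nint: "(\<lambda>s. norm (a s)) integrable_on {0..len}"
    using am tc' by (intro integrable_on_of_nn_integral) auto
  have Ith: "integral {0..len} (\<lambda>s. norm (a s)) = th"
    using tc' set_nn_integral_eq_integral[OF _ nint] thb integral_nonneg[OF nint] by simp
  have wedge: "1 + cos th \<le> T s \<bullet> (u + v)" if s: "s \<in> {0..len}" for s
  proof -
    have i: "(\<lambda>s. norm (a s)) integrable_on {0..s}" "(\<lambda>s. norm (a s)) integrable_on {s..len}"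
      using nint s by (auto intro: integrable_on_subinterval)
    have "\<bar>arccos (T s \<bullet> u) - arccos (T 0 \<bullet> u)\<bar> \<le> integral {0..s} (\<lambda>s. norm (a s))"
      by (rule angle_change_le_length[OF _ S(1) _ _ nu deriv i(1)])
        (use s unit in \<open>auto intro: continuous_on_subset[OF cont]\<close>)
    moreover have "\<bar>arccos (T len \<bullet> v) - arccos (T s \<bullet> v)\<bar> \<le> integral {s..len} (\<lambda>s. norm (a s))"
      by (rule angle_change_le_length[OF _ S(1) _ _ nv deriv i(2)])
        (use s unit in \<open>auto intro: continuous_on_subset[OF cont]\<close>)
    moreover have "T 0 \<bullet> u = 1" "T len \<bullet> v = 1" using ends nu nv by (auto simp: norm_eq_1)
    moreover have "integral {0..s} (\<lambda>s. norm (a s)) + integral {s..len} (\<lambda>s. norm (a s)) = th"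
      unfolding Ith[symmetric] using s by (intro Henstock_Kurzweil_Integration.integral_combine nint) auto
    ultimately have AB: "arccos (T s \<bullet> u) + arccos (T s \<bullet> v) \<le> th" by simp
    have "\<bar>T s \<bullet> w\<bar> \<le> 1" if "norm w = 1" for w
      using Cauchy_Schwarz_ineq2[of "T s" w] unit[OF s] that by simp
    from this[OF nu] this[OF nv] have "cos (arccos (T s \<bullet> u)) = T s \<bullet> u" "cos (arccos (T s \<bullet> v)) = T s \<bullet> v"
      "0 \<le> arccos (T s \<bullet> u)" "0 \<le> arccos (T s \<bullet> v)"
      by (auto intro: cos_arccos_abs arccos_lbound simp: abs_le_iff)
    then show ?thesis using cos_add_cos_ge[OF AB] thb by (simp add: inner_add_right)
  qed
  have gd: "(g has_vector_derivative T s) (at s within {0..len})" if "s \<in> {0..len}" for s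
    unfolding T_def tangent_def using dif[OF that] vector_derivative_works by blast
  have "(T has_integral g len - g 0) {0..len}"
    using len gd by (intro fundamental_theorem_of_calculus) auto
  then have "((\<lambda>s. T s \<bullet> (u + v)) has_integral (g len - g 0) \<bullet> (u + v)) {0..len}"
    by (rule has_integral_linear[OF _ bounded_linear_inner_left, unfolded o_def])
  note A = this
  have B: "((\<lambda>s. 1 + cos th) has_integral len * (1 + cos th)) {0..len}"
    using has_integral_const_real[of "1 + cos th" 0 len] len by simp
  have "len * (1 + cos th) \<le> (g len - g 0) \<bullet> (u + v)"
    using has_integral_le[OF B A wedge] by simp
  also have "g len - g 0 = (norm (y - x) / 2) *\<^sub>R u + (norm (z - y) / 2) *\<^sub>R v"
    using xy by (simp add: ends u_def v_def midpoint_def scaleR_right_diff_distrib scaleR_right_distrib)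
  also have "\<dots> \<bullet> (u + v) = (norm (y - x) + norm (z - y)) / 2 * (1 + cos th)"
    using nu nv uv by (simp add: inner_add_left inner_add_right norm_eq_1 inner_commute field_simps)
  finally show "len \<le> (norm (y - x) + norm (z - y)) / 2"
    using cos_monotone_0_pi[of th pi] thb by simp
  show "ennreal (turning_angle x y z powr p / len powr (p - 1)) \<le> p_energy p len g" if p: "p > 1"
  proof (cases "p_energy p len g < \<infinity>")
    case True
    have "(\<lambda>s. norm (a s) powr p) integrable_on {0..len}"
      using am True by (intro integrable_on_of_nn_integral) (auto simp: p_energy_def a_def)
    note pint = this
    have pe: "p_energy p len g = ennreal (integral {0..len} (\<lambda>s. norm (a s) powr p))"
      using set_nn_integral_eq_integral[OF _ pint] by (simp add: p_energy_def a_def)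
    have "norm th powr p \<le> integral {0..len} (\<lambda>s. norm (norm (a s)) powr p) * (len - 0) powr (p - 1)"
      by (rule norm_integral_powr_le[OF p]) (use len nint Ith pint in \<open>auto simp: has_integral_iff\<close>)
    then have "th powr p / len powr (p - 1) \<le> integral {0..len} (\<lambda>s. norm (a s) powr p)"
      using len thb by (simp add: field_simps)
    then show ?thesis unfolding pe th_def by (rule ennreal_leI)
  qed (use less_top[of "p_energy p len g"] in simp)
qed

lemma corner_energy_ge:
  fixes x y z :: "'a::euclidean_space"
  assumes p: "p > 1" and xy: "x \<noteq> y" "y \<noteq> z"
  shows "ennreal (turning_angle x y z powr p / ((norm (y - x) + norm (z - y)) / 2) powr (p - 1))
    \<le> corner_energy p x y z"
proof (cases "turning_angle x y z = pi")
  case False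
  then have th: "turning_angle x y z < pi" using turning_angle_bounds(2)[of x y z] by simp
  have "ennreal (turning_angle x y z powr p / ((norm (y - x) + norm (z - y)) / 2) powr (p - 1))
      \<le> p_energy p len g" if r: "rounds_corner x y z len g" for len g
  proof -
    have len: "0 < len" using r by (simp add: rounds_corner_def piecewise_smooth_curve_def)
    have "turning_angle x y z powr p / ((norm (y - x) + norm (z - y)) / 2) powr (p - 1)
        \<le> turning_angle x y z powr p / len powr (p - 1)"
      using rounding_bounds(1)[OF r xy th] len p
      by (intro divide_left_mono powr_mono2 mult_pos_pos) auto
    then show ?thesis using rounding_bounds(2)[OF r xy th p] by (meson ennreal_leI order_trans)
  qed
  then show ?thesis using False by (auto simp: corner_energy_def intro!: INF_greatest)
qed (simp add: corner_energy_def)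

section \<open>Rounding a corner by a circular arc\<close>

text \<open>Rounding curves are prescribed by their unit tangent and then integrated.
  \<open>tangent len g\<close> is known to equal \<open>T\<close> on \<open>{0..len}\<close>, so
  derivatives are compared within subsets of that interval.\<close>

lemma curve_with_tangent:
  fixes T :: "real \<Rightarrow> 'a::euclidean_space" and m :: 'a
  assumes len: "0 < len" and cont: "continuous_on {0..len} T"
    and unit: "\<And>s. s \<in> {0..len} \<Longrightarrow> norm (T s) = 1" and pc: "piecewise_C1 T 0 len"
  defines "g \<equiv> \<lambda>s. m + integral {0..s} T"
  shows "piecewise_smooth_curve len g"
    and "\<And>s. s \<in> {0..len} \<Longrightarrow> tangent len g s = T s"
    and "\<And>s D. s \<in> {0<..<len} \<Longrightarrow> (T has_vector_derivative D) (at s) \<Longrightarrow> acceleration len g s = D"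
proof -
  have gd: "(g has_vector_derivative T s) (at s within {0..len})" if "s \<in> {0..len}" for s
    using has_vector_derivative_add[OF has_vector_derivative_const[of m] integral_has_vector_derivative[OF cont that]]
    unfolding g_def by simp
  then show tan: "tangent len g s = T s" if "s \<in> {0..len}" for s
    using that len unfolding tangent_def by (intro vector_derivative_within_closed_interval) auto
  have tvd: "(tangent len g has_vector_derivative D) (at s within J) \<longleftrightarrow> (T has_vector_derivative D) (at s within J)"
    if "s \<in> J" "J \<subseteq> {0..len}" for s D J
    using that tan by (intro has_vector_derivative_cong_ev)
      (auto simp: eventually_at_filter intro!: always_eventually)
  obtain ts where ts: "is_partition 0 len ts" and D: "\<And>i. i < length ts - 1 \<Longrightarrow>
      \<exists>D. continuous_on {ts ! i..ts ! Suc i} D \<and> (\<forall>x\<in>{ts ! i..ts ! Suc i}.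
              (T has_vector_derivative D x) (at x within {ts ! i..ts ! Suc i}))"
    using pc unfolding piecewise_C1_def by blast
  have sub: "{ts ! i..ts ! Suc i} \<subseteq> {0..len}" if "i < length ts - 1" for i
  proof -
    have le: "ts ! i \<le> ts ! j" if "i \<le> j" "j < length ts" for i j
      using ts that by (metis is_partition_def le_less sorted_wrt_iff_nth_less order_refl)
    have "ts \<noteq> []" "ts ! 0 = 0" "ts ! (length ts - 1) = len"
      using ts by (auto simp: is_partition_def hd_conv_nth last_conv_nth)
    then show ?thesis using le[of 0 i] le[of "Suc i" "length ts - 1"] that by auto
  qed
  have "piecewise_C1 (tangent len g) 0 len"
    unfolding piecewise_C1_def
  proof (rule exI[of _ ts], intro conjI allI impI ts)
    fix i assume i: "i < length ts - 1"
    show "\<exists>D. continuous_on {ts ! i..ts ! Suc i} D \<and> (\<forall>x\<in>{ts ! i..ts ! Suc i}.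
              (tangent len g has_vector_derivative D x) (at x within {ts ! i..ts ! Suc i}))"
      using D[OF i] tvd[OF _ sub[OF i]] by blast
  qed
  moreover have "continuous_on {0..len} (tangent len g)"
    using cont tan by (subst continuous_on_cong[OF refl tan]) auto
  ultimately show "piecewise_smooth_curve len g"
    unfolding piecewise_smooth_curve_def using len tan unit differentiableI_vector[OF gd] by auto
  show "acceleration len g s = D" if s: "s \<in> {0<..<len}" and "(T has_vector_derivative D) (at s)" for s D
  proof -
    have "(tangent len g has_vector_derivative D) (at s within {0..len})"
      using that by (subst tvd) (auto intro: has_vector_derivative_at_within)
    then show ?thesis unfolding acceleration_def
      using s len by (intro vector_derivative_within_closed_interval) auto
  qed
qed

text \<open>The rounding curve consists of a segment, a circular arc of radius \<open>R = d / tan (\<theta> / 2)\<close> and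
  another segment; choosing \<open>d\<close> strictly below the half-lengths keeps all three pieces
  non-degenerate.\<close>

lemma corner_energy_le:
  fixes x y z :: "'a::euclidean_space"
  assumes p: "p > 1" and d: "0 < d" "d < norm (y - x) / 2" "d < norm (z - y) / 2"
    and th: "turning_angle x y z < pi"
  shows "corner_energy p x y z
    \<le> ennreal (turning_angle x y z * (tan (turning_angle x y z / 2) / d) powr (p - 1))"
proof -
  define l1 where "l1 = norm (y - x)"
  define l2 where "l2 = norm (z - y)"
  define u where "u = (1 / l1) *\<^sub>R (y - x)"
  define v where "v = (1 / l2) *\<^sub>R (z - y)"
  define t where "t = turning_angle x y z"
  have l: "0 < l1" "0 < l2" using d by (auto simp: l1_def l2_def)
  have nu: "norm u = 1" and nv: "norm v = 1" using l by (auto simp: u_def v_def l1_def l2_def)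
  have uv: "u \<bullet> v = cos t" unfolding t_def cos_turning_angle by (simp add: u_def v_def l1_def l2_def)
  have t: "0 \<le> t" "t < pi" using th turning_angle_bounds by (auto simp: t_def)
  have mid: "midpoint x y + ((l1 / 2) *\<^sub>R u + (l2 / 2) *\<^sub>R v) = midpoint y z"
    using l by (simp add: u_def v_def midpoint_def scaleR_right_diff_distrib scaleR_right_distrib)
  have bound: "corner_energy p x y z \<le> p_energy p len g"
    if "piecewise_smooth_curve len g" "g 0 = midpoint x y" "tangent len g 0 = u"
      "g len = midpoint y z" "tangent len g len = v" "total_curvature len g = ennreal t" for len g
    using that th unfolding corner_energy_def
    by (auto simp: rounds_corner_def u_def v_def t_def l1_def l2_def intro!: INF_lower2[of "(len, g)"])
  show ?thesis
  \<comment> \<open>A straight corner determines no plane of rotation; the segment between the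
    midpoints serves, with zero acceleration.\<close>
  proof (cases "t = 0")
    case True
    have "(norm (u - v))\<^sup>2 = 0"
      using nu nv uv True unfolding power2_norm_eq_inner
      by (simp add: inner_diff_left inner_diff_right inner_commute norm_eq_1)
    then have vu: "v = u" by simp
    define len where "len = l1 / 2 + l2 / 2"
    have len: "0 < len" using l by (simp add: len_def)
    define g where "g = (\<lambda>s. midpoint x y + integral {0..s} (\<lambda>_::real. u))"
    have pc: "piecewise_C1 (\<lambda>_::real. u) 0 len"
      unfolding piecewise_C1_def
      by (rule exI[of _ "[0, len]"]) (use len in \<open>auto simp: is_partition_def intro!: exI[of _ "\<lambda>_. 0"]\<close>)
    note cw = curve_with_tangent[OF len _ _ pc, where m = "midpoint x y", folded g_def]
    have acc: "acceleration len g s = 0" if "s \<in> {0<..<len}" for s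
      using that nu by (intro cw) auto
    have ae: "AE s in lebesgue. s \<notin> {0, len}"
      by (rule AE_I'[of "{0,len}"]) (auto simp: negligible_iff_null_sets[symmetric])
    have nn: "(\<integral>\<^sup>+s\<in>{0..len}. ennreal (f (norm (acceleration len g s))) \<partial>lebesgue) = 0"
      if "f 0 = 0" for f :: "real \<Rightarrow> real"
    proof -
      have "(\<integral>\<^sup>+s\<in>{0..len}. ennreal (f (norm (acceleration len g s))) \<partial>lebesgue) = integral\<^sup>N lebesgue (\<lambda>s::real. 0)"
        using ae by (intro nn_integral_cong_AE, elim eventually_mono)
          (use acc that in \<open>auto simp: indicator_def\<close>)
      then show ?thesis by simp
    qed
    have tc: "total_curvature len g = 0" and pe: "p_energy p len g = 0"
      unfolding total_curvature_def p_energy_def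
      using nn[of "\<lambda>x. x"] nn[of "\<lambda>x. x powr p"] p by auto
    have "corner_energy p x y z \<le> p_energy p len g"
    proof (rule bound)
      show "g len = midpoint y z"
        unfolding mid[symmetric] using len by (simp add: g_def vu len_def scaleR_left_distrib)
      show "total_curvature len g = ennreal t" using tc True by simp
    qed (use cw nu len vu in \<open>auto simp: g_def\<close>)
    then show ?thesis using pe by simp
  next
    case False
    then have t0: "0 < t" using t by simp
    have st: "0 < sin t" using t t0 by (simp add: sin_gt_zero)
    \<comment> \<open>The unit vector orthogonal to \<open>u\<close> in the plane of the corner, on
      the side of \<open>v\<close>.\<close>
    define e where "e = (1 / sin t) *\<^sub>R (v - cos t *\<^sub>R u)"
    have v: "v = cos t *\<^sub>R u + sin t *\<^sub>R e" using st by (simp add: e_def)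
    have ue: "u \<bullet> e = 0" using nu uv by (simp add: e_def inner_diff_right norm_eq_1)
    have "v \<bullet> v = 1" "u \<bullet> u = 1" using nu nv by (auto simp: norm_eq_1)
    then have "(cos t)\<^sup>2 + (sin t)\<^sup>2 * (e \<bullet> e) = (cos t)\<^sup>2 + (sin t)\<^sup>2" unfolding sin_cos_squared_add2
      using ue unfolding v by (simp add: inner_add_left inner_add_right inner_commute power2_eq_square algebra_simps)
    then have "(sin t)\<^sup>2 * (e \<bullet> e) = (sin t)\<^sup>2 * 1" by linarith
    then have ee: "e \<bullet> e = 1" using st by (simp only: mult_cancel_left) auto
    have tan0: "0 < tan (t / 2)" using t t0 by (intro tan_gt_zero) auto
    define R where "R = d / tan (t / 2)"
    have R: "0 < R" using d tan0 by (simp add: R_def)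
    define k where "k = 1 / R"
    have k: "0 < k" "k * R = 1" using R by (auto simp: k_def)
    define a1 where "a1 = l1 / 2 - d"
    define b1 where "b1 = a1 + R * t"
    define len where "len = b1 + (l2 / 2 - d)"
    have ord: "0 < a1" "a1 < b1" "b1 < len" using d R t0 by (auto simp: a1_def b1_def len_def l1_def l2_def)
    then have len: "0 < len" by simp
    \<comment> \<open>The angle of the direction at \<open>s\<close>: 0 before the arc, growing at
      rate \<open>k\<close> on it, \<open>t\<close> after it. Clipping yields a single formula,
      which makes continuity immediate.\<close>
    define al where "al = (\<lambda>s. max 0 (min t (k * (s - a1))))"
    define T where "T = (\<lambda>s. cos (al s) *\<^sub>R u + sin (al s) *\<^sub>R e)"
    have kb: "k * (b1 - a1) = t" using k by (simp add: b1_def mult.commute mult.left_commute)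
    have al1: "al s = 0" if "s \<le> a1" for s
    proof -
      have "k * (s - a1) \<le> 0" using that k by (simp add: mult_le_0_iff)
      then show ?thesis using t0 by (simp add: al_def)
    qed
    have al2: "al s = k * (s - a1)" if "s \<in> {a1..b1}" for s
    proof -
      have "0 \<le> k * (s - a1)" "k * (s - a1) \<le> k * (b1 - a1)"
        using that k by (auto intro!: mult_left_mono)
      then show ?thesis unfolding kb by (simp add: al_def)
    qed
    have al3: "al s = t" if "b1 \<le> s" for s
    proof -
      have "k * (b1 - a1) \<le> k * (s - a1)" using that k by (intro mult_left_mono) auto
      then show ?thesis unfolding kb using t0 by (simp add: al_def)
    qed
    have T1: "T s = u" if "s \<le> a1" for s using al1[OF that] by (simp add: T_def)
    have T2: "T s = cos (k * (s - a1)) *\<^sub>R u + sin (k * (s - a1)) *\<^sub>R e" if "s \<in> {a1..b1}" for s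
      using al2[OF that] by (simp add: T_def)
    have T3: "T s = v" if "b1 \<le> s" for s using al3[OF that] by (simp add: T_def v)
    have cont: "continuous_on A T" for A unfolding T_def al_def by (intro continuous_intros)
    have unit: "norm (T s) = 1" for s
      using ue ee \<open>u \<bullet> u = 1\<close>
      by (simp add: T_def norm_eq_1 inner_add_left inner_add_right inner_commute flip: power2_eq_square)
    define D where "D = (\<lambda>s. (- k * sin (k * (s - a1))) *\<^sub>R u + (k * cos (k * (s - a1))) *\<^sub>R e)"
    have D: "((\<lambda>s. cos (k * (s - a1)) *\<^sub>R u + sin (k * (s - a1)) *\<^sub>R e) has_vector_derivative D s) (at s within J)" for s J
      unfolding D_def by (auto intro!: derivative_eq_intros simp: has_real_derivative_iff_has_vector_derivative[symmetric] mult.commute)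
    have nD: "norm (D s) = k" for s
    proof -
      have "(a *\<^sub>R u + b *\<^sub>R e) \<bullet> (a *\<^sub>R u + b *\<^sub>R e) = a\<^sup>2 + b\<^sup>2" for a b
        using ue ee \<open>u \<bullet> u = 1\<close>
        by (simp add: inner_add_left inner_add_right inner_commute power2_eq_square)
      then have "D s \<bullet> D s = k\<^sup>2 * ((sin (k * (s - a1)))\<^sup>2 + (cos (k * (s - a1)))\<^sup>2)"
        unfolding D_def by (simp only: power_mult_distrib distrib_left power2_minus mult_minus_left)
      then have "D s \<bullet> D s = k\<^sup>2" by simp
      then show ?thesis using k by (simp add: norm_eq_sqrt_inner)
    qed
    have d1: "(T has_vector_derivative 0) (at s within {0..a1})" if "s \<in> {0..a1}" for s
      by (rule has_vector_derivative_transform[of _ _ _ "\<lambda>_. u"]) (use that T1 in auto)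
    have d2: "(T has_vector_derivative D s) (at s within {a1..b1})" if "s \<in> {a1..b1}" for s
      by (rule has_vector_derivative_transform[OF that _ D]) (use T2 in auto)
    have d3: "(T has_vector_derivative 0) (at s within {b1..len})" if "s \<in> {b1..len}" for s
      by (rule has_vector_derivative_transform[of _ _ _ "\<lambda>_. v"]) (use that T3 in auto)
    have pc: "piecewise_C1 T 0 len"
      unfolding piecewise_C1_def
    proof (rule exI[of _ "[0, a1, b1, len]"], intro conjI allI impI)
      show "is_partition 0 len [0, a1, b1, len]" using ord by (simp add: is_partition_def)
      fix i assume "i < length [0, a1, b1, len] - 1"
      then have "i < 3" by simp
      then consider "i = 0" | "i = 1" | "i = 2" by linarith
      then show "\<exists>D. continuous_on {[0, a1, b1, len] ! i..[0, a1, b1, len] ! Suc i} D \<and>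
        (\<forall>x\<in>{[0, a1, b1, len] ! i..[0, a1, b1, len] ! Suc i}.
          (T has_vector_derivative D x) (at x within {[0, a1, b1, len] ! i..[0, a1, b1, len] ! Suc i}))"
      proof cases
        case 1 then show ?thesis using d1 by (auto intro!: exI[of _ "\<lambda>_. 0"])
      next
        case 2
        have "continuous_on {a1..b1} D" unfolding D_def by (intro continuous_intros)
        then show ?thesis using 2 d2 by (auto intro!: exI[of _ D])
      next
        case 3 then show ?thesis using d3 by (auto intro!: exI[of _ "\<lambda>_. 0"])
      qed
    qed
    define g where "g = (\<lambda>s. midpoint x y + integral {0..s} T)"
    note cw = curve_with_tangent[OF len cont unit pc, where m = "midpoint x y", folded g_def]
    have acc: "norm (acceleration len g s) = (if s \<in> {a1..b1} then k else 0)"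
      if s: "s \<in> {0..len} - {0, a1, b1, len}" for s
    proof -
      consider "s \<in> {0<..<a1}" | "s \<in> {a1<..<b1}" | "s \<in> {b1<..<len}" using s by fastforce
      then show ?thesis
      proof cases
        case 1
        then have "acceleration len g s = 0" using d1[of s] ord
          by (intro cw) (auto simp: at_within_Icc_at)
        then show ?thesis using 1 by simp
      next
        case 2
        then have "acceleration len g s = D s" using d2[of s] ord
          by (intro cw) (auto simp: at_within_Icc_at)
        then show ?thesis using 2 nD by simp
      next
        case 3
        then have "acceleration len g s = 0" using d3[of s] ord
          by (intro cw) (auto simp: at_within_Icc_at)
        then show ?thesis using 3 by simp
      qed
    qed
    have ae: "AE s in lebesgue. s \<notin> {0, a1, b1, len}"
      by (rule AE_I'[of "{0, a1, b1, len}"]) (auto simp: negligible_iff_null_sets[symmetric])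
    have nn: "(\<integral>\<^sup>+s\<in>{0..len}. ennreal (f (norm (acceleration len g s))) \<partial>lebesgue) = ennreal (f k * (R * t))"
      if f: "f 0 = 0" "0 \<le> f k" for f :: "real \<Rightarrow> real"
    proof -
      have "(\<integral>\<^sup>+s\<in>{0..len}. ennreal (f (norm (acceleration len g s))) \<partial>lebesgue)
          = (\<integral>\<^sup>+s. ennreal (f k) * indicator {a1..b1} s \<partial>lebesgue)"
        using ae by (intro nn_integral_cong_AE, elim eventually_mono)
          (use acc ord f in \<open>auto simp: indicator_def\<close>)
      also have "\<dots> = ennreal (f k) * ennreal (b1 - a1)"
        using ord by (subst nn_integral_cmult_indicator) auto
      also have "\<dots> = ennreal (f k * (R * t))"
        using f R t0 by (simp add: b1_def ennreal_mult)
      finally show ?thesis .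
    qed
    have tc: "total_curvature len g = ennreal t"
      unfolding total_curvature_def using nn[of "\<lambda>x. x"] k by (simp add: mult.assoc[symmetric])
    \<comment> \<open>The energy is \<open>k powr p\<close> on an arc of length
      \<open>R * t\<close>; as \<open>k * R = 1\<close>, this is
      \<open>t * k powr (p - 1)\<close>.\<close>
    have "k powr p = k * k powr (p - 1)" using k powr_mult_base[of k "p - 1"] by simp
    then have "k powr p * (R * t) = t * (k powr (p - 1) * (k * R))"
      by (simp only: ac_simps)
    then have "k powr p * (R * t) = t * k powr (p - 1)" using k by simp
    then have pe: "p_energy p len g = ennreal (t * (tan (t / 2) / d) powr (p - 1))"
      unfolding p_energy_def using nn[of "\<lambda>x. x powr p"] p by (simp add: k_def R_def)
    have "(T has_integral a1 *\<^sub>R u) {0..a1}"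
      using has_integral_const_real[of u 0 a1] ord
      by (rule_tac has_integral_eq[of _ "\<lambda>_. u"]) (auto simp: T1)
    moreover have "(T has_integral R *\<^sub>R (sin t *\<^sub>R u + (1 - cos t) *\<^sub>R e)) {a1..b1}"
    proof -
      define G where "G = (\<lambda>s. R *\<^sub>R (sin (k * (s - a1)) *\<^sub>R u - cos (k * (s - a1)) *\<^sub>R e))"
      have "(G has_vector_derivative T s) (at s within {a1..b1})" if "s \<in> {a1..b1}" for s
      proof -
        have "(G has_vector_derivative R *\<^sub>R ((k * cos (k * (s - a1))) *\<^sub>R u - (- k * sin (k * (s - a1))) *\<^sub>R e)) (at s within {a1..b1})"
          unfolding G_def
          by (auto intro!: derivative_eq_intros simp: has_real_derivative_iff_has_vector_derivative[symmetric] mult.commute)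
        moreover have "R * (k * c) = c" for c using k by (simp add: mult.assoc[symmetric] mult.commute)
        ultimately show ?thesis by (simp add: T2[OF that] scaleR_right_distrib)
      qed
      then have "(T has_integral G b1 - G a1) {a1..b1}"
        using ord by (intro fundamental_theorem_of_calculus) auto
      moreover have "G b1 - G a1 = R *\<^sub>R (sin t *\<^sub>R u + (1 - cos t) *\<^sub>R e)"
        unfolding G_def kb by (simp add: algebra_simps)
      ultimately show ?thesis by simp
    qed
    moreover have "(T has_integral (l2 / 2 - d) *\<^sub>R v) {b1..len}"
      using has_integral_const_real[of v b1 len] ord
      by (rule_tac has_integral_eq[of _ "\<lambda>_. v"]) (auto simp: T3 len_def)
    ultimately have "(T has_integral a1 *\<^sub>R u + R *\<^sub>R (sin t *\<^sub>R u + (1 - cos t) *\<^sub>R e) + (l2 / 2 - d) *\<^sub>R v) {0..len}"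
      using ord by (meson has_integral_combine less_imp_le order_trans)
    \<comment> \<open>Both tangent segments from the vertex to the arc have length \<open>d\<close>,
      so the arc leads from \<open>- d * u\<close> to \<open>d * v\<close> relative to the vertex;
      half-angle formulas confirm it.\<close>
    moreover have "R *\<^sub>R (sin t *\<^sub>R u + (1 - cos t) *\<^sub>R e) = d *\<^sub>R (u + v)"
    proof -
      have tt: "tan (t / 2) = sin t / (1 + cos t)"
        using tan_half[of "t / 2"] by (simp add: add.commute)
      have c1: "0 < 1 + cos t" using cos_monotone_0_pi[of t pi] t by simp
      have "R * sin t = d * (1 + cos t)" using st c1 by (simp add: R_def tt)
      moreover have "R * (1 - cos t) = d * sin t"
      proof -
        have "R * (1 - cos t) = d * ((1 + cos t) * (1 - cos t)) / sin t"
          using st c1 by (simp add: R_def tt)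
        also have "(1 + cos t) * (1 - cos t) = sin t * sin t"
          using sin_cos_squared_add[of t] by (simp add: power2_eq_square algebra_simps)
        finally show ?thesis using st by simp
      qed
      ultimately show ?thesis unfolding v by (simp add: scaleR_right_distrib scaleR_left_distrib distrib_left)
    qed
    ultimately have "integral {0..len} T = a1 *\<^sub>R u + d *\<^sub>R (u + v) + (l2 / 2 - d) *\<^sub>R v"
      by (simp add: integral_unique)
    then have int: "integral {0..len} T = (l1 / 2) *\<^sub>R u + (l2 / 2) *\<^sub>R v"
      by (simp add: a1_def algebra_simps)
    have "corner_energy p x y z \<le> p_energy p len g"
    proof (rule bound)
      show "g len = midpoint y z" using int mid by (simp add: g_def)
      show "tangent len g 0 = u" "tangent len g len = v" using cw(2) len T1 T3 ord by auto
    qed (use cw(1) tc in \<open>auto simp: g_def\<close>)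
    then show ?thesis using pe by (simp add: t_def)
  qed
qed

section \<open>Arc-length parameterizations and fine partitions\<close>

lemma is_partition_nth:
  assumes "is_partition a b ts"
  shows "ts ! 0 = a" "ts ! (length ts - 1) = b" "0 < length ts"
    "\<And>i j. i < j \<Longrightarrow> j < length ts \<Longrightarrow> ts ! i < ts ! j"
    "\<And>i. i < length ts \<Longrightarrow> ts ! i \<in> {a..b}"
proof -
  show *: "ts ! 0 = a" "ts ! (length ts - 1) = b" "0 < length ts"
    using assms by (auto simp: is_partition_def hd_conv_nth last_conv_nth)
  show **: "ts ! i < ts ! j" if "i < j" "j < length ts" for i j
    using assms that by (auto simp: is_partition_def sorted_wrt_iff_nth_less)
  show "ts ! i \<in> {a..b}" if "i < length ts" for i
  proof -
    have "a \<le> ts ! i" using **[of 0 i] that * by (cases "i = 0") auto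
    moreover have "ts ! i \<le> b" using **[of i "length ts - 1"] that * by (cases "i = length ts - 1") (auto simp: less_imp_le)
    ultimately show ?thesis by simp
  qed
qed

lemma sum_dist_le_telescope:
  assumes ts: "is_partition a b ts"
    and le: "\<And>x y. a \<le> x \<Longrightarrow> x \<le> y \<Longrightarrow> y \<le> b \<Longrightarrow> dist (c x) (c y) \<le> f y - f x"
  shows "(\<Sum>i<length ts - 1. dist (c (ts ! i)) (c (ts ! Suc i))) \<le> f b - f a"
proof -
  note n = is_partition_nth[OF ts]
  have "(\<Sum>i<length ts - 1. dist (c (ts ! i)) (c (ts ! Suc i)))
      \<le> (\<Sum>i<length ts - 1. f (ts ! Suc i) - f (ts ! i))"
  proof (rule sum_mono)
    fix i assume "i \<in> {..<length ts - 1}"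
    then show "dist (c (ts ! i)) (c (ts ! Suc i)) \<le> f (ts ! Suc i) - f (ts ! i)"
      using n(4)[of i "Suc i"] n(5)[of i] n(5)[of "Suc i"] by (intro le) (force simp: less_imp_le)+
  qed
  also have "\<dots> = f b - f a"
    using n(1,2) by (subst sum_lessThan_telescope) simp
  finally show ?thesis .
qed

text \<open>Appending \<open>y\<close> to a partition of \<open>{0..x}\<close> adds
  \<open>dist (c x) (c y)\<close> to its sum, which stays at most \<open>y\<close>; the supremum
  over the partitions of \<open>{0..x}\<close> is \<open>x\<close>.\<close>

lemma arclength_dist_le:
  assumes c: "arclength_parameterized c L" and xy: "0 \<le> x" "x \<le> y" "y \<le> L"
  shows "dist (c x) (c y) \<le> y - x"
proof (cases "x = y")
  case False
  then have lt: "x < y" using xy by simp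
  have cx: "curve_length c 0 x = ennreal x" and cy: "curve_length c 0 y = ennreal y"
    using c xy by (auto simp: arclength_parameterized_def)
  have le: "(\<Sum>i<length ts - 1. dist (c (ts ! i)) (c (ts ! Suc i))) + dist (c x) (c y) \<le> y"
    if ts: "is_partition 0 x ts" for ts
  proof -
    note n = is_partition_nth[OF ts]
    have p: "is_partition 0 y (ts @ [y])"
      using ts lt n by (auto simp: is_partition_def sorted_wrt_append in_set_conv_nth) force
    have s: "Suc (length ts - 1) = length ts" using n(3) by simp
    have "(\<Sum>i<length ts. dist (c ((ts @ [y]) ! i)) (c ((ts @ [y]) ! Suc i)))
        = (\<Sum>i<length ts - 1. dist (c ((ts @ [y]) ! i)) (c ((ts @ [y]) ! Suc i)))
          + dist (c ((ts @ [y]) ! (length ts - 1))) (c ((ts @ [y]) ! length ts))"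
      by (subst s[symmetric], subst sum.lessThan_Suc) (simp only: s)
    also have "\<dots> = (\<Sum>i<length ts - 1. dist (c (ts ! i)) (c (ts ! Suc i))) + dist (c x) (c y)"
      using n by (auto simp: nth_append intro!: sum.cong)
    finally have "ennreal ((\<Sum>i<length ts - 1. dist (c (ts ! i)) (c (ts ! Suc i))) + dist (c x) (c y))
        \<le> curve_length c 0 y"
      unfolding curve_length_def using p by (intro SUP_upper2[of "ts @ [y]"]) auto
    then show ?thesis unfolding cy using xy by (subst (asm) ennreal_le_iff) auto
  qed
  \<comment> \<open>At \<open>x = 0\<close> the one-point list is the partition.\<close>
  have ex: "\<exists>ts. is_partition 0 x ts"
    using xy by (cases "x = 0") (auto simp: is_partition_def intro: exI[of _ "[0]"] exI[of _ "[0, x]"])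
  then have "dist (c x) (c y) \<le> y"
    using le by (smt (verit) sum_nonneg zero_le_dist)
  moreover have "curve_length c 0 x \<le> ennreal (y - dist (c x) (c y))"
    unfolding curve_length_def using le by (intro SUP_least ennreal_leI) (force simp: algebra_simps)
  ultimately show ?thesis unfolding cx by (subst (asm) ennreal_le_iff) auto
qed simp

text \<open>Speed at most 1 up to \<open>a\<close> and at most \<open>r\<close> from there to
  \<open>b\<close> would make the length up to \<open>b\<close> at most
  \<open>a + r * (b - a) < b\<close>. With \<open>r = 0\<close> this shows that \<open>c\<close> is
  constant on no interval; with \<open>norm (T x) < r < 1\<close> it bounds the tangent from
  below.\<close>

lemma arclength_no_contraction:
  assumes c: "arclength_parameterized c L" and ab: "0 \<le> a" "a < b" "b \<le> L" and r: "r < 1"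
    and le: "\<And>x y. a \<le> x \<Longrightarrow> x \<le> y \<Longrightarrow> y \<le> b \<Longrightarrow> dist (c x) (c y) \<le> r * (y - x)"
  shows False
proof -
  have "0 \<le> r * (b - a)" using le[of a b] ab zero_le_dist[of "c a" "c b"] by linarith
  then have r0: "0 \<le> r" using ab by (simp add: zero_le_mult_iff)
  define f where "f = (\<lambda>t. if t \<le> a then t else a + r * (t - a))"
  have d: "dist (c x) (c y) \<le> f y - f x" if xy: "0 \<le> x" "x \<le> y" "y \<le> b" for x y
  proof -
    consider "y \<le> a" | "x \<le> a" "a < y" | "a < x" using xy by linarith
    then show ?thesis
    proof cases
      case 1 then show ?thesis using xy ab arclength_dist_le[OF c, of x y] by (simp add: f_def)
    next
      case 2
      have "dist (c x) (c y) \<le> dist (c x) (c a) + dist (c a) (c y)" by (rule dist_triangle)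
      then show ?thesis using 2 xy ab arclength_dist_le[OF c, of x a] le[of a y] by (simp add: f_def)
    next
      case 3 then show ?thesis using xy le[of x y] by (simp add: f_def algebra_simps)
    qed
  qed
  have fb: "f b - f 0 = a + r * (b - a)" using ab by (simp add: f_def)
  have "ennreal b = curve_length c 0 b" using c ab by (auto simp: arclength_parameterized_def)
  also have "\<dots> \<le> ennreal (a + r * (b - a))"
    unfolding curve_length_def fb[symmetric]
    by (intro SUP_least ennreal_leI sum_dist_le_telescope) (use d in auto)
  finally have "b \<le> a + r * (b - a)" using ab r0 by (subst (asm) ennreal_le_iff) auto
  then have "(1 - r) * (b - a) \<le> 0" by (simp add: algebra_simps)
  then show False using r ab by (simp add: mult_le_0_iff)
qed

text \<open>Cut the parameter interval into cells of length \<open>g / 2\<close>. On each of the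
  finitely many cells inside \<open>{0..L}\<close> the curve is not constant, hence has two points
  at a definite distance. An interval longer than \<open>g\<close> contains a whole cell, so
  \<open>c\<close> cannot stay too close to one point on it.\<close>

lemma small_oscillation_imp_short:
  assumes c: "arclength_parameterized c L" and g: "0 < g"
  obtains mu where "0 < mu" "\<And>a b. 0 \<le> a \<Longrightarrow> a \<le> b \<Longrightarrow> b \<le> L \<Longrightarrow>
    (\<And>s. s \<in> {a..b} \<Longrightarrow> dist (c s) (c a) \<le> mu) \<Longrightarrow> b - a \<le> g"
proof -
  define z where "z = (\<lambda>j::nat. real j * (g / 2))"
  define J where "J = {j. z (Suc j) \<le> L}"
  have "\<exists>d>0. \<exists>x y. x \<in> {z j..z (Suc j)} \<and> y \<in> {z j..z (Suc j)} \<and> d \<le> dist (c x) (c y)" if "j \<in> J" for j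
  proof (rule ccontr)
    assume "\<not> ?thesis"
    then have *: "dist (c x) (c y) = 0" if "x \<in> {z j..z (Suc j)}" "y \<in> {z j..z (Suc j)}" for x y
      using that by (metis order_refl zero_less_dist_iff dist_eq_0_iff)
    show False
      by (rule arclength_no_contraction[OF c, of "z j" "z (Suc j)" 0])
        (use * that g in \<open>auto simp: z_def J_def\<close>)
  qed
  then obtain d where d: "\<And>j. j \<in> J \<Longrightarrow> d j > 0 \<and> (\<exists>x y. x \<in> {z j..z (Suc j)} \<and> y \<in> {z j..z (Suc j)} \<and> d j \<le> dist (c x) (c y))"
    by metis
  have "J \<subseteq> {..nat \<lceil>L / (g / 2)\<rceil>}"
  proof
    fix j assume "j \<in> J"
    then have "real (Suc j) \<le> L / (g / 2)" using g by (simp add: J_def z_def field_simps)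
    then show "j \<in> {..nat \<lceil>L / (g / 2)\<rceil>}" by (simp add: le_nat_iff) linarith
  qed
  then have fJ: "finite J" by (rule finite_subset) simp
  \<comment> \<open>Two points within \<open>mu\<close> of \<open>c a\<close> are at distance at
    most \<open>2 * mu\<close>, less than the \<open>3 * mu\<close> that every cell attains. The
    inserted 1 covers the case without cells.\<close>
  define mu where "mu = Min (insert 1 (d ` J)) / 3"
  have mu: "0 < mu" using fJ d by (simp add: mu_def)
  have mud: "3 * mu \<le> d j" if "j \<in> J" for j using fJ that by (simp add: mu_def)
  show ?thesis
  proof (rule that[OF mu], rule ccontr)
    fix a b assume ab: "0 \<le> a" "a \<le> b" "b \<le> L" and cl: "\<And>s. s \<in> {a..b} \<Longrightarrow> dist (c s) (c a) \<le> mu"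
      and "\<not> b - a \<le> g"
    define j where "j = nat \<lceil>a / (g / 2)\<rceil>"
    have j: "real j = real_of_int \<lceil>a / (g / 2)\<rceil>" using ab g by (simp add: j_def)
    have "a / (g / 2) \<le> real j" "real j < a / (g / 2) + 1" unfolding j by linarith+
    then have "a \<le> z j" "z j < a + g / 2" using g by (auto simp: z_def field_simps)
    moreover have "z (Suc j) = z j + g / 2" by (simp add: z_def algebra_simps)
    ultimately have zs: "a \<le> z j" "z (Suc j) \<le> b" using \<open>\<not> b - a \<le> g\<close> by linarith+
    then have jJ: "j \<in> J" using ab by (simp add: J_def)
    then obtain x y where xy: "x \<in> {z j..z (Suc j)}" "y \<in> {z j..z (Suc j)}" "d j \<le> dist (c x) (c y)"
      using d by blast
    have "dist (c x) (c y) \<le> dist (c x) (c a) + dist (c y) (c a)" by (rule dist_triangle2)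
    also have "\<dots> \<le> mu + mu" using xy zs by (intro add_mono cl) auto
    finally show False using xy mud[OF jJ] mu by linarith
  qed
qed

text \<open>A partition weakened just enough to survive the merging of repeated vertices: each arc
  is compared with its left vertex, and the last vertex may lie before \<open>L\<close> as long as
  the remaining arc is close to it.\<close>

fun close_chain :: "(real \<Rightarrow> 'a::metric_space) \<Rightarrow> real \<Rightarrow> real \<Rightarrow> real list \<Rightarrow> bool" where
  "close_chain c mu L [] \<longleftrightarrow> False"
| "close_chain c mu L [x] \<longleftrightarrow> x \<le> L \<and> (\<forall>s\<in>{x..L}. dist (c s) (c x) \<le> mu)"
| "close_chain c mu L (x # y # ts) \<longleftrightarrow>
     x < y \<and> (\<forall>s\<in>{x..y}. dist (c s) (c x) \<le> mu) \<and> close_chain c mu L (y # ts)"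

text \<open>Dropping a vertex that repeats its predecessor keeps the chain close: the merged arc stays
  near the same point.\<close>

lemma close_chain_remdups_adj:
  "close_chain c mu L ts \<Longrightarrow>
    \<exists>ts'. close_chain c mu L ts' \<and> map c ts' = remdups_adj (map c ts) \<and> hd ts' = hd ts"
proof (induction "length ts" arbitrary: ts rule: less_induct)
  case less
  show ?case
  proof (cases ts)
    case Nil then show ?thesis using less.prems by simp
  next
    case (Cons x us)
    show ?thesis
    proof (cases us)
      case Nil then show ?thesis using less.prems Cons by (intro exI[of _ "[x]"]) simp
    next
      case Cons': (Cons y zs)
      have xy: "x < y" "\<And>s. s \<in> {x..y} \<Longrightarrow> dist (c s) (c x) \<le> mu" "close_chain c mu L (y # zs)"
        using less.prems Cons Cons' by auto
      show ?thesis
      proof (cases "c x = c y")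
        case True
        have "close_chain c mu L (x # zs)"
        proof (cases zs)
          case Nil
          have "dist (c s) (c x) \<le> mu" if "s \<in> {x..L}" for s
            using xy Nil True that by (cases "s \<le> y") auto
          then show ?thesis using xy Nil by auto
        next
          case Z: (Cons z ws)
          have "dist (c s) (c x) \<le> mu" if "s \<in> {x..z}" for s
            using xy Z True that by (cases "s \<le> y") auto
          then show ?thesis using xy Z by auto
        qed
        then obtain ts' where "close_chain c mu L ts'" "map c ts' = remdups_adj (map c (x # zs))" "hd ts' = x"
          using less.hyps[of "x # zs"] Cons Cons' by auto
        then show ?thesis using Cons Cons' True by (intro exI[of _ ts']) simp
      next
        case False
        obtain ts' where t: "close_chain c mu L ts'" "map c ts' = remdups_adj (map c (y # zs))" "hd ts' = y"
          using less.hyps[of "y # zs"] Cons Cons' xy by auto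
        then obtain vs where "ts' = y # vs" by (cases ts') auto
        then show ?thesis using Cons Cons' False t xy by (intro exI[of _ "x # ts'"]) simp
      qed
    qed
  qed
qed

lemma close_chain_nth:
  "close_chain c mu L ts \<Longrightarrow> ts \<noteq> [] \<and> last ts \<le> L \<and> (\<forall>s\<in>{last ts..L}. dist (c s) (c (last ts)) \<le> mu) \<and>
    (\<forall>i < length ts - 1. ts ! i < ts ! Suc i \<and> (\<forall>s\<in>{ts ! i..ts ! Suc i}. dist (c s) (c (ts ! i)) \<le> mu))"
proof (induction c mu L ts rule: close_chain.induct)
  case (3 c mu L x y ts)
  then have IH: "\<forall>i < length ts. (y # ts) ! i < (y # ts) ! Suc i \<and>
      (\<forall>s\<in>{(y # ts) ! i..(y # ts) ! Suc i}. dist (c s) (c ((y # ts) ! i)) \<le> mu)" by simp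
  have "(x # y # ts) ! i < (x # y # ts) ! Suc i \<and>
      (\<forall>s\<in>{(x # y # ts) ! i..(x # y # ts) ! Suc i}. dist (c s) (c ((x # y # ts) ! i)) \<le> mu)"
    if "i < Suc (length ts)" for i
    using IH 3 that by (cases i) auto
  then show ?case using 3 by simp
qed simp_all

lemma close_chain_of_partition:
  assumes "ts \<noteq> []" "last ts = L" "0 \<le> mu" "\<And>i. i < length ts - 1 \<Longrightarrow> ts ! i < ts ! Suc i"
    "\<And>i s. i < length ts - 1 \<Longrightarrow> s \<in> {ts ! i..ts ! Suc i} \<Longrightarrow> dist (c s) (c (ts ! i)) \<le> mu"
  shows "close_chain c mu L ts"
  using assms
proof (induction ts)
  case (Cons x us)
  show ?case
  proof (cases us)
    case Nil then show ?thesis using Cons.prems by simp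
  next
    case C: (Cons y zs)
    have "close_chain c mu L us"
    proof (rule Cons.IH)
      show "us ! i < us ! Suc i" if "i < length us - 1" for i using Cons.prems(4)[of "Suc i"] that by simp
      show "dist (c s) (c (us ! i)) \<le> mu" if "i < length us - 1" "s \<in> {us ! i..us ! Suc i}" for i s
        using Cons.prems(5)[of "Suc i" s] that by simp
    qed (use C Cons.prems in auto)
    then show ?thesis using Cons.prems(4)[of 0] Cons.prems(5)[of 0] C by auto
  qed
qed simp

text \<open>The modulus bounds how far \<open>c\<close> moves on each arc, and
  \<open>small_oscillation_imp_short\<close> turns this into a bound on parameter gaps. Doing so
  after the merging also covers the arcs from which vertices were dropped. The final
  \<open>t m\<close> precedes \<open>L\<close> when the last vertices were merged.\<close>

lemma fine_vertices:
  assumes c: "arclength_parameterized c L" and g: "0 < g"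
  obtains mu where "0 < mu" "\<And>ts. is_partition 0 L ts \<Longrightarrow> modulus c ts < mu \<Longrightarrow>
    \<exists>t m. remdups_adj (map c ts) = map (\<lambda>i. c (t i)) [0..<Suc m] \<and> t 0 = 0 \<and>
      (\<forall>i<m. t i < t (Suc i) \<and> t (Suc i) \<le> t i + g) \<and> t m \<le> L \<and> L \<le> t m + g"
proof -
  obtain mu where mu: "0 < mu" and short: "\<And>a b. 0 \<le> a \<Longrightarrow> a \<le> b \<Longrightarrow> b \<le> L \<Longrightarrow>
    (\<And>s. s \<in> {a..b} \<Longrightarrow> dist (c s) (c a) \<le> mu) \<Longrightarrow> b - a \<le> g"
    using small_oscillation_imp_short[OF c g] by blast
  have cont: "continuous_on {0..L} c" using c by (simp add: arclength_parameterized_def)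
  show ?thesis
  proof (rule that[OF mu])
    fix ts assume ts: "is_partition 0 L ts" and m: "modulus c ts < mu"
    note n = is_partition_nth[OF ts]
    have "close_chain c mu L ts"
    proof (rule close_chain_of_partition)
      show "ts \<noteq> []" "last ts = L" using ts by (auto simp: is_partition_def)
      show "0 \<le> mu" using mu by simp
      show "ts ! i < ts ! Suc i" if "i < length ts - 1" for i using n(4)[of i "Suc i"] that by simp
      show "dist (c s) (c (ts ! i)) \<le> mu" if i: "i < length ts - 1" and s: "s \<in> {ts ! i..ts ! Suc i}" for i s
      proof -
        have "{ts ! i..ts ! Suc i} \<subseteq> {0..L}" using n(5)[of i] n(5)[of "Suc i"] i by auto
        then have "bounded (c ` {ts ! i..ts ! Suc i})"
          by (intro compact_imp_bounded compact_continuous_image continuous_on_subset[OF cont]) auto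
        then have "dist (c s) (c (ts ! i)) \<le> diameter (c ` {ts ! i..ts ! Suc i})"
          using s by (intro diameter_bounded_bound) auto
        also have "\<dots> \<le> modulus c ts" unfolding modulus_def using i by (intro Max_ge) auto
        finally show ?thesis using m by simp
      qed
    qed
    then obtain ts' where cc: "close_chain c mu L ts'" and rd: "map c ts' = remdups_adj (map c ts)" and hd: "hd ts' = hd ts"
      using close_chain_remdups_adj by blast
    note N = close_chain_nth[OF cc]
    define t where "t = (\<lambda>i. ts' ! i)"
    define m where "m = length ts' - 1"
    have len: "length ts' = Suc m" and t0: "t 0 = 0" and tm: "t m = last ts'"
      using N hd ts by (auto simp: m_def t_def is_partition_def hd_conv_nth last_conv_nth)
    have inc: "t i < t (Suc i)" if "i < m" for i using N that by (simp add: t_def m_def)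
    have nonneg: "0 \<le> t i" if "i \<le> m" for i
      using that by (induction i) (use t0 inc in \<open>auto intro: less_imp_le order_trans simp: Suc_le_eq\<close>)
    have leL: "t i \<le> L" if "i \<le> m" for i
      using that by (induction i rule: inc_induct) (use N tm inc in \<open>auto intro: order.trans[OF less_imp_le]\<close>)
    have "t (Suc i) - t i \<le> g" if "i < m" for i
      using N that nonneg[of i] leL[of "Suc i"] inc[of i] by (intro short) (auto simp: t_def m_def)
    moreover have "L - t m \<le> g"
      using N nonneg[of m] by (intro short) (auto simp: tm)
    moreover have "map (\<lambda>i. c (t i)) [0..<Suc m] = map c ts'"
      by (rule nth_equalityI) (auto simp: len t_def simp del: upt_Suc)
    ultimately show "\<exists>t m. remdups_adj (map c ts) = map (\<lambda>i. c (t i)) [0..<Suc m] \<and> t 0 = 0 \<and>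
      (\<forall>i<m. t i < t (Suc i) \<and> t (Suc i) \<le> t i + g) \<and> t m \<le> L \<and> L \<le> t m + g"
      using t0 inc leL[of m] rd by (intro exI[of _ t] exI[of _ m]) (auto simp: algebra_simps simp del: upt_Suc)
  qed
qed

section \<open>The direction of an inscribed polygonal\<close>

text \<open>A chord of the unit circle against its arc. The exact length serves the upper bound for
  the energy, the comparison the lower bound.\<close>

lemma norm_diff_le_turning_angle:
  fixes x y z :: "'a::real_inner"
  assumes "x \<noteq> y" "y \<noteq> z"
  defines "u \<equiv> (1 / norm (y - x)) *\<^sub>R (y - x)" and "v \<equiv> (1 / norm (z - y)) *\<^sub>R (z - y)"
  shows "norm (v - u) = 2 * sin (turning_angle x y z / 2)"
    and "norm (v - u) \<le> turning_angle x y z"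
proof -
  let ?t = "turning_angle x y z"
  have "norm u = 1" "norm v = 1" using assms(1,2) by (auto simp: u_def v_def)
  then have nu: "u \<bullet> u = 1" "v \<bullet> v = 1" by (auto simp: norm_eq_1)
  have uv: "u \<bullet> v = cos ?t" unfolding cos_turning_angle by (simp add: u_def v_def)
  have "(norm (v - u))\<^sup>2 = 2 - 2 * cos ?t"
    unfolding power2_norm_eq_inner using nu uv by (simp add: inner_diff_left inner_diff_right inner_commute)
  also have "\<dots> = (2 * sin (?t / 2))\<^sup>2"
    using cos_double_sin[of "?t / 2"] by (simp add: power2_eq_square)
  finally have eq: "(norm (v - u))\<^sup>2 = (2 * sin (?t / 2))\<^sup>2" .
  have "0 \<le> sin (?t / 2)" using turning_angle_bounds[of x y z] by (intro sin_ge_zero) auto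
  then show "norm (v - u) = 2 * sin (?t / 2)" by (intro power2_eq_imp_eq[OF eq]) auto
  then show "norm (v - u) \<le> ?t"
    using sin_x_le_x[of "?t / 2"] turning_angle_bounds[of x y z] by simp
qed

text \<open>The corner bound is weakened twice: the angle becomes the distance between directions,
  and side lengths become parameter differences, which dominate chords because \<open>c\<close> is
  1-Lipschitz. Distances of directions obey the triangle inequality and parameter differences
  telescope, which is what passing to arbitrary partitions needs.\<close>

lemma optimal_rotation_ge:
  fixes c :: "real \<Rightarrow> 'a::euclidean_space"
  assumes c: "arclength_parameterized c L" and p: "p > 1"
    and V: "remdups_adj (map c ts) = map (\<lambda>i. c (t i)) [0..<Suc m]"
    and t0: "0 \<le> t 0" and tm: "t m \<le> L" and incr: "\<forall>i<m. t i < t (Suc i)"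
  defines "w \<equiv> \<lambda>i. c (t (Suc i)) - c (t i)"
  defines "u \<equiv> \<lambda>i. (1 / norm (w i)) *\<^sub>R w i"
  shows "i < m \<Longrightarrow> norm (w i) \<le> t (Suc i) - t i"
    and "ennreal (\<Sum>i<m - 1. norm (u (Suc i) - u i) powr p / ((t (i + 2) - t i) / 2) powr (p - 1))
      \<le> optimal_rotation p (map c ts)"
proof -
  have inc: "\<And>i. i < m \<Longrightarrow> t i < t (Suc i)" using incr by blast
  let ?V = "remdups_adj (map c ts)"
  have len: "length ?V = Suc m" unfolding V by simp
  have nth: "?V ! i = c (t i)" if "i \<le> m" for i
    unfolding V using that by (simp add: nth_map_upt del: upt_Suc)
  have w0: "w i \<noteq> 0" if "i < m" for i
    using distinct_adj_remdups_adj[of "map c ts"] nth[of i] nth[of "Suc i"] that len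
    by (auto simp: distinct_adj_conv_nth w_def)
  have nonneg: "0 \<le> t i" if "i \<le> m" for i
    using that by (induction i) (use t0 inc in \<open>auto intro: less_imp_le order_trans simp: Suc_le_eq\<close>)
  have leL: "t i \<le> L" if "i \<le> m" for i
    using that by (induction i rule: inc_induct) (use tm inc in \<open>auto intro: order.trans[OF less_imp_le]\<close>)
  have nw: "norm (w i) \<le> t (Suc i) - t i" if "i < m" for i
    using arclength_dist_le[OF c, of "t i" "t (Suc i)"] nonneg[of i] leL[of "Suc i"] inc[of i] that
    by (simp add: w_def dist_norm norm_minus_commute)
  then show "i < m \<Longrightarrow> norm (w i) \<le> t (Suc i) - t i" .
  have corner: "ennreal (norm (u (Suc i) - u i) powr p / ((t (i + 2) - t i) / 2) powr (p - 1))
      \<le> corner_energy p (?V ! i) (?V ! (i + 1)) (?V ! (i + 2))" if i: "i < m - 1" for i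
  proof -
    let ?x = "c (t i)" and ?y = "c (t (Suc i))" and ?z = "c (t (Suc (Suc i)))"
    have im: "i < m" "Suc i < m" using i by auto
    have ne: "?x \<noteq> ?y" "?y \<noteq> ?z" using w0[OF im(1)] w0[OF im(2)] by (auto simp: w_def)
    have "norm (u (Suc i) - u i) \<le> turning_angle ?x ?y ?z"
      using norm_diff_le_turning_angle(2)[OF ne] by (simp add: u_def w_def)
    moreover have "norm (w i) + norm (w (Suc i)) \<le> t (i + 2) - t i"
      using nw[OF im(1)] nw[OF im(2)] by simp
    moreover have "0 < norm (w i)" "0 < norm (w i) + norm (w (Suc i))"
      using w0 im by (auto intro: add_pos_pos)
    ultimately have "norm (u (Suc i) - u i) powr p / ((t (i + 2) - t i) / 2) powr (p - 1)
       \<le> turning_angle ?x ?y ?z powr p / ((norm (w i) + norm (w (Suc i))) / 2) powr (p - 1)"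
      using p by (intro frac_le powr_mono2) auto
    also have "\<dots> = turning_angle ?x ?y ?z powr p / ((norm (?y - ?x) + norm (?z - ?y)) / 2) powr (p - 1)"
      by (simp add: w_def)
    finally have "ennreal (norm (u (Suc i) - u i) powr p / ((t (i + 2) - t i) / 2) powr (p - 1))
      \<le> corner_energy p ?x ?y ?z"
      by (rule order_trans[OF ennreal_leI corner_energy_ge[OF p ne]])
    then show ?thesis
      using nth[of i] nth[of "Suc i"] nth[of "Suc (Suc i)"] im by simp
  qed
  have "ennreal (\<Sum>i<m - 1. norm (u (Suc i) - u i) powr p / ((t (i + 2) - t i) / 2) powr (p - 1))
      = (\<Sum>i<m - 1. ennreal (norm (u (Suc i) - u i) powr p / ((t (i + 2) - t i) / 2) powr (p - 1)))"
    by (subst sum_ennreal) auto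
  also have "\<dots> \<le> (\<Sum>i<m - 1. corner_energy p (?V ! i) (?V ! (i + 1)) (?V ! (i + 2)))"
    by (intro sum_mono corner) auto
  also have "\<dots> = optimal_rotation p (map c ts)"
    unfolding optimal_rotation_def Let_def len by simp
  finally show "ennreal (\<Sum>i<m - 1. norm (u (Suc i) - u i) powr p / ((t (i + 2) - t i) / 2) powr (p - 1))
      \<le> optimal_rotation p (map c ts)" .
qed

text \<open>On the last piece the index stays at \<open>m - 1\<close>, so that it always names a segment.\<close>

definition piece :: "(nat \<Rightarrow> real) \<Rightarrow> nat \<Rightarrow> real \<Rightarrow> nat" where
  "piece t m x = Max {i. i < m \<and> t i \<le> x}"

text \<open>The factor 2 is due to the last index, which serves its own segment and the rest up to
  \<open>L\<close>, each of length at most \<open>g\<close>.\<close>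

lemma piece_props:
  assumes m: "0 < m" and t0: "t 0 = 0" and inc: "\<forall>i<m. t i < t (Suc i) \<and> t (Suc i) \<le> t i + g"
    and L: "L \<le> t m + g" and x: "0 \<le> x" "x \<le> L"
  shows "piece t m x < m" "t (piece t m x) \<le> x" "Suc (piece t m x) < m \<Longrightarrow> x < t (Suc (piece t m x))"
    "x \<le> t (piece t m x) + 2 * g"
    "x \<le> y \<Longrightarrow> piece t m x \<le> piece t m y"
    "i < m \<Longrightarrow> t i \<le> x \<Longrightarrow> i \<le> piece t m x"
proof -
  let ?A = "{i. i < m \<and> t i \<le> x}"
  have A: "finite ?A" "?A \<noteq> {}" using m t0 x by auto
  then have "piece t m x \<in> ?A" unfolding piece_def by (rule Max_in)
  then show *: "piece t m x < m" "t (piece t m x) \<le> x" by auto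
  show **: "x < t (Suc (piece t m x))" if "Suc (piece t m x) < m"
  proof (rule ccontr)
    assume "\<not> ?thesis"
    then have "Suc (piece t m x) \<le> piece t m x" unfolding piece_def using A that
      by (intro Max_ge) (auto simp: piece_def)
    then show False by simp
  qed
  show "x \<le> t (piece t m x) + 2 * g"
  proof (cases "Suc (piece t m x) < m")
    case True
    then show ?thesis using **[OF True] inc[rule_format, OF *(1)] by linarith
  next
    case False
    then have "m = Suc (piece t m x)" using * by simp
    then show ?thesis using inc[rule_format, OF *(1)] L x by simp
  qed
  show "x \<le> y \<Longrightarrow> piece t m x \<le> piece t m y"
    unfolding piece_def using A by (intro Max_mono) auto
  show "i < m \<Longrightarrow> t i \<le> x \<Longrightarrow> i \<le> piece t m x"
    unfolding piece_def using A by (intro Max_ge) auto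
qed

text \<open>Fix a partition whose polygonal is longer than \<open>L - e / 2\<close> and move its
  points to nearby vertices of the finer polygonal. Each move costs at most \<open>2 * g\<close>,
  hence each side \<open>4 * g\<close>, and the triangle inequality bounds the moved polygonal by
  the fine one. The 8 in \<open>d\<close> keeps the total cost at most \<open>e / 2\<close>.\<close>

lemma inscribed_length_close:
  fixes c :: "real \<Rightarrow> 'a::euclidean_space"
  assumes c: "arclength_parameterized c L" and e: "0 < e" and L: "0 \<le> L"
  obtains d where "0 < d"
    "\<And>t m g. g < d \<Longrightarrow> 0 < m \<Longrightarrow> t 0 = 0 \<Longrightarrow> (\<And>i. i < m \<Longrightarrow> t i < t (Suc i) \<and> t (Suc i) \<le> t i + g) \<Longrightarrow>
      t m \<le> L \<Longrightarrow> L \<le> t m + g \<Longrightarrow> L - e \<le> (\<Sum>i<m. norm (c (t (Suc i)) - c (t i)))"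
proof (cases "L - e < 0")
  case True
  show ?thesis
  proof (rule that[of 1])
    show "L - e \<le> (\<Sum>i<m. norm (c (t (Suc i)) - c (t i)))" for t m
      using True sum_nonneg[of "{..<m}" "\<lambda>i. norm (c (t (Suc i)) - c (t i))"] by auto
  qed simp
next
  case False
  have "ennreal (L - e / 2) < ennreal L" using e False by (intro ennreal_lessI) auto
  also have "ennreal L = curve_length c 0 L" using c L by (simp add: arclength_parameterized_def)
  finally obtain ts where ts: "is_partition 0 L ts"
    and s: "ennreal (L - e / 2) < ennreal (\<Sum>i<length ts - 1. dist (c (ts ! i)) (c (ts ! Suc i)))"
    unfolding curve_length_def less_SUP_iff by blast
  have s: "L - e / 2 < (\<Sum>i<length ts - 1. dist (c (ts ! i)) (c (ts ! Suc i)))"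
    using s e False by (subst (asm) ennreal_less_iff) auto
  note n = is_partition_nth[OF ts]
  define d where "d = e / (8 * real (length ts))"
  have d: "0 < d" using e n by (simp add: d_def)
  show ?thesis
  proof (rule that[OF d])
    fix t m g assume g: "g < d" and m: "0 < m" and t0: "t 0 = 0"
      and inc: "\<And>i. i < m \<Longrightarrow> t i < t (Suc i) \<and> t (Suc i) \<le> t i + g" and tm: "t m \<le> L" "L \<le> t m + g"
    have inc': "\<forall>i<m. t i < t (Suc i) \<and> t (Suc i) \<le> t i + g" using inc by blast
    note P = piece_props[OF m t0 inc' tm(2)]
    define j where "j = (\<lambda>k. piece t m (ts ! k))"
    define A where "A = (\<lambda>j. \<Sum>i<j. norm (c (t (Suc i)) - c (t i)))"
    have nonneg: "0 \<le> t i" if "i \<le> m" for i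
      using that by (induction i) (use t0 inc in \<open>auto intro: less_imp_le order_trans simp: Suc_le_eq\<close>)
    have dA: "norm (c (t k) - c (t i)) \<le> A k - A i" if "i \<le> k" for i k
      using that
    proof (induction rule: dec_induct)
      case (step n)
      have "norm (c (t (Suc n)) - c (t i)) \<le> norm (c (t (Suc n)) - c (t n)) + norm (c (t n) - c (t i))"
        using norm_triangle_ineq[of "c (t (Suc n)) - c (t n)" "c (t n) - c (t i)"] by simp
      then show ?case using step by (simp add: A_def)
    qed simp
    have close: "dist (c (ts ! k)) (c (t (j k))) \<le> 2 * g" if k: "k < length ts" for k
    proof -
      have x: "0 \<le> ts ! k" "ts ! k \<le> L" using n(5)[OF k] by auto
      have "dist (c (t (j k))) (c (ts ! k)) \<le> ts ! k - t (j k)"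
        using P(1,2)[OF x] nonneg[of "j k"] x by (intro arclength_dist_le[OF c]) (auto simp: j_def)
      then show ?thesis using P(4)[OF x] by (simp add: j_def dist_commute)
    qed
    have "(\<Sum>i<length ts - 1. dist (c (ts ! i)) (c (ts ! Suc i)))
        \<le> (\<Sum>k<length ts - 1. 4 * g + (A (j (Suc k)) - A (j k)))"
    proof (rule sum_mono)
      fix k assume "k \<in> {..<length ts - 1}"
      then have k: "Suc k < length ts" by auto
      have "j k \<le> j (Suc k)" unfolding j_def
        using k n(4)[of k "Suc k"] n(5)[of k] by (intro P(5)) auto
      then have "dist (c (t (j k))) (c (t (j (Suc k)))) \<le> A (j (Suc k)) - A (j k)"
        using dA by (simp add: dist_norm norm_minus_commute)
      moreover have "dist (c (ts ! k)) (c (t (j k))) \<le> 2 * g" "dist (c (ts ! Suc k)) (c (t (j (Suc k)))) \<le> 2 * g"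
        using close[of k] close[of "Suc k"] k by auto
      moreover have "dist (c (ts ! k)) (c (ts ! Suc k)) \<le> dist (c (ts ! k)) (c (t (j k)))
          + (dist (c (t (j k))) (c (t (j (Suc k)))) + dist (c (t (j (Suc k)))) (c (ts ! Suc k)))"
        by (intro order_trans[OF dist_triangle[of _ _ "c (t (j k))"]] add_left_mono dist_triangle)
      ultimately show "dist (c (ts ! k)) (c (ts ! Suc k)) \<le> 4 * g + (A (j (Suc k)) - A (j k))"
        by (simp add: dist_commute)
    qed
    also have "\<dots> = 4 * g * real (length ts - 1) + (A (j (length ts - 1)) - A (j 0))"
      by (simp add: sum.distrib sum_lessThan_telescope[of "\<lambda>k. A (j k)"])
    also have "\<dots> \<le> e / 2 + A m"
    proof -
      have g0: "0 \<le> g" using inc[OF m] by linarith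
      have "4 * g * real (length ts - 1) \<le> 4 * d * real (length ts)"
        using g g0 d by (intro mult_mono) auto
      also have "\<dots> = e / 2" using n(3) by (simp add: d_def)
      finally have "4 * g * real (length ts - 1) \<le> e / 2" .
      moreover have "j (length ts - 1) < m" unfolding j_def
        using n(3) n(5)[of "length ts - 1"] by (intro P(1)) auto
      then have "A (j (length ts - 1)) \<le> A m" unfolding A_def by (intro sum_mono2) auto
      moreover have "0 \<le> A (j 0)" unfolding A_def by (intro sum_nonneg) auto
      ultimately show ?thesis by linarith
    qed
    finally show "L - e \<le> (\<Sum>i<m. norm (c (t (Suc i)) - c (t i)))" using s by (simp add: A_def)
  qed
qed

text \<open>The field \<open>U\<close> is the direction of an inscribed polygonal, as a function of the arc length of \<open>c\<close>.
  The second property says that \<open>c\<close> almost integrates \<open>U\<close>, in a form that needs no integrals.\<close>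

lemma discrete_tangent_field:
  fixes c :: "real \<Rightarrow> 'a::euclidean_space"
  assumes c: "arclength_parameterized c L" and p: "p > 1" and L: "0 < L"
    and M: "relaxed_energy p L c < ennreal M" and h: "0 < h"
  obtains U :: "real \<Rightarrow> 'a" where
    "\<And>x. norm (U x) \<le> 1"
    "\<And>x y e r. 0 \<le> x \<Longrightarrow> x \<le> y \<Longrightarrow> y \<le> L \<Longrightarrow> norm e \<le> 1 \<Longrightarrow> 0 \<le> r \<Longrightarrow> (\<And>z. z \<in> {x..y} \<Longrightarrow> norm (U z - e) \<le> r) \<Longrightarrow>
      norm (c y - c x - (y - x) *\<^sub>R e) \<le> r * (y - x + h) + h"
    "\<And>n (x :: nat \<Rightarrow> real). 0 \<le> x 0 \<Longrightarrow> x n \<le> L \<Longrightarrow> (\<And>j. j < n \<Longrightarrow> x j \<le> x (Suc j)) \<Longrightarrow>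
      (\<Sum>j<n. norm (U (x (Suc j)) - U (x j)) powr p / (x (Suc j) - x j + h) powr (p - 1)) \<le> M"
proof -
  obtain d where d: "0 < d" and dl: "\<And>t m g. g < d \<Longrightarrow> 0 < m \<Longrightarrow> t 0 = 0 \<Longrightarrow> (\<And>i. i < m \<Longrightarrow> t i < t (Suc i) \<and> t (Suc i) \<le> t i + g) \<Longrightarrow>
      t m \<le> L \<Longrightarrow> L \<le> t m + g \<Longrightarrow> L - h / 4 \<le> (\<Sum>i<m. norm (c (t (Suc i)) - c (t i)))"
    using inscribed_length_close[OF c, of "h / 4"] h L by (auto simp: less_imp_le)
  \<comment> \<open>\<open>g < d\<close> makes the missing length at most \<open>h / 4\<close>;
    \<open>h / 16\<close> keeps the boundary errors, \<open>6 * g\<close> in all, at most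
    \<open>3 * h / 8\<close>; \<open>g < L\<close> ensures that there is a segment.\<close>
  define g where "g = min (d / 2) (min (h / 16) (L / 2))"
  have g: "0 < g" "g < d" "g \<le> h / 16" "g < L" using d h L by (auto simp: g_def)
  obtain mu where mu: "0 < mu" and fine: "\<And>ts. is_partition 0 L ts \<Longrightarrow> modulus c ts < mu \<Longrightarrow>
    \<exists>t m. remdups_adj (map c ts) = map (\<lambda>i. c (t i)) [0..<Suc m] \<and> t 0 = 0 \<and>
      (\<forall>i<m. t i < t (Suc i) \<and> t (Suc i) \<le> t i + g) \<and> t m \<le> L \<and> L \<le> t m + g"
    using fine_vertices[OF c g(1)] by blast
  obtain T where T: "\<And>k. is_partition 0 L (T k)" "(\<lambda>k. modulus c (T k)) \<longlonglongrightarrow> 0"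
    and lim: "liminf (\<lambda>k. optimal_rotation p (map c (T k))) < ennreal M"
    using M unfolding relaxed_energy_def Inf_less_iff by blast
  have "\<forall>\<^sub>F k in sequentially. modulus c (T k) < mu" using order_tendstoD(2)[OF T(2) mu] .
  \<comment> \<open>A limit inferior below \<open>M\<close> only gives infinitely many good indices,
    enough to meet the eventual condition on the modulus once.\<close>
  moreover have "\<exists>\<^sub>F k in sequentially. optimal_rotation p (map c (T k)) < ennreal M"
    unfolding frequently_def
  proof
    assume "\<forall>\<^sub>F k in sequentially. \<not> optimal_rotation p (map c (T k)) < ennreal M"
    then have "\<forall>\<^sub>F k in sequentially. ennreal M \<le> optimal_rotation p (map c (T k))"
      by (simp add: not_less)
    then have "ennreal M \<le> liminf (\<lambda>k. optimal_rotation p (map c (T k)))" by (rule Liminf_bounded)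
    then show False using lim by simp
  qed
  ultimately obtain k where k: "modulus c (T k) < mu" "optimal_rotation p (map c (T k)) < ennreal M"
    using frequently_ex[OF frequently_eventually_conj] by blast
  obtain t m where V: "remdups_adj (map c (T k)) = map (\<lambda>i. c (t i)) [0..<Suc m]" and t0: "t 0 = 0"
    and inc: "\<And>i. i < m \<Longrightarrow> t i < t (Suc i) \<and> t (Suc i) \<le> t i + g" and tm: "t m \<le> L" "L \<le> t m + g"
    using fine[OF T(1) k(1)] by blast
  have m: "0 < m" using tm t0 g by (cases m) auto
  define w where "w = (\<lambda>i. c (t (Suc i)) - c (t i))"
  define u where "u = (\<lambda>i. (1 / norm (w i)) *\<^sub>R w i)"
  define E where "E = (\<lambda>i. norm (u (Suc i) - u i) powr p / ((t (i + 2) - t i) / 2) powr (p - 1))"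
  have "0 \<le> t 0" "\<forall>i<m. t i < t (Suc i)" using t0 inc by auto
  note O = optimal_rotation_ge[OF c p V this(1) tm(1) this(2)]
  have nw: "norm (w i) \<le> t (Suc i) - t i" if "i < m" for i
    unfolding w_def using that by (rule O(1))
  have rot: "ennreal (\<Sum>i<m - 1. E i) \<le> optimal_rotation p (map c (T k))"
    unfolding E_def u_def w_def by (rule O(2))
  have EM: "(\<Sum>i<m - 1. E i) \<le> M"
  proof -
    have "ennreal (\<Sum>i<m - 1. E i) < ennreal M" using rot k(2) by (rule le_less_trans)
    then show ?thesis by (simp add: ennreal_less_iff E_def sum_nonneg less_imp_le)
  qed
  have lenP: "L - h / 4 \<le> (\<Sum>i<m. norm (w i))"
    unfolding w_def using g m t0 inc tm by (intro dl) auto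
  have inc': "\<forall>i<m. t i < t (Suc i) \<and> t (Suc i) \<le> t i + g" using inc by blast
  note P = piece_props[OF m t0 inc' tm(2)]
  define U where "U = (\<lambda>x. u (piece t m x))"
  have nu: "norm (u i) \<le> 1" for i by (simp add: u_def)
  have nonneg: "0 \<le> t i" if "i \<le> m" for i
    using that by (induction i) (use t0 inc in \<open>auto intro: less_imp_le order_trans simp: Suc_le_eq\<close>)
  have tmono: "t i \<le> t k" if "i \<le> k" "k \<le> m" for i k
    using that by (induction rule: dec_induct) (use inc in \<open>auto intro: less_imp_le order_trans simp: Suc_le_eq\<close>)
  have tstrict: "t i < t k" if "i < k" "k \<le> m" for i k
    using tmono[of "Suc i" k] inc[of i] that by auto
  have leL: "t i \<le> L" if "i \<le> m" for i using tmono[of i m] tm that by auto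
  have piece_t: "piece t m (t k) = k" if "k < m" for k
  proof -
    have x: "0 \<le> t k" "t k \<le> L" using nonneg leL that by auto
    have "k \<le> piece t m (t k)" using that by (intro P(6) x) auto
    moreover have "piece t m (t k) \<le> k" using P(1,2)[OF x] tstrict[of k "piece t m (t k)"]
      by (cases "piece t m (t k) \<le> k") auto
    ultimately show ?thesis by simp
  qed
  show ?thesis
  proof (rule that[of U])
    show "norm (U x) \<le> 1" for x using nu by (simp add: U_def)
  next
    fix x y r :: real and e :: 'a
    assume x: "0 \<le> x" and xy: "x \<le> y" and y: "y \<le> L" and e: "norm e \<le> 1" and r: "0 \<le> r"
      and U: "\<And>z. z \<in> {x..y} \<Longrightarrow> norm (U z - e) \<le> r"
    have x': "x \<le> L" and y': "0 \<le> y" using x xy y by auto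
    define i where "i = piece t m x"
    define j where "j = piece t m y"
    have ij: "i \<le> j" "i < m" "j < m" unfolding i_def j_def using P(1)[OF x x'] P(1)[OF y' y] P(5)[OF x x' xy] by auto
    have ux: "norm (u l - e) \<le> r" if l: "l \<in> {i..<j}" for l
    proof (cases "l = i")
      case True then show ?thesis using U[of x] xy by (simp add: U_def i_def)
    next
      case False
      then have "x < t (Suc i)" using P(3)[OF x x'] l ij by (simp add: i_def)
      also have "\<dots> \<le> t l" using False l ij by (intro tmono) auto
      finally have "x \<le> t l" by simp
      moreover have "t l \<le> y" using tmono[of l j] l ij P(2)[OF y' y] by (simp add: j_def)
      ultimately show ?thesis using U[of "t l"] piece_t[of l] l ij by (simp add: U_def)
    qed
    have tele: "(\<Sum>l\<in>{i..<j}. f (Suc l) - f l) = f j - f i" for f :: "nat \<Rightarrow> 'b::ab_group_add"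
      using ij by (intro sum_Suc_diff') auto
    have "c (t j) - c (t i) - (t j - t i) *\<^sub>R e = (\<Sum>l\<in>{i..<j}. w l - (t (Suc l) - t l) *\<^sub>R e)"
      using tele[of "\<lambda>l. c (t l) - t l *\<^sub>R e"] by (simp add: w_def algebra_simps)
    also have "norm \<dots> \<le> (\<Sum>l\<in>{i..<j}. r * (t (Suc l) - t l) + (t (Suc l) - t l - norm (w l)))"
    proof (rule order_trans[OF norm_sum], rule sum_mono)
      fix l assume l: "l \<in> {i..<j}"
      then have lm: "l < m" using ij by auto
      have wl: "w l = norm (w l) *\<^sub>R u l" by (simp add: u_def)
      \<comment> \<open>A chord departs from \<open>e\<close> times its parameter gap in two ways:
        its direction deviates by at most \<open>r\<close>, and it is shorter than the gap. The
        second kind of error adds up over the whole polygonal to the missing length.\<close>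
      have "w l - (t (Suc l) - t l) *\<^sub>R e = norm (w l) *\<^sub>R (u l - e) - (t (Suc l) - t l - norm (w l)) *\<^sub>R e"
        by (subst wl) (simp add: algebra_simps)
      also have "norm \<dots> \<le> norm (w l) * norm (u l - e) + \<bar>t (Suc l) - t l - norm (w l)\<bar> * norm e"
        by (rule order_trans[OF norm_triangle_ineq4]) simp
      also have "\<dots> \<le> (t (Suc l) - t l) * r + (t (Suc l) - t l - norm (w l)) * 1"
        using nw[OF lm] inc[OF lm] ux[OF l] e r by (intro add_mono mult_mono) auto
      finally show "norm (w l - (t (Suc l) - t l) *\<^sub>R e) \<le> r * (t (Suc l) - t l) + (t (Suc l) - t l - norm (w l))"
        by (simp add: mult.commute)
    qed
    also have "\<dots> = r * (t j - t i) + (\<Sum>l\<in>{i..<j}. t (Suc l) - t l - norm (w l))"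
      unfolding sum.distrib sum_distrib_left[symmetric] tele ..
    also have "(\<Sum>l\<in>{i..<j}. t (Suc l) - t l - norm (w l)) \<le> (\<Sum>l<m. t (Suc l) - t l - norm (w l))"
      using ij nw by (intro sum_mono2) auto
    also have "\<dots> = t m - (\<Sum>l<m. norm (w l))"
      unfolding sum_subtractf[of "\<lambda>l. t (Suc l) - t l"] sum_lessThan_telescope t0 by simp
    also have "\<dots> \<le> h / 4" using lenP tm by simp
    finally have 1: "norm (c (t j) - c (t i) - (t j - t i) *\<^sub>R e) \<le> r * (t j - t i) + h / 4" by simp
    have ti: "t i \<le> x" "x \<le> t i + 2 * g" unfolding i_def using P(2,4)[OF x x'] by auto
    have tj: "t j \<le> y" "y \<le> t j + 2 * g" unfolding j_def using P(2,4)[OF y' y] by auto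
    have 2: "norm (c x - c (t i)) \<le> 2 * g"
      using arclength_dist_le[OF c, of "t i" x] ti nonneg[of i] ij x' by (simp add: dist_norm norm_minus_commute)
    have 3: "norm (c y - c (t j)) \<le> 2 * g"
      using arclength_dist_le[OF c, of "t j" y] tj nonneg[of j] ij y by (simp add: dist_norm norm_minus_commute)
    have 4: "norm (((y - t j) - (x - t i)) *\<^sub>R e) \<le> 2 * g"
    proof -
      have "norm (((y - t j) - (x - t i)) *\<^sub>R e) \<le> 2 * g * 1"
        unfolding norm_scaleR using ti tj e by (intro mult_mono) auto
      then show ?thesis by simp
    qed
    have "c y - c x - (y - x) *\<^sub>R e = (c (t j) - c (t i) - (t j - t i) *\<^sub>R e) + (c y - c (t j)) - (c x - c (t i))
        - ((y - t j) - (x - t i)) *\<^sub>R e"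
      by (simp add: algebra_simps)
    moreover have "norm (a + b - c' - d') \<le> norm a + norm b + norm c' + norm d'" for a b c' d' :: 'a
      using norm_triangle_ineq[of a b] norm_triangle_ineq4[of "a + b" c'] norm_triangle_ineq4[of "a + b - c'" d']
      by linarith
    ultimately have "norm (c y - c x - (y - x) *\<^sub>R e) \<le> norm (c (t j) - c (t i) - (t j - t i) *\<^sub>R e) + norm (c y - c (t j))
        + norm (c x - c (t i)) + norm (((y - t j) - (x - t i)) *\<^sub>R e)"
      by (simp only:)
    also have "\<dots> \<le> r * (t j - t i) + h / 4 + 2 * g + 2 * g + 2 * g" using 1 2 3 4 by linarith
    also have "r * (t j - t i) \<le> r * (y - x + h)"
      using r ti tj g h by (intro mult_left_mono) auto
    finally show "norm (c y - c x - (y - x) *\<^sub>R e) \<le> r * (y - x + h) + h"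
      using g h by linarith
  next
    fix n and x :: "nat \<Rightarrow> real"
    assume x0: "0 \<le> x 0" and xn: "x n \<le> L" and xinc: "\<And>j. j < n \<Longrightarrow> x j \<le> x (Suc j)"
    have xmono: "x i \<le> x k" if "i \<le> k" "k \<le> n" for i k
      using that by (induction rule: dec_induct) (use xinc in \<open>auto intro: order_trans simp: Suc_le_eq\<close>)
    have x: "0 \<le> x j" "x j \<le> L" if "j \<le> n" for j using xmono[of 0 j] xmono[of j n] x0 xn that by auto
    define A where "A = (\<lambda>k. \<Sum>i<k. E i)"
    define q where "q = (\<lambda>j. piece t m (x j))"
    have qm: "q j < m" if "j \<le> n" for j unfolding q_def using P(1)[OF x(1)[OF that] x(2)[OF that]] .
    have step: "norm (U (x (Suc j)) - U (x j)) powr p / (x (Suc j) - x j + h) powr (p - 1) \<le> A (q (Suc j)) - A (q j)"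
      if j: "j < n" for j
    proof -
      let ?I = "{q j..<q (Suc j)}"
      have x1: "0 \<le> x j" "x j \<le> L" "0 \<le> x (Suc j)" "x (Suc j) \<le> L" using x[of j] x[of "Suc j"] j by auto
      have qq: "q j \<le> q (Suc j)" unfolding q_def using xinc[OF j] by (intro P(5) x1)
      have AI: "A (q (Suc j)) - A (q j) = (\<Sum>i\<in>?I. E i)"
        unfolding A_def using qq sum_diff[of "{..<q (Suc j)}" "{..<q j}" E]
        by (simp add: lessThan_minus_lessThan)
      show ?thesis
      proof (cases "q j = q (Suc j)")
        case True
        then show ?thesis using AI p by (simp add: U_def q_def)
      next
        case False
        then have lt: "q j < q (Suc j)" using qq by simp
        have ln: "q (Suc j) < m" using qm[of "Suc j"] j by simp
        have hpos: "0 < (t (i + 2) - t i) / 2" if "i \<in> ?I" for i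
          using tstrict[of i "i + 2"] that ln by simp
        \<comment> \<open>\<open>(t (i + 2) - t i) / 2\<close> is the distance between the midpoints
          of two adjacent parameter intervals. The sum telescopes to the distance between the first
          and the last midpoint, which exceeds \<open>x (Suc j) - x j\<close> by at most
          \<open>g\<close>.\<close>
        have hle: "(\<Sum>i\<in>?I. (t (i + 2) - t i) / 2) \<le> x (Suc j) - x j + h"
        proof -
          define f where "f = (\<lambda>i. (t i + t (Suc i)) / 2)"
          have "(\<Sum>i\<in>?I. (t (i + 2) - t i) / 2) = (\<Sum>i\<in>?I. f (Suc i) - f i)"
            by (intro sum.cong) (auto simp: f_def field_simps)
          also have "\<dots> = f (q (Suc j)) - f (q j)" using qq by (rule sum_Suc_diff')
          finally have "(\<Sum>i\<in>?I. (t (i + 2) - t i) / 2) = f (q (Suc j)) - f (q j)" .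
          moreover have "t (q (Suc j)) \<le> x (Suc j)" unfolding q_def by (intro P(2) x1)
          moreover have "t (Suc (q (Suc j))) \<le> t (q (Suc j)) + g" using inc[OF ln] by simp
          moreover have "x j < t (Suc (q j))" unfolding q_def using lt ln by (intro P(3) x1) (simp add: q_def)
          moreover have "t (Suc (q j)) \<le> t (q j) + g" using inc[of "q j"] lt ln by simp
          ultimately show ?thesis using g h by (simp add: f_def field_simps)
        qed
        have "norm (U (x (Suc j)) - U (x j)) = norm (\<Sum>i\<in>?I. u (Suc i) - u i)"
          unfolding U_def using qq by (subst sum_Suc_diff') (auto simp: q_def)
        also have "\<dots> \<le> (\<Sum>i\<in>?I. norm (u (Suc i) - u i))" by (rule norm_sum)
        finally have "norm (U (x (Suc j)) - U (x j)) powr p \<le> (\<Sum>i\<in>?I. norm (u (Suc i) - u i)) powr p"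
          using p by (intro powr_mono2) auto
        also have "\<dots> \<le> (\<Sum>i\<in>?I. E i) * (\<Sum>i\<in>?I. (t (i + 2) - t i) / 2) powr (p - 1)"
          unfolding E_def using hpos by (intro sum_powr_le p) auto
        also have "\<dots> \<le> (\<Sum>i\<in>?I. E i) * (x (Suc j) - x j + h) powr (p - 1)"
          using p hle hpos by (intro mult_left_mono powr_mono2 sum_nonneg) (auto simp: E_def less_imp_le)
        finally have "norm (U (x (Suc j)) - U (x j)) powr p \<le> (\<Sum>i\<in>?I. E i) * (x (Suc j) - x j + h) powr (p - 1)" .
        then show ?thesis unfolding AI using xinc[OF j] h by (simp add: divide_le_eq)
      qed
    qed
    have "(\<Sum>j<n. norm (U (x (Suc j)) - U (x j)) powr p / (x (Suc j) - x j + h) powr (p - 1))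
        \<le> (\<Sum>j<n. A (q (Suc j)) - A (q j))"
      using step by (intro sum_mono) auto
    also have "\<dots> = A (q n) - A (q 0)" by (rule sum_lessThan_telescope)
    also have "\<dots> \<le> A (m - 1)"
    proof -
      have "0 \<le> A (q 0)" unfolding A_def by (intro sum_nonneg) (auto simp: E_def)
      moreover have "A (q n) \<le> A (m - 1)" unfolding A_def using qm[of n] by (intro sum_mono2) (auto simp: E_def)
      ultimately show ?thesis by simp
    qed
    finally show "(\<Sum>j<n. norm (U (x (Suc j)) - U (x j)) powr p / (x (Suc j) - x j + h) powr (p - 1)) \<le> M"
      using EM by (simp add: A_def)
  qed
qed

section \<open>The tangent of a curve of finite energy\<close>

text \<open>The fields for tolerances \<open>h k\<close> tending to 0 share a modulus of continuity
  up to \<open>h k\<close>, and over an interval of length \<open>d\<close> each of them integrates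
  to the same increment of \<open>c\<close> up to an error small relative to \<open>d\<close>.
  Dividing by \<open>d\<close> compares two fields at a point, so the whole sequence is pointwise
  Cauchy. The limit is the derivative of \<open>c\<close> and inherits the energy bound with the
  tolerance set to 0.\<close>

lemma tangent_of_finite_energy:
  fixes c :: "real \<Rightarrow> 'a::euclidean_space"
  assumes c: "arclength_parameterized c L" and p: "p > 1" and L: "0 < L"
    and M: "relaxed_energy p L c < ennreal M"
  obtains T :: "real \<Rightarrow> 'a" where
    "\<And>z. z \<in> {0..L} \<Longrightarrow> (c has_vector_derivative T z) (at z within {0..L})"
    "continuous_on {0..L} T"
    "\<And>n (x :: nat \<Rightarrow> real). 0 \<le> x 0 \<Longrightarrow> x n \<le> L \<Longrightarrow> (\<And>j. j < n \<Longrightarrow> x j < x (Suc j)) \<Longrightarrow>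
      (\<Sum>j<n. norm (T (x (Suc j)) - T (x j)) powr p / (x (Suc j) - x j) powr (p - 1)) \<le> M"
proof -
  have M0: "0 < M" using M by (metis ennreal_neg not_le not_less_zero zero_less_iff_neq_zero linorder_not_le)
  define h where "h = (\<lambda>k::nat. 1 / real (Suc k))"
  have h: "0 < h k" for k by (simp add: h_def)
  have hlim: "h \<longlonglongrightarrow> 0" unfolding h_def using LIMSEQ_inverse_real_of_nat by (simp add: inverse_eq_divide)
  \<comment> \<open>The three properties are bundled so that one field can be chosen for every
    \<open>k\<close>.\<close>
  define Q :: "nat \<Rightarrow> (real \<Rightarrow> 'a) \<Rightarrow> bool" where "Q = (\<lambda>k U. (\<forall>x. norm (U x) \<le> 1) \<and>
    (\<forall>x y e r. 0 \<le> x \<longrightarrow> x \<le> y \<longrightarrow> y \<le> L \<longrightarrow> norm e \<le> 1 \<longrightarrow> 0 \<le> r \<longrightarrow> (\<forall>z\<in>{x..y}. norm (U z - e) \<le> r) \<longrightarrow>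
      norm (c y - c x - (y - x) *\<^sub>R e) \<le> r * (y - x + h k) + h k) \<and>
    (\<forall>n (x :: nat \<Rightarrow> real). 0 \<le> x 0 \<longrightarrow> x n \<le> L \<longrightarrow> (\<forall>j<n. x j \<le> x (Suc j)) \<longrightarrow>
      (\<Sum>j<n. norm (U (x (Suc j)) - U (x j)) powr p / (x (Suc j) - x j + h k) powr (p - 1)) \<le> M))"
  have "\<exists>U. Q k U" for k
  proof (rule discrete_tangent_field[OF c p L M h[of k]], goal_cases)
    case (1 U)
    show ?case
    proof (rule exI[of _ U], unfold Q_def, intro conjI allI impI)
      show "norm (U x) \<le> 1" for x by (rule 1(1))
    next
      fix x y r :: real and e :: 'a
      assume "0 \<le> x" "x \<le> y" "y \<le> L" "norm e \<le> 1" "0 \<le> r" "\<forall>z\<in>{x..y}. norm (U z - e) \<le> r"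
      then show "norm (c y - c x - (y - x) *\<^sub>R e) \<le> r * (y - x + h k) + h k" by (intro 1(2)) auto
    next
      fix n and x :: "nat \<Rightarrow> real"
      assume "0 \<le> x 0" "x n \<le> L" "\<forall>j<n. x j \<le> x (Suc j)"
      then show "(\<Sum>j<n. norm (U (x (Suc j)) - U (x j)) powr p / (x (Suc j) - x j + h k) powr (p - 1)) \<le> M"
        by (intro 1(3)) auto
    qed
  qed
  then obtain U where U: "\<And>k. Q k (U k)" by metis
  then have U1: "\<And>k x. norm (U k x) \<le> 1"
    and U2: "\<And>k x y e r. 0 \<le> x \<Longrightarrow> x \<le> y \<Longrightarrow> y \<le> L \<Longrightarrow> norm e \<le> 1 \<Longrightarrow> 0 \<le> r \<Longrightarrow> \<forall>z\<in>{x..y}. norm (U k z - e) \<le> r \<Longrightarrow>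
      norm (c y - c x - (y - x) *\<^sub>R e) \<le> r * (y - x + h k) + h k"
    and U3: "\<And>k n (x :: nat \<Rightarrow> real). 0 \<le> x 0 \<Longrightarrow> x n \<le> L \<Longrightarrow> \<forall>j<n. x j \<le> x (Suc j) \<Longrightarrow>
      (\<Sum>j<n. norm (U k (x (Suc j)) - U k (x j)) powr p / (x (Suc j) - x j + h k) powr (p - 1)) \<le> M"
    unfolding Q_def by blast+
  \<comment> \<open>The Hoelder modulus of exponent \<open>(p - 1) / p\<close> that the energy bound
    gives on a partition with only two points.\<close>
  define om where "om = (\<lambda>r. (M * r powr (p - 1)) powr (1 / p))"
  have om0: "0 \<le> om r" for r by (simp add: om_def)
  have om_mono: "om r \<le> om s" if "0 \<le> r" "r \<le> s" for r s
    unfolding om_def using that M0 p by (intro powr_mono2 mult_left_mono) auto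
  have om_cont: "isCont om r" if "0 < r" for r
    unfolding om_def using that M0 by (intro continuous_intros) auto
  have om_lim: "(om \<longlongrightarrow> 0) (at_right 0)"
  proof -
    have pos: "\<forall>\<^sub>F r in at_right (0::real). 0 \<le> r"
      by (rule eventually_mono[OF eventually_at_right_less]) simp
    have "((\<lambda>r. r powr (p - 1)) \<longlongrightarrow> 0 powr (p - 1)) (at_right (0::real))"
      using p pos by (intro tendsto_powr' tendsto_ident_at tendsto_const) auto
    then have "((\<lambda>r. M * r powr (p - 1)) \<longlongrightarrow> M * 0) (at_right (0::real))"
      by (intro tendsto_mult) auto
    moreover have "\<forall>\<^sub>F r in at_right 0. 0 \<le> M * r powr (p - 1)" using M0 by simp
    ultimately have "((\<lambda>r. (M * r powr (p - 1)) powr (1 / p)) \<longlongrightarrow> (M * 0) powr (1 / p)) (at_right (0::real))"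
      using p by (intro tendsto_powr') auto
    then show ?thesis by (simp add: om_def[abs_def])
  qed
  have U4: "norm (U k y - U k x) \<le> om (y - x + h k)" if "0 \<le> x" "x \<le> y" "y \<le> L" for x y k
  proof -
    have "norm (U k y - U k x) powr p / (y - x + h k) powr (p - 1) \<le> M"
      using U3[of "\<lambda>j. if j = 0 then x else y" 1 k] that by simp
    then have "norm (U k y - U k x) powr p \<le> M * (y - x + h k) powr (p - 1)"
      using h[of k] that by (simp add: divide_le_eq)
    then have "(norm (U k y - U k x) powr p) powr (1 / p) \<le> om (y - x + h k)"
      unfolding om_def using p by (intro powr_mono2) auto
    then show ?thesis using p by (simp add: powr_powr)
  qed
  have U5: "norm (c y - c x - (y - x) *\<^sub>R U k z) \<le> om (y - x + h k) * (y - x + h k) + h k"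
    if "0 \<le> x" "x \<le> y" "y \<le> L" "z \<in> {x..y}" for x y z k
  proof (rule U2)
    show "\<forall>z'\<in>{x..y}. norm (U k z' - U k z) \<le> om (y - x + h k)"
    proof
      fix z' assume z': "z' \<in> {x..y}"
      have "norm (U k z' - U k z) \<le> om (\<bar>z' - z\<bar> + h k)"
      proof (cases "z \<le> z'")
        case True then show ?thesis using U4[of z z' k] z' that by simp
      next
        case False then show ?thesis using U4[of z' z k] z' that by (simp add: norm_minus_commute)
      qed
      also have "\<dots> \<le> om (y - x + h k)" using z' that h[of k] by (intro om_mono) auto
      finally show "norm (U k z' - U k z) \<le> om (y - x + h k)" .
    qed
  qed (use that U1 om0 in auto)
  have bound_lim: "(\<lambda>k. om (d + h k) * (d + h k) + h k) \<longlonglongrightarrow> om d * d" if "0 < d" for d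
  proof -
    have "(\<lambda>k. d + h k) \<longlonglongrightarrow> d" using tendsto_add[OF tendsto_const[of d] hlim] by simp
    moreover from isCont_tendsto_compose[OF om_cont[OF that] this] have "(\<lambda>k. om (d + h k)) \<longlonglongrightarrow> om d" .
    ultimately have "(\<lambda>k. om (d + h k) * (d + h k) + h k) \<longlonglongrightarrow> om d * d + 0"
      by (intro tendsto_add tendsto_mult hlim)
    then show ?thesis by simp
  qed
  have "Cauchy (\<lambda>k. U k z)" if z: "z \<in> {0..L}" for z
  proof (rule CauchyI)
    fix e :: real assume e: "0 < e"
    have "\<forall>\<^sub>F r in at_right 0. om r < e / 4" using order_tendstoD(2)[OF om_lim, of "e / 4"] e by simp
    moreover have "\<forall>\<^sub>F r in at_right 0. r < L / 2" using L by (simp add: eventually_at_right_less eventually_at_right[of 0 "L/2"]) (auto intro!: exI[of _ "L/2"])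
    ultimately have "\<forall>\<^sub>F r in at_right 0. 0 < r \<and> om r < e / 4 \<and> r < L / 2"
      using eventually_at_right_less[of 0] by eventually_elim simp
    then obtain d where d: "0 < d" "om d < e / 4" "d < L / 2"
      using eventually_happens by force
    \<comment> \<open>The fields are compared on an interval of length \<open>d\<close> with end
      point \<open>z\<close>; \<open>d < L / 2\<close> makes one fit on the right or on the
      left.\<close>
    obtain x y where xy: "0 \<le> x" "x \<le> y" "y \<le> L" "z \<in> {x..y}" "y - x = d"
    proof (cases "z + d \<le> L")
      case True then show ?thesis using that[of z "z + d"] z d by auto
    next
      case False then show ?thesis using that[of "z - d" z] z d by auto
    qed
    have "om d * d < e / 4 * d" using d by simp
    then have "\<forall>\<^sub>F k in sequentially. om (d + h k) * (d + h k) + h k < e / 4 * d"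
      by (rule order_tendstoD(2)[OF bound_lim[OF d(1)]])
    then obtain N where N: "\<And>k. k \<ge> N \<Longrightarrow> om (d + h k) * (d + h k) + h k < e / 4 * d"
      by (auto simp: eventually_sequentially)
    have "norm (U k z - U l z) < e" if kl: "k \<ge> N" "l \<ge> N" for k l
    proof -
      let ?S = "c y - c x"
      have "norm (d *\<^sub>R (U k z - U l z)) = norm ((?S - d *\<^sub>R U l z) - (?S - d *\<^sub>R U k z))"
        by (simp add: algebra_simps)
      also have "\<dots> \<le> norm (?S - d *\<^sub>R U l z) + norm (?S - d *\<^sub>R U k z)" by (rule norm_triangle_ineq4)
      also have "\<dots> < e / 4 * d + e / 4 * d"
        using U5[OF xy(1-4), of k] U5[OF xy(1-4), of l] N[OF kl(1)] N[OF kl(2)] unfolding xy(5) by linarith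
      finally have "d * norm (U k z - U l z) < d * (e / 2)"
        unfolding norm_scaleR using d by (simp only: abs_of_pos) (simp add: algebra_simps)
      then show ?thesis using d e by simp
    qed
    then show "\<exists>N. \<forall>k\<ge>N. \<forall>l\<ge>N. norm (U k z - U l z) < e" by blast
  qed
  then have "\<forall>z\<in>{0..L}. \<exists>T. (\<lambda>k. U k z) \<longlonglongrightarrow> T" using Cauchy_convergent_iff convergent_def by blast
  then obtain T where T: "\<And>z. z \<in> {0..L} \<Longrightarrow> (\<lambda>k. U k z) \<longlonglongrightarrow> T z" by metis
  have T5: "norm (c y - c x - (y - x) *\<^sub>R T z) \<le> om (y - x) * (y - x)"
    if "0 \<le> x" "x < y" "y \<le> L" "z \<in> {x..y}" for x y z
  proof (rule LIMSEQ_le)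
    show "(\<lambda>k. om (y - x + h k) * (y - x + h k) + h k) \<longlonglongrightarrow> om (y - x) * (y - x)"
      using that by (intro bound_lim) simp
    show "(\<lambda>k. norm (c y - c x - (y - x) *\<^sub>R U k z)) \<longlonglongrightarrow> norm (c y - c x - (y - x) *\<^sub>R T z)"
      using that by (intro tendsto_intros T) auto
    show "\<exists>N. \<forall>k\<ge>N. norm (c y - c x - (y - x) *\<^sub>R U k z) \<le> om (y - x + h k) * (y - x + h k) + h k"
      using U5 that by auto
  qed
  have T3: "(\<Sum>j<n. norm (T (x (Suc j)) - T (x j)) powr p / (x (Suc j) - x j) powr (p - 1)) \<le> M"
    if x: "0 \<le> x 0" "x n \<le> L" "\<And>j. j < n \<Longrightarrow> x j < x (Suc j)" for n and x :: "nat \<Rightarrow> real"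
  proof (rule LIMSEQ_le_const2)
    have xmono: "x i \<le> x k" if "i \<le> k" "k \<le> n" for i k
      using that by (induction rule: dec_induct) (use x(3) in \<open>auto intro: order.trans[OF _ less_imp_le] simp: Suc_le_eq\<close>)
    have xin: "x j \<in> {0..L}" if "j \<le> n" for j using xmono[of 0 j] xmono[of j n] x that by auto
    show "(\<lambda>k. \<Sum>j<n. norm (U k (x (Suc j)) - U k (x j)) powr p / (x (Suc j) - x j + h k) powr (p - 1))
      \<longlonglongrightarrow> (\<Sum>j<n. norm (T (x (Suc j)) - T (x j)) powr p / (x (Suc j) - x j) powr (p - 1))"
    proof (rule tendsto_sum)
      fix j assume j: "j \<in> {..<n}"
      have "(\<lambda>k. norm (U k (x (Suc j)) - U k (x j)) powr p) \<longlonglongrightarrow> norm (T (x (Suc j)) - T (x j)) powr p"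
        using p j by (intro tendsto_powr' tendsto_intros T xin) auto
      moreover have "(\<lambda>k. (x (Suc j) - x j + h k) powr (p - 1)) \<longlonglongrightarrow> (x (Suc j) - x j + 0) powr (p - 1)"
        using x(3)[of j] j by (intro tendsto_intros hlim) auto
      ultimately show "(\<lambda>k. norm (U k (x (Suc j)) - U k (x j)) powr p / (x (Suc j) - x j + h k) powr (p - 1))
        \<longlonglongrightarrow> norm (T (x (Suc j)) - T (x j)) powr p / (x (Suc j) - x j) powr (p - 1)"
        using x(3)[of j] j by (intro tendsto_divide) auto
    qed
    show "\<exists>N. \<forall>k\<ge>N. (\<Sum>j<n. norm (U k (x (Suc j)) - U k (x j)) powr p / (x (Suc j) - x j + h k) powr (p - 1)) \<le> M"
      using U3[of x n] x by (simp add: less_imp_le)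
  qed
  have T4: "norm (T y - T x) \<le> om (y - x)" if "0 \<le> x" "x < y" "y \<le> L" for x y
  proof -
    have "norm (T y - T x) powr p / (y - x) powr (p - 1) \<le> M"
      using T3[of "\<lambda>j. if j = 0 then x else y" 1] that by simp
    then have "norm (T y - T x) powr p \<le> M * (y - x) powr (p - 1)"
      using that by (simp add: divide_le_eq)
    then have "(norm (T y - T x) powr p) powr (1 / p) \<le> om (y - x)"
      unfolding om_def using p by (intro powr_mono2) auto
    then show ?thesis using p by (simp add: powr_powr)
  qed
  have near: "\<forall>\<^sub>F y in at z within {0..L}. om \<bar>y - z\<bar> < e" if e: "0 < e" for z e
  proof -
    obtain d where d: "0 < d" "\<And>r. 0 < r \<Longrightarrow> r < d \<Longrightarrow> om r < e"
      using order_tendstoD(2)[OF om_lim e] unfolding eventually_at_right_field by blast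
    show ?thesis unfolding eventually_at using d by (auto simp: dist_real_def intro!: exI[of _ d])
  qed
  show ?thesis
  proof (rule that[of T])
    fix z assume z: "z \<in> {0..L}"
    show "(c has_vector_derivative T z) (at z within {0..L})"
      unfolding has_vector_derivative_def has_derivative_within_alt
    proof (intro conjI allI impI bounded_linear_scaleR_left)
      fix e :: real assume e: "0 < e"
      obtain d where d: "0 < d" and dd: "\<And>y. y \<in> {0..L} \<Longrightarrow> y \<noteq> z \<Longrightarrow> dist y z < d \<Longrightarrow> om \<bar>y - z\<bar> < e"
        using near[OF e, of z] unfolding eventually_at by blast
      have "norm (c y - c z - (y - z) *\<^sub>R T z) \<le> e * norm (y - z)" if y: "y \<in> {0..L}" "norm (y - z) < d" for y
      proof (cases "y = z")
        case False
        have "norm (c y - c z - (y - z) *\<^sub>R T z) \<le> om \<bar>y - z\<bar> * \<bar>y - z\<bar>"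
        proof (cases "z < y")
          case True then show ?thesis using T5[of z y z] y z by simp
        next
          case F: False
          have "norm (c y - c z - (y - z) *\<^sub>R T z) = norm (c z - c y - (z - y) *\<^sub>R T z)"
            by (subst norm_minus_cancel[symmetric]) (simp add: algebra_simps)
          then show ?thesis using T5[of y z z] y z F False by simp
        qed
        also have "\<dots> \<le> e * \<bar>y - z\<bar>" using dd[OF y(1) False] y by (intro mult_right_mono) (auto simp: dist_norm)
        finally show ?thesis by simp
      qed simp
      then show "\<exists>d>0. \<forall>y\<in>{0..L}. norm (y - z) < d \<longrightarrow> norm (c y - c z - (y - z) *\<^sub>R T z) \<le> e * norm (y - z)"
        using d by blast
    qed
  next
    show "continuous_on {0..L} T"
      unfolding continuous_on_eq_continuous_within continuous_within tendsto_iff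
    proof (intro ballI allI impI)
      fix z e assume z: "z \<in> {0..L}" and e: "(0::real) < e"
      have "\<forall>\<^sub>F y in at z within {0..L}. y \<in> {0..L} \<and> y \<noteq> z" by (simp add: eventually_at_filter)
      with near[OF e, of z] show "\<forall>\<^sub>F y in at z within {0..L}. dist (T y) (T z) < e"
      proof eventually_elim
        case (elim y)
        have "dist (T y) (T z) \<le> om \<bar>y - z\<bar>"
          using T4[of y z] T4[of z y] elim z by (cases "y < z") (auto simp: dist_norm norm_minus_commute)
        then show ?case using elim by simp
      qed
    qed
  qed (use T3 in blast)
qed

section \<open>Dyadic slopes and their limit\<close>

lemma has_integral_uniform_pieces:
  fixes g :: "real \<Rightarrow> 'a::banach"
  assumes h: "0 \<le> h" and I: "\<And>k. k < N \<Longrightarrow> (g has_integral I k) {a + real k * h..a + real (Suc k) * h}"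
  shows "(g has_integral (\<Sum>k<N. I k)) {a..a + real N * h}"
  using I
proof (induction N)
  case (Suc N)
  have "(g has_integral (\<Sum>k<N. I k)) {a..a + real N * h}" by (rule Suc.IH) (use Suc.prems in simp)
  moreover have "(g has_integral I N) {a + real N * h..a + real (Suc N) * h}" by (rule Suc.prems) simp
  ultimately have "(g has_integral (\<Sum>k<N. I k) + I N) {a..a + real (Suc N) * h}"
    by (rule has_integral_combine[rotated 2]) (use h in \<open>auto simp: algebra_simps\<close>)
  then show ?case by simp
qed auto

text \<open>Prepared for the dyadic step functions, whose values at break points are left
  uncontrolled.\<close>

lemma has_integral_const_interior:
  fixes g :: "real \<Rightarrow> 'a::banach"
  assumes "a \<le> b" "\<And>x. a < x \<Longrightarrow> x < b \<Longrightarrow> g x = A"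
  shows "(g has_integral (b - a) *\<^sub>R A) {a..b}"
proof (rule has_integral_spike_finite[of "{a, b}" _ _ "\<lambda>_. A"])
  show "((\<lambda>_. A) has_integral (b - a) *\<^sub>R A) {a..b}"
    using has_integral_const_real[of A a b] assms by simp
qed (use assms in auto)

text \<open>\<open>norm (1, x)\<close> is the square root of \<open>1 + norm x ^ 2\<close>, and the
  difference on the right is its Bregman distance: the value at \<open>y\<close> minus the tangent
  plane at \<open>x\<close>. The Gram determinant of \<open>(1, x)\<close> and \<open>(1, y)\<close>
  is \<open>norm (x - y) ^ 2\<close> plus that of \<open>x\<close> and \<open>y\<close>; factoring
  it as a difference of squares isolates the Bregman distance.\<close>

lemma norm_Pair_1_bregman:
  fixes x y :: "'a::real_inner"
  shows "(norm (x - y))\<^sup>2 \<le> 2 * (norm (1::real, x))\<^sup>2 * norm (1::real, y) *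
    (norm (1::real, y) - ((1::real, x) \<bullet> (1, y)) / norm (1::real, x))"
    and "0 \<le> norm (1::real, y) - ((1::real, x) \<bullet> (1, y)) / norm (1::real, x)"
proof -
  let ?X = "(1::real, x)" and ?Y = "(1::real, y)"
  have X: "0 < norm ?X" by (simp add: norm_Pair add_pos_nonneg)
  have le: "?X \<bullet> ?Y \<le> norm ?X * norm ?Y" by (rule norm_cauchy_schwarz)
  have D: "norm ?X * norm ?Y - ?X \<bullet> ?Y = norm ?X * (norm ?Y - (?X \<bullet> ?Y) / norm ?X)"
    using X by (simp add: right_diff_distrib)
  show D0: "0 \<le> norm ?Y - (?X \<bullet> ?Y) / norm ?X" using le X by (simp add: divide_le_eq mult.commute)
  have "(norm (x - y))\<^sup>2 \<le> (norm ?X)\<^sup>2 * (norm ?Y)\<^sup>2 - (?X \<bullet> ?Y)\<^sup>2"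
  proof -
    have "(x \<bullet> y)\<^sup>2 \<le> (x \<bullet> x) * (y \<bullet> y)" by (rule Cauchy_Schwarz_ineq)
    moreover have "(norm (x - y))\<^sup>2 = x \<bullet> x - 2 * (x \<bullet> y) + y \<bullet> y"
      unfolding power2_norm_eq_inner by (simp add: inner_diff_left inner_diff_right inner_commute)
    moreover have "(norm ?X)\<^sup>2 = 1 + x \<bullet> x" "(norm ?Y)\<^sup>2 = 1 + y \<bullet> y" "?X \<bullet> ?Y = 1 + x \<bullet> y"
      unfolding power2_norm_eq_inner by auto
    ultimately show ?thesis by (simp add: power2_eq_square algebra_simps)
  qed
  also have "\<dots> = (norm ?X * norm ?Y - ?X \<bullet> ?Y) * (norm ?X * norm ?Y + ?X \<bullet> ?Y)"
    by (simp add: power2_eq_square algebra_simps)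
  also have "\<dots> \<le> (norm ?X * norm ?Y - ?X \<bullet> ?Y) * (2 * (norm ?X * norm ?Y))"
    using le by (intro mult_left_mono) auto
  also have "\<dots> = 2 * (norm ?X)\<^sup>2 * norm ?Y * (norm ?Y - (?X \<bullet> ?Y) / norm ?X)"
    unfolding D by (simp add: power2_eq_square)
  finally show "(norm (x - y))\<^sup>2 \<le> 2 * (norm ?X)\<^sup>2 * norm ?Y * (norm ?Y - (?X \<bullet> ?Y) / norm ?X)" .
qed

text \<open>Splits according to whether both vectors have norm at most \<open>R\<close>.\<close>

lemma norm_diff_le_bregman:
  fixes x y :: "'a::real_inner"
  assumes p: "p > 1" and R: "R > 0" and d: "d > 0"
  shows "norm (x - y) \<le> d + 2 * (1 + R) ^ 3 / d * (norm (1::real, y) - ((1::real, x) \<bullet> (1, y)) / norm (1::real, x))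
    + 2 * R powr (1 - p) * (norm x powr p + norm y powr p)"
proof -
  let ?D = "norm (1::real, y) - ((1::real, x) \<bullet> (1, y)) / norm (1::real, x)"
  have D0: "0 \<le> ?D" by (rule norm_Pair_1_bregman(2))
  show ?thesis
  proof (cases "norm x \<le> R \<and> norm y \<le> R")
    case True
    have n: "norm (1::real, z) \<le> 1 + R" if "norm z \<le> R" for z :: 'a
      using norm_Pair_le[of "1::real" z] that by simp
    have "(norm (1::real, x))\<^sup>2 * norm (1::real, y) \<le> (1 + R)\<^sup>2 * (1 + R)"
      using n[of x] n[of y] True by (intro mult_mono power_mono) auto
    then have "2 * (norm (1::real, x))\<^sup>2 * norm (1::real, y) * ?D \<le> 2 * (1 + R) ^ 3 * ?D"
      using D0 by (intro mult_right_mono) (auto simp: power2_eq_square power3_eq_cube)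
    with norm_Pair_1_bregman(1)[of x y] have sq: "(norm (x - y))\<^sup>2 \<le> 2 * (1 + R) ^ 3 * ?D" by linarith
    have "norm (x - y) \<le> d + (norm (x - y))\<^sup>2 / d"
    proof (cases "norm (x - y) \<le> d")
      case True then show ?thesis using d by (simp add: add_increasing2)
    next
      case False
      then have "norm (x - y) * d \<le> (norm (x - y))\<^sup>2" by (simp add: power2_eq_square mult_left_mono)
      then show ?thesis using d by (simp add: pos_le_divide_eq add_increasing)
    qed
    also have "(norm (x - y))\<^sup>2 / d \<le> 2 * (1 + R) ^ 3 / d * ?D"
      using divide_right_mono[OF sq, of d] d by simp
    finally show ?thesis using R by (simp add: add_increasing2)
  next
    case False
    define m where "m = max (norm x) (norm y)"
    have m: "R < m" using False by (auto simp: m_def)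
    have "R powr (p - 1) \<le> m powr (p - 1)" using m R p by (intro powr_mono2) auto
    then have "R powr (1 - p) * R powr (p - 1) \<le> R powr (1 - p) * m powr (p - 1)"
      by (rule mult_left_mono) simp
    then have "1 \<le> R powr (1 - p) * m powr (p - 1)"
      using R by (simp flip: powr_add)
    then have "m * 1 \<le> m * (R powr (1 - p) * m powr (p - 1))" using m R by (intro mult_left_mono) auto
    also have "\<dots> = R powr (1 - p) * m powr p"
      using m R powr_mult_base[of m "p - 1"] by (simp add: mult.left_commute)
    also have "m powr p \<le> norm x powr p + norm y powr p" by (auto simp: m_def max_def)
    finally have "m \<le> R powr (1 - p) * (norm x powr p + norm y powr p)" by (simp add: mult_left_mono)
    moreover have "norm (x - y) \<le> 2 * m" using norm_triangle_ineq4[of x y] by (simp add: m_def)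
    ultimately have "norm (x - y) \<le> 2 * R powr (1 - p) * (norm x powr p + norm y powr p)" by simp
    moreover have "0 \<le> d + 2 * (1 + R) ^ 3 / d * ?D"
      using d R by (intro add_nonneg_nonneg mult_nonneg_nonneg D0) auto
    ultimately show ?thesis by simp
  qed
qed

text \<open>The slopes of \<open>F\<close> on the dyadic intervals of level \<open>n\<close> form a martingale bounded in \<open>L\<^sup>p\<close>, which the
  strictly convex function \<open>x \<mapsto> norm (1, x)\<close> shows to be Cauchy in \<open>L\<^sup>1\<close>.\<close>

lemma riesz_density:
  fixes F :: "real \<Rightarrow> 'a::euclidean_space"
  assumes p: "p > 1" and L: "L > 0" and cont: "continuous_on {0..L} F"
    and R: "\<And>n. 0 < n \<Longrightarrow> (\<Sum>k<n. norm (F (real (Suc k) * (L / real n)) - F (real k * (L / real n))) powr p)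
      \<le> M * (L / real n) powr (p - 1)"
  obtains v where "v absolutely_integrable_on {0..L}"
    "\<And>x y. 0 \<le> x \<Longrightarrow> x \<le> y \<Longrightarrow> y \<le> L \<Longrightarrow> (v has_integral F y - F x) {x..y}"
    "(\<lambda>s. norm (v s) powr p) integrable_on {0..L}" "integral {0..L} (\<lambda>s. norm (v s) powr p) \<le> M"
proof -
  define h where "h = (\<lambda>n::nat. L / 2 ^ n)"
  have h: "0 < h n" for n using L by (simp add: h_def)
  have hr: "h n = real (2 ^ (m - n)) * h m" if "n \<le> m" for n m
  proof -
    have "(2::real) ^ m = 2 ^ n * 2 ^ (m - n)" using that by (simp flip: power_add)
    then show ?thesis by (simp add: h_def)
  qed
  have hL: "real (2 ^ n) * h n = L" "2 ^ n * h n = L" for n unfolding h_def by simp_all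
  define S where "S = (\<lambda>n k. (1 / h n) *\<^sub>R (F (real (Suc k) * h n) - F (real k * h n)))"
  \<comment> \<open>The step function of dyadic slopes. At \<open>L\<close> it refers to a slope
    beyond the interval, which is harmless at a single point.\<close>
  define f where "f = (\<lambda>n x. S n (nat \<lfloor>x / h n\<rfloor>))"
  have fS: "f n x = S n k" if "real k * h n < x" "x < real (Suc k) * h n" for n k x
  proof -
    have "real k < x / h n" "x / h n < real k + 1"
      using that h[of n] by (auto simp: field_simps)
    then have "\<lfloor>x / h n\<rfloor> = int k" by (intro floor_unique) auto
    then show ?thesis by (simp add: f_def)
  qed
  have step: "((\<lambda>x. G (f n x)) has_integral (\<Sum>k<N. h n *\<^sub>R G (S n (a + k)))) {real a * h n..real (a + N) * h n}"
    for G :: "'a \<Rightarrow> 'b::banach" and n a N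
  proof -
    have "((\<lambda>x. G (f n x)) has_integral (\<Sum>k<N. h n *\<^sub>R G (S n (a + k)))) {real a * h n..real a * h n + real N * h n}"
    proof (rule has_integral_uniform_pieces)
      fix k
      have "((\<lambda>x. G (f n x)) has_integral (real (Suc (a + k)) * h n - real (a + k) * h n) *\<^sub>R G (S n (a + k)))
          {real (a + k) * h n..real (Suc (a + k)) * h n}"
        using h[of n] by (intro has_integral_const_interior arg_cong[of _ _ G] fS) (auto intro: mult_right_mono)
      then show "((\<lambda>x. G (f n x)) has_integral h n *\<^sub>R G (S n (a + k)))
          {real a * h n + real k * h n..real a * h n + real (Suc k) * h n}"
        by (simp add: algebra_simps)
    qed (use h[of n] in simp)
    then show ?thesis by (simp add: algebra_simps)
  qed
  have step0: "((\<lambda>x. G (f n x)) has_integral (\<Sum>k<2 ^ n. h n *\<^sub>R G (S n k))) {0..L}"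
    for G :: "'a \<Rightarrow> 'b::banach" and n
    using step[of G n 0 "2 ^ n"] by (simp add: hL)
  have tele: "(\<Sum>k<N. h n *\<^sub>R S n (a + k)) = F (real (a + N) * h n) - F (real a * h n)" for n a N
    using h[of n] sum_lessThan_telescope[of "\<lambda>k. F (real (a + k) * h n)" N] by (simp add: S_def)
  have fint: "(f n has_integral (F (real b * h n) - F (real a * h n))) {real a * h n..real b * h n}" if "a \<le> b" for a b n
    using step[of "\<lambda>x. x" n a "b - a"] tele[of n a "b - a"] that by simp
  \<comment> \<open>The martingale property: a slope of level \<open>n\<close> is the mean over its
    cell of the slopes of any finer level \<open>m\<close>.\<close>
  have fint': "(f m has_integral (F (real b * h n) - F (real a * h n))) {real a * h n..real b * h n}"
    if "a \<le> b" "n \<le> m" for a b n m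
    using fint[of "a * 2 ^ (m - n)" "b * 2 ^ (m - n)" m] that hr[OF that(2)] by (simp add: mult.assoc)
  have piece_in: "h n *\<^sub>R S n j = F (real (Suc j) * h n) - F (real j * h n)" for n j
    using h[of n] by (simp add: S_def)
  have M0: "0 \<le> M"
  proof -
    have "0 \<le> M * (L / real 1) powr (p - 1)"
      using R[of 1] by (rule order_trans[rotated]) (auto intro: sum_nonneg)
    then show ?thesis using L by (simp add: zero_le_mult_iff)
  qed
  have fp: "((\<lambda>x. norm (f n x) powr p) has_integral (\<Sum>k<2 ^ n. h n * norm (S n k) powr p)) {0..L}" for n
    using step0[of "\<lambda>y. norm y powr p" n] by simp
  have fpM: "(\<Sum>k<2 ^ n. h n * norm (S n k) powr p) \<le> M" for n
  proof -
    have "h n * norm (S n k) powr p = norm (F (real (Suc k) * h n) - F (real k * h n)) powr p / h n powr (p - 1)" for k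
      using h[of n] by (simp add: S_def powr_divide powr_diff)
    then have "(\<Sum>k<2 ^ n. h n * norm (S n k) powr p)
        = (\<Sum>k<2 ^ n. norm (F (real (Suc k) * h n) - F (real k * h n)) powr p) / h n powr (p - 1)"
      by (simp add: sum_divide_distrib)
    also have "\<dots> \<le> M"
    proof -
      have "L / real (2 ^ n) = h n" by (simp add: h_def)
      then have "(\<Sum>k<2 ^ n. norm (F (real (Suc k) * h n) - F (real k * h n)) powr p) \<le> M * h n powr (p - 1)"
        using R[of "2 ^ n"] by simp
      then show ?thesis using h[of n] by (simp add: pos_divide_le_eq)
    qed
    finally show ?thesis .
  qed
  have fabs: "f n absolutely_integrable_on {0..L}" for n
    using step0[of "\<lambda>x. x" n] step0[of norm n] by (intro absolutely_integrable_onI) (auto simp: integrable_on_def)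
  define \<phi> where "\<phi> = (\<lambda>x::'a. norm (1::real, x))"
  define D where "D = (\<lambda>x y::'a. \<phi> y - ((1::real, x) \<bullet> (1, y)) / \<phi> x)"
  have \<phi>0: "0 < \<phi> x" for x by (simp add: \<phi>_def norm_Pair add_pos_nonneg)
  define a where "a = (\<lambda>n. integral {0..L} (\<lambda>x. \<phi> (f n x)))"
  have a: "((\<lambda>x. \<phi> (f n x)) has_integral a n) {0..L}" for n
    unfolding a_def using step0[of \<phi> n] by (auto simp: has_integral_iff)
  \<comment> \<open>On a cell of level \<open>n\<close> the tangent plane at the value of
    \<open>f n\<close> is one fixed affine function; by the martingale property its mean along
    \<open>f m\<close> equals that along \<open>f n\<close>. So the Bregman distance integrates to
    the gain in the integral of \<open>\<phi>\<close>.\<close>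
  have Dint: "((\<lambda>x. D (f n x) (f m x)) has_integral (a m - a n)) {0..L}" if nm: "n \<le> m" for n m
  proof -
    define I where "I = (\<lambda>j. integral {real j * h n..real (Suc j) * h n} (\<lambda>x. \<phi> (f m x)))"
    have I: "((\<lambda>x. \<phi> (f m x)) has_integral I j) {real j * h n..real (Suc j) * h n}" for j
      using step[of \<phi> m "j * 2 ^ (m - n)" "2 ^ (m - n)"] hr[OF nm]
      by (simp add: I_def has_integral_iff mult.assoc algebra_simps)
    have "((\<lambda>x. D (f n x) (f m x)) has_integral (I j - h n * \<phi> (S n j))) {real j * h n..real (Suc j) * h n}" for j
    proof -
      let ?s = "S n j" and ?J = "{real j * h n..real (Suc j) * h n}"
      have "(f m has_integral h n *\<^sub>R ?s) ?J" unfolding piece_in using nm by (intro fint') auto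
      from has_integral_linear[OF this bounded_linear_inner_right[of ?s], unfolded o_def]
      have "((\<lambda>x. ?s \<bullet> f m x) has_integral h n * (?s \<bullet> ?s)) ?J" by simp
      moreover have "((\<lambda>x. 1) has_integral h n * 1) ?J"
        using has_integral_const_real[of "1::real" "real j * h n" "real (Suc j) * h n"] h[of n] by (simp add: algebra_simps)
      ultimately have "((\<lambda>x. 1 + ?s \<bullet> f m x) has_integral h n * 1 + h n * (?s \<bullet> ?s)) ?J"
        by (intro has_integral_add)
      then have "((\<lambda>x. \<phi> (f m x) - (1 + ?s \<bullet> f m x) / \<phi> ?s) has_integral I j - (h n * 1 + h n * (?s \<bullet> ?s)) / \<phi> ?s) ?J"
        by (intro has_integral_diff I has_integral_divide)
      moreover have "(h n * 1 + h n * (?s \<bullet> ?s)) / \<phi> ?s = h n * \<phi> ?s"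
      proof -
        have "\<phi> ?s * \<phi> ?s = 1 + ?s \<bullet> ?s"
          by (simp add: \<phi>_def flip: power2_eq_square) (simp add: power2_norm_eq_inner)
        then show ?thesis using \<phi>0[of ?s] by (simp add: divide_eq_eq mult.assoc distrib_left)
      qed
      ultimately have *: "((\<lambda>x. \<phi> (f m x) - (1 + ?s \<bullet> f m x) / \<phi> ?s) has_integral I j - h n * \<phi> ?s) ?J" by simp
      show ?thesis
        by (rule has_integral_spike_finite[of "{real j * h n, real (Suc j) * h n}", OF _ _ *])
          (auto simp: D_def fS[of j n])
    qed
    then have "((\<lambda>x. D (f n x) (f m x)) has_integral (\<Sum>j<2 ^ n. I j - h n * \<phi> (S n j))) {0..0 + real (2 ^ n) * h n}"
      using h[of n] by (intro has_integral_uniform_pieces) auto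
    moreover have "((\<lambda>x. \<phi> (f m x)) has_integral (\<Sum>j<2 ^ n. I j)) {0..0 + real (2 ^ n) * h n}"
      using h[of n] I by (intro has_integral_uniform_pieces) auto
    then have "a m = (\<Sum>j<2 ^ n. I j)" using a[of m] by (simp add: hL has_integral_iff)
    moreover have "a n = (\<Sum>j<2 ^ n. h n * \<phi> (S n j))" using step0[of \<phi> n] a[of n] by (simp add: has_integral_iff)
    ultimately show ?thesis by (simp add: hL sum_subtractf)
  qed
  have D0: "0 \<le> D x y" for x y unfolding D_def \<phi>_def by (rule norm_Pair_1_bregman(2))
  have a_mono: "a n \<le> a m" if "n \<le> m" for n m
    using has_integral_nonneg[OF Dint[OF that]] D0 by simp
  \<comment> \<open>This bound makes the increasing sequence \<open>a\<close> converge, so its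
    increments, which are the integrated Bregman distances, become small.\<close>
  have "a n \<le> 2 * L + M" for n
  proof -
    have le: "\<phi> y \<le> 2 + norm y powr p" for y
    proof -
      have "norm y \<le> 1 + norm y powr p"
      proof (cases "norm y \<le> 1")
        case False
        then have "norm y powr 1 \<le> norm y powr p" using p by (intro powr_mono) auto
        then show ?thesis using False by simp
      qed (simp add: add_increasing2)
      then show ?thesis using norm_Pair_le[of "1::real" y] by (simp add: \<phi>_def)
    qed
    have "((\<lambda>x. 2 + norm (f n x) powr p) has_integral 2 * L + (\<Sum>k<2 ^ n. h n * norm (S n k) powr p)) {0..L}"
      using has_integral_const_real[of "2::real" 0 L] L by (intro has_integral_add fp) (simp add: mult.commute)
    from has_integral_le[OF a this le] show ?thesis using fpM[of n] by simp
  qed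
  note bd = this
  have "incseq a" using a_mono by (simp add: incseq_def)
  then obtain l where "a \<longlonglongrightarrow> l" using incseq_convergent[of a "2 * L + M"] bd by blast
  then have "Cauchy a" by (rule LIMSEQ_imp_Cauchy)
  have fdint: "(\<lambda>x. norm (f i x - f j x)) integrable_on {0..L}" for i j
    using absolutely_integrable_norm[OF set_integral_diff(1)[OF fabs[of i] fabs[of j]]]
    by (simp add: absolutely_integrable_on_def)
  have cauchy: "\<exists>N. \<forall>i\<ge>N. \<forall>j\<ge>N. integral {0..L} (\<lambda>x. norm (f i x - f j x)) < e" if e: "0 < e" for e
  proof -
    \<comment> \<open>\<open>norm_diff_le_bregman\<close> has three terms, each made at most a third
      of \<open>e\<close>: \<open>d\<close> handles the constant, \<open>N\<close> the Bregman term
      and \<open>R\<close> the tails. The 13 exceeds 4 times 3, and \<open>M + 1\<close> avoids a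
      division by zero.\<close>
    obtain R where R0: "0 < R" and Re: "4 * R powr (1 - p) * M < e / 3"
    proof -
      define R where "R = (e / (13 * (M + 1))) powr (1 / (1 - p))"
      have "R powr (1 - p) = e / (13 * (M + 1))" using e M0 p by (simp add: R_def powr_powr)
      moreover have "4 * (e / (13 * (M + 1))) * M < e / 3"
        using e M0 by (simp add: field_simps) (smt (verit) mult_nonneg_nonneg)
      ultimately show ?thesis using that[of R] e M0 by (simp add: R_def)
    qed
    define d where "d = e / (3 * L)"
    have d: "0 < d" using e L by (simp add: d_def)
    define K where "K = 2 * (1 + R) ^ 3 / d"
    have K: "0 < K" using d R0 by (simp add: K_def)
    obtain N where N: "\<And>n m. n \<ge> N \<Longrightarrow> m \<ge> N \<Longrightarrow> norm (a m - a n) < e / (3 * K)"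
      using CauchyD[OF \<open>Cauchy a\<close>, of "e / (3 * K)"] e K by auto
    have main: "integral {0..L} (\<lambda>x. norm (f n x - f m x)) < e" if nm: "N \<le> n" "n \<le> m" for n m
    proof -
      have "((\<lambda>x. d + K * D (f n x) (f m x) + 2 * R powr (1 - p) * (norm (f n x) powr p + norm (f m x) powr p))
        has_integral (L * d + K * (a m - a n) + 2 * R powr (1 - p) *
          ((\<Sum>k<2 ^ n. h n * norm (S n k) powr p) + (\<Sum>k<2 ^ m. h m * norm (S m k) powr p)))) {0..L}"
        using has_integral_const_real[of d 0 L] L nm
        by (intro has_integral_add has_integral_mult_right fp Dint) auto
      then have "integral {0..L} (\<lambda>x. norm (f n x - f m x)) \<le> L * d + K * (a m - a n) + 2 * R powr (1 - p) *
          ((\<Sum>k<2 ^ n. h n * norm (S n k) powr p) + (\<Sum>k<2 ^ m. h m * norm (S m k) powr p))"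
        using norm_diff_le_bregman[OF p R0 d]
        by (intro has_integral_le[OF integrable_integral[OF fdint]]) (auto simp: K_def D_def \<phi>_def)
      also have "\<dots> \<le> L * d + K * (a m - a n) + 2 * R powr (1 - p) * (M + M)"
        using fpM by (intro add_left_mono mult_left_mono add_mono) auto
      also have "L * d = e / 3" using L by (simp add: d_def)
      also have "K * (a m - a n) < e / 3"
      proof -
        have "K * (a m - a n) < K * (e / (3 * K))" using N[of n m] nm K by (intro mult_strict_left_mono) auto
        then show ?thesis using K by simp
      qed
      finally show ?thesis using Re by simp
    qed
    have "integral {0..L} (\<lambda>x. norm (f i x - f j x)) < e" if "N \<le> i" "N \<le> j" for i j
      using main[of i j] main[of j i] that by (cases "i \<le> j") (auto simp: norm_minus_commute)
    then show ?thesis by blast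
  qed
  let ?M = "lebesgue_on {0..L}"
  have fI: "integrable ?M (f n)" for n using fabs[of n] by (simp add: absolutely_integrable_on_def[symmetric] set_integrable_def integrable_restrict_space)
  have fM[measurable]: "f n \<in> borel_measurable ?M" for n using fI by auto
  have L1: "(LINT x|?M. norm (f i x - f j x)) = integral {0..L} (\<lambda>x. norm (f i x - f j x))" for i j
    using fI by (intro lebesgue_integral_eq_integral) auto
  \<comment> \<open>The almost everywhere limit along a subsequence defines \<open>v\<close>;
    Fatou's lemma then gives its energy bound and the convergence of the whole sequence in the
    mean.\<close>
  obtain r where r: "strict_mono r" and AEc: "AE x in ?M. Cauchy (\<lambda>i. f (r i) x)"
    by (rule cauchy_L1_AE_cauchy_subseq[of ?M f]) (use fI cauchy L1 in auto)
  define v where "v = (\<lambda>x. lim (\<lambda>i. f (r i) x))"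
  have vM[measurable]: "v \<in> borel_measurable ?M" unfolding v_def by measurable
  have AEl: "AE x in ?M. (\<lambda>i. f (r i) x) \<longlonglongrightarrow> v x"
    using AEc by eventually_elim (simp add: v_def Cauchy_convergent_iff convergent_LIMSEQ_iff)
  have nnI: "(\<integral>\<^sup>+x. ennreal (g x) \<partial>?M) = ennreal (integral {0..L} g)"
    if "\<And>x. 0 \<le> g x" "g integrable_on {0..L}" for g
    using set_nn_integral_eq_integral[of "{0..L}" g] that
    by (subst nn_integral_restrict_space) (auto simp: mult.commute)
  have "(\<integral>\<^sup>+x. ennreal (norm (v x) powr p) \<partial>?M) \<le> liminf (\<lambda>i. \<integral>\<^sup>+x. ennreal (norm (f (r i) x) powr p) \<partial>?M)"
  proof -
    have "AE x in ?M. ennreal (norm (v x) powr p) = liminf (\<lambda>i. ennreal (norm (f (r i) x) powr p))"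
      using AEl
    proof eventually_elim
      case (elim x)
      then have "(\<lambda>i. ennreal (norm (f (r i) x) powr p)) \<longlonglongrightarrow> ennreal (norm (v x) powr p)"
        using p by (intro tendsto_ennrealI tendsto_powr' tendsto_norm tendsto_const) auto
      from lim_imp_Liminf[OF sequentially_bot this] show ?case by (rule sym)
    qed
    then have "(\<integral>\<^sup>+x. ennreal (norm (v x) powr p) \<partial>?M) = (\<integral>\<^sup>+x. liminf (\<lambda>i. ennreal (norm (f (r i) x) powr p)) \<partial>?M)"
      by (rule nn_integral_cong_AE)
    also have "\<dots> \<le> liminf (\<lambda>i. \<integral>\<^sup>+x. ennreal (norm (f (r i) x) powr p) \<partial>?M)"
      by (rule nn_integral_liminf) measurable
    finally show ?thesis .
  qed
  also have "\<dots> \<le> ennreal M"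
  proof (rule Liminf_le)
    show "\<forall>\<^sub>F i in sequentially. (\<integral>\<^sup>+x. ennreal (norm (f (r i) x) powr p) \<partial>?M) \<le> ennreal M"
      using fp fpM by (intro always_eventually allI) (subst nnI, auto simp: has_integral_iff intro!: ennreal_leI)
  qed simp
  finally have vp: "(\<integral>\<^sup>+x. ennreal (norm (v x) powr p) \<partial>?M) \<le> ennreal M" .
  have vd: "(\<integral>\<^sup>+x. ennreal (norm (f j x - v x)) \<partial>?M) \<le> ennreal e"
    if N: "\<And>i j. N \<le> i \<Longrightarrow> N \<le> j \<Longrightarrow> integral {0..L} (\<lambda>x. norm (f i x - f j x)) < e" "N \<le> j" for j N e
  proof -
    have "AE x in ?M. ennreal (norm (f j x - v x)) = liminf (\<lambda>i. ennreal (norm (f j x - f (r i) x)))"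
      using AEl
    proof eventually_elim
      case (elim x)
      then have "(\<lambda>i. ennreal (norm (f j x - f (r i) x))) \<longlonglongrightarrow> ennreal (norm (f j x - v x))"
        by (intro tendsto_ennrealI tendsto_intros)
      from lim_imp_Liminf[OF sequentially_bot this] show ?case by (rule sym)
    qed
    then have "(\<integral>\<^sup>+x. ennreal (norm (f j x - v x)) \<partial>?M) = (\<integral>\<^sup>+x. liminf (\<lambda>i. ennreal (norm (f j x - f (r i) x))) \<partial>?M)"
      by (rule nn_integral_cong_AE)
    also have "\<dots> \<le> liminf (\<lambda>i. \<integral>\<^sup>+x. ennreal (norm (f j x - f (r i) x)) \<partial>?M)"
      by (rule nn_integral_liminf) measurable
    also have "\<dots> \<le> ennreal e"
    proof (rule Liminf_le)
      show "\<forall>\<^sub>F i in sequentially. (\<integral>\<^sup>+x. ennreal (norm (f j x - f (r i) x)) \<partial>?M) \<le> ennreal e"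
        using eventually_ge_at_top[of N]
      proof eventually_elim
        case (elim i)
        then have "N \<le> r i" using seq_suble[OF r, of i] by simp
        then show ?case using N(1)[OF N(2), of "r i"] fdint by (subst nnI) (auto intro: ennreal_leI)
      qed
    qed simp
    finally show ?thesis .
  qed
  have vI: "integrable ?M v"
  proof -
    obtain N where N: "\<And>i j. N \<le> i \<Longrightarrow> N \<le> j \<Longrightarrow> integral {0..L} (\<lambda>x. norm (f i x - f j x)) < 1"
      using cauchy[of 1] by auto
    have "integrable ?M (\<lambda>x. f N x - v x)"
    proof (rule integrableI_bounded)
      have "(\<integral>\<^sup>+x. ennreal (norm (f N x - v x)) \<partial>?M) \<le> ennreal 1" using vd[OF N order_refl] by simp
      also have "ennreal 1 < \<infinity>" by simp
      finally show "(\<integral>\<^sup>+x. ennreal (norm (f N x - v x)) \<partial>?M) < \<infinity>" .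
    qed measurable
    from Bochner_Integration.integrable_diff[OF fI[of N] this] show ?thesis by simp
  qed
  then have vabs: "v absolutely_integrable_on {0..L}"
    by (simp add: set_integrable_def integrable_restrict_space)
  have vint: "v integrable_on {x..y}" if "0 \<le> x" "y \<le> L" for x y
    using set_lebesgue_integral_eq_integral(1)[OF vabs] that by (intro integrable_on_subinterval) auto
  have lim: "(\<lambda>j. integral {x..y} (f j)) \<longlonglongrightarrow> integral {x..y} v" if xy: "0 \<le> x" "y \<le> L" for x y
  proof (rule LIMSEQ_I)
    fix e :: real assume e: "0 < e"
    obtain N where N: "\<And>i j. N \<le> i \<Longrightarrow> N \<le> j \<Longrightarrow> integral {0..L} (\<lambda>x. norm (f i x - f j x)) < e / 2"
      using cauchy[of "e / 2"] e by auto
    have "norm (integral {x..y} (f j) - integral {x..y} v) < e" if j: "N \<le> j" for j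
    proof -
      have fj: "f j integrable_on {x..y}"
        using set_lebesgue_integral_eq_integral(1)[OF fabs[of j]] xy by (intro integrable_on_subinterval) auto
      have ni: "(\<lambda>x. norm (f j x - v x)) integrable_on {0..L}"
        using absolutely_integrable_norm[OF set_integral_diff(1)[OF fabs[of j] vabs]]
        by (simp add: absolutely_integrable_on_def)
      have "norm (integral {x..y} (f j) - integral {x..y} v) = norm (integral {x..y} (\<lambda>s. f j s - v s))"
        using fj vint[OF xy] by (simp add: integral_diff)
      also have "\<dots> \<le> integral {x..y} (\<lambda>s. norm (f j s - v s))"
        using fj vint[OF xy] integrable_on_subinterval[OF ni, of x y] xy
        by (intro integral_norm_bound_integral integrable_diff) auto
      also have "\<dots> \<le> integral {0..L} (\<lambda>s. norm (f j s - v s))"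
        using xy integrable_on_subinterval[OF ni, of x y] ni by (intro integral_subset_le) auto
      also have "\<dots> \<le> e / 2"
      proof -
        have "(\<integral>\<^sup>+x. ennreal (norm (f j x - v x)) \<partial>?M) \<le> ennreal (e / 2)"
          by (rule vd[of N]) (use N j in auto)
        then have "ennreal (integral {0..L} (\<lambda>s. norm (f j s - v s))) \<le> ennreal (e / 2)"
          using nnI[OF _ ni] by simp
        then show ?thesis using e by (simp add: ennreal_le_iff)
      qed
      finally show ?thesis using e by simp
    qed
    then show "\<exists>N. \<forall>j\<ge>N. norm (integral {x..y} (f j) - integral {x..y} v) < e" by blast
  qed
  \<comment> \<open>At a dyadic point the integral of \<open>f j\<close> is eventually constant in
    \<open>j\<close>, so the limit is exact there; continuity covers the other points.\<close>
  have dy: "integral {0..real k * h n} v = F (real k * h n) - F 0" if k: "k \<le> 2 ^ n" for k n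
  proof (rule LIMSEQ_unique)
    have "real k * h n \<le> real (2 ^ n) * h n" using k h[of n] by (intro mult_right_mono) auto
    then show "(\<lambda>j. integral {0..real k * h n} (f j)) \<longlonglongrightarrow> integral {0..real k * h n} v"
      by (intro lim) (auto simp: hL)
    have "\<forall>\<^sub>F j in sequentially. integral {0..real k * h n} (f j) = F (real k * h n) - F 0"
      using eventually_ge_at_top[of n]
    proof eventually_elim
      case (elim j)
      then show ?case using fint'[of 0 k n j] by (simp add: integral_unique)
    qed
    then show "(\<lambda>j. integral {0..real k * h n} (f j)) \<longlonglongrightarrow> F (real k * h n) - F 0"
      by (rule tendsto_eventually)
  qed
  have all: "integral {0..x} v = F x - F 0" if x: "x \<in> {0..L}" for x
  proof -
    define X where "X = (\<lambda>n. real (nat \<lfloor>x / h n\<rfloor>) * h n)"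
    have k: "real (nat \<lfloor>x / h n\<rfloor>) \<le> x / h n" "x / h n < real (nat \<lfloor>x / h n\<rfloor>) + 1" for n
    proof -
      have "0 \<le> x / h n" using x h[of n] by simp
      then have "real (nat \<lfloor>x / h n\<rfloor>) = of_int \<lfloor>x / h n\<rfloor>" by simp
      then show "real (nat \<lfloor>x / h n\<rfloor>) \<le> x / h n" "x / h n < real (nat \<lfloor>x / h n\<rfloor>) + 1" by linarith+
    qed
    have Xx: "X n \<le> x" "x - h n < X n" for n
      using k[of n] h[of n] by (auto simp: X_def field_simps)
    have "0 \<le> X n" for n unfolding X_def using h[of n] by (intro mult_nonneg_nonneg) auto
    then have X0: "X n \<in> {0..L}" for n using Xx(1)[of n] x by (auto intro: order_trans)
    have k2: "nat \<lfloor>x / h n\<rfloor> \<le> 2 ^ n" for n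
    proof -
      have "real (nat \<lfloor>x / h n\<rfloor>) * h n \<le> real (2 ^ n) * h n" using Xx(1)[of n] x unfolding hL X_def by simp
      then show ?thesis using h[of n] by (simp only: mult_le_cancel_right_pos of_nat_le_iff)
    qed
    have hlim: "h \<longlonglongrightarrow> 0" unfolding h_def by (rule LIMSEQ_divide_realpow_zero) simp
    have "X \<longlonglongrightarrow> x"
    proof (rule real_tendsto_sandwich)
      show "(\<lambda>n. x - h n) \<longlonglongrightarrow> x" using tendsto_diff[OF tendsto_const hlim, of x] by simp
      show "(\<lambda>_. x) \<longlonglongrightarrow> x" by simp
    qed (use Xx in \<open>auto intro!: always_eventually less_imp_le\<close>)
    moreover have "continuous_on {0..L} (\<lambda>x. integral {0..x} v - (F x - F 0))"
      using vint L by (intro continuous_intros cont indefinite_integral_continuous_1) auto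
    ultimately have "(\<lambda>n. integral {0..X n} v - (F (X n) - F 0)) \<longlonglongrightarrow> integral {0..x} v - (F x - F 0)"
      using x X0 by (auto simp: continuous_on_sequentially o_def)
    moreover have "integral {0..X n} v - (F (X n) - F 0) = 0" for n using dy[OF k2] by (simp add: X_def)
    ultimately have "(\<lambda>n. 0) \<longlonglongrightarrow> integral {0..x} v - (F x - F 0)" by simp
    then show ?thesis using LIMSEQ_unique tendsto_const by fastforce
  qed
  have vpi: "(\<lambda>s. norm (v s) powr p) integrable_on {0..L}"
  proof (rule integrable_on_of_nn_integral)
    have "(\<integral>\<^sup>+x\<in>{0..L}. ennreal (norm (v x) powr p) \<partial>lebesgue) = (\<integral>\<^sup>+x. ennreal (norm (v x) powr p) \<partial>?M)"
      by (subst nn_integral_restrict_space) auto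
    then show "(\<integral>\<^sup>+x\<in>{0..L}. ennreal (norm (v x) powr p) \<partial>lebesgue) < \<infinity>"
      using vp by (auto intro: le_less_trans)
  qed auto
  show ?thesis
  proof (rule that[OF vabs _ vpi])
    fix x y assume xy: "0 \<le> x" "x \<le> y" "y \<le> L"
    have "integral {0..x} v + integral {x..y} v = integral {0..y} v"
      using xy vint by (intro Henstock_Kurzweil_Integration.integral_combine) auto
    then show "(v has_integral F y - F x) {x..y}"
      using all[of x] all[of y] xy vint[of x y] by (auto simp: has_integral_iff algebra_simps)
  next
    show "integral {0..L} (\<lambda>s. norm (v s) powr p) \<le> M"
      using vp nnI[OF _ vpi] M0 by (simp add: ennreal_le_iff)
  qed
qed

section \<open>Test functions and vanishing weak second derivatives\<close>

text \<open>The powers of \<open>inverse x\<close> are carried along because differentiating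
  \<open>exp (- inverse x)\<close> produces them; the derivative of a member is then a combination
  of members.\<close>

definition flat :: "nat \<Rightarrow> real \<Rightarrow> real" where
  "flat k x = (if x > 0 then exp (- inverse x) * inverse x ^ k else 0)"

lemma flat_tendsto_0: "(flat k \<longlongrightarrow> 0) (at_right 0)"
proof -
  have "((\<lambda>x. inverse x ^ k / exp (inverse x)) \<longlongrightarrow> (0::real)) (at_right 0)"
    by (rule filterlim_compose[OF tendsto_power_div_exp_0 filterlim_inverse_at_top_right])
  moreover have "\<forall>\<^sub>F x in at_right 0. inverse x ^ k / exp (inverse x) = flat k x"
    using eventually_at_right_less[of "0::real"]
    by eventually_elim (simp add: flat_def exp_minus field_simps)
  ultimately show ?thesis by (rule Lim_transform_eventually)
qed

text \<open>At 0 the difference quotient from the right is \<open>flat (Suc k)\<close>, so the decay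
  of the whole family settles the derivative there; elsewhere it is computed.\<close>

lemma DERIV_flat: "(flat k has_real_derivative (flat (k + 2) x - real k * flat (k + 1) x)) (at x)"
proof -
  consider "x < 0" | "x = 0" | "x > 0" by linarith
  then show ?thesis
  proof cases
    case 1
    have "((\<lambda>_. 0) has_real_derivative 0) (at x)" by simp
    then have "(flat k has_real_derivative 0) (at x)"
      by (rule has_field_derivative_transform_within_open[of _ _ _ "{..<0}"]) (use 1 in \<open>auto simp: flat_def\<close>)
    then show ?thesis using 1 by (simp add: flat_def)
  next
    case 2
    have "((\<lambda>h. (flat k (0 + h) - flat k 0) / h) \<longlongrightarrow> 0) (at 0)"
    proof (rule filterlim_split_at)
      have "\<forall>\<^sub>F h in at_left 0. 0 = (flat k (0 + h) - flat k 0) / h"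
        by (auto simp: eventually_at_left[of "-1"] flat_def intro!: exI[of _ "-1"])
      then show "((\<lambda>h. (flat k (0 + h) - flat k 0) / h) \<longlongrightarrow> 0) (at_left 0)"
        by (rule Lim_transform_eventually[OF tendsto_const])
      have "\<forall>\<^sub>F h in at_right 0. flat (Suc k) h = (flat k (0 + h) - flat k 0) / h"
        using eventually_at_right_less[of "0::real"]
        by eventually_elim (simp add: flat_def field_simps)
      then show "((\<lambda>h. (flat k (0 + h) - flat k 0) / h) \<longlongrightarrow> 0) (at_right 0)"
        by (rule Lim_transform_eventually[OF flat_tendsto_0])
    qed
    then show ?thesis using 2 by (simp add: DERIV_def flat_def)
  next
    case 3
    have i: "(inverse has_real_derivative - ((inverse x)\<^sup>2)) (at x)"
      using DERIV_inverse[of x] 3 by (simp add: power2_eq_square)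
    have "((\<lambda>x. inverse x ^ k) has_real_derivative - (real k * inverse x ^ (k + 1))) (at x)"
      by (rule DERIV_cong[OF DERIV_power[OF i]]) (cases k; simp add: power2_eq_square)
    moreover have "((\<lambda>x. exp (- inverse x)) has_real_derivative exp (- inverse x) * (inverse x)\<^sup>2) (at x)"
      by (rule DERIV_cong[OF DERIV_fun_exp[OF DERIV_minus[OF i]]]) simp
    ultimately have "((\<lambda>x. exp (- inverse x) * inverse x ^ k) has_real_derivative
        (flat (k + 2) x - real k * flat (k + 1) x)) (at x)"
      by (rule DERIV_cong[OF DERIV_mult[rotated]]) (use 3 in \<open>simp add: flat_def power_add power2_eq_square\<close>)
    then show ?thesis
      by (rule has_field_derivative_transform_within_open[of _ _ _ "{0<..}"]) (use 3 in \<open>auto simp: flat_def\<close>)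
  qed
qed

text \<open>A class stable under differentiation, so that membership proves smoothness of every
  order. Products of rescaled \<open>flat\<close> functions, hence bumps, belong to it.\<close>

inductive flat_algebra :: "(real \<Rightarrow> real) \<Rightarrow> bool" where
  flat: "flat_algebra (\<lambda>x. flat k (s * x + t))"
| const: "flat_algebra (\<lambda>x. r)"
| add: "flat_algebra f \<Longrightarrow> flat_algebra g \<Longrightarrow> flat_algebra (\<lambda>x. f x + g x)"
| mult: "flat_algebra f \<Longrightarrow> flat_algebra g \<Longrightarrow> flat_algebra (\<lambda>x. f x * g x)"

lemma flat_algebra_deriv:
  "flat_algebra f \<Longrightarrow> \<exists>f'. flat_algebra f' \<and> (\<forall>x. (f has_real_derivative f' x) (at x))"
proof (induction rule: flat_algebra.induct)
  case (flat k s t)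
  have "((\<lambda>x. flat k (s * x + t)) has_real_derivative
      ((flat (k + 2) (s * x + t) + (- real k) * flat (k + 1) (s * x + t)) * s)) (at x)" for x
    by (rule DERIV_cong[OF DERIV_chain2[OF DERIV_flat]]) (auto intro!: derivative_eq_intros)
  moreover have "flat_algebra (\<lambda>x. (flat (k + 2) (s * x + t) + (- real k) * flat (k + 1) (s * x + t)) * s)"
    by (intro flat_algebra.intros)
  ultimately show ?case by blast
next
  case (const r)
  show ?case by (rule exI[of _ "\<lambda>_. 0"]) (auto intro: flat_algebra.intros)
next
  case (add f g)
  then obtain f' g' where "flat_algebra f'" "\<forall>x. (f has_real_derivative f' x) (at x)"
    "flat_algebra g'" "\<forall>x. (g has_real_derivative g' x) (at x)" by blast
  then show ?case
    by (intro exI[of _ "\<lambda>x. f' x + g' x"]) (auto intro: flat_algebra.intros DERIV_add)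
next
  case (mult f g)
  then obtain f' g' where d: "flat_algebra f'" "\<forall>x. (f has_real_derivative f' x) (at x)"
    "flat_algebra g'" "\<forall>x. (g has_real_derivative g' x) (at x)" by blast
  have "((\<lambda>x. f x * g x) has_real_derivative f' x * g x + g' x * f x) (at x)" for x
    using d by (intro DERIV_mult) auto
  moreover have "flat_algebra (\<lambda>x. f' x * g x + g' x * f x)"
    using d mult by (intro flat_algebra.intros)
  ultimately show ?case by blast
qed

text \<open>Smoothness by induction: every iterated derivative stays in a set that is closed under
  differentiation.\<close>

lemma iterated_deriv_differentiable:
  fixes f :: "real \<Rightarrow> real"
  assumes "f \<in> S" "\<And>g. g \<in> S \<Longrightarrow> \<exists>g'\<in>S. \<forall>x. (g has_real_derivative g' x) (at x)"
  shows "(deriv ^^ k) f field_differentiable (at x)"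
proof -
  have "(deriv ^^ k) f \<in> S"
  proof (induction k)
    case (Suc k)
    then obtain g' where "g' \<in> S" "\<forall>x. ((deriv ^^ k) f has_real_derivative g' x) (at x)"
      using assms(2) by blast
    moreover then have "deriv ((deriv ^^ k) f) = g'" by (auto intro: DERIV_imp_deriv)
    ultimately show ?case by simp
  qed (use assms in simp)
  then show ?thesis using assms(2) by (auto simp: field_differentiable_def)
qed

lemma antiderivative_of_left_supported:
  fixes f :: "real \<Rightarrow> real"
  assumes cont: "continuous_on UNIV f" and z: "\<And>x. x \<le> A \<Longrightarrow> f x = 0"
  obtains G where "\<And>x. (G has_real_derivative f x) (at x)" "\<And>x. x \<le> A \<Longrightarrow> G x = 0"
proof -
  \<comment> \<open>The base point lies before the support of \<open>f\<close>. For smaller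
    \<open>x\<close> the integral runs over an empty interval and is 0, so \<open>G\<close> is an
    antiderivative on the whole line.\<close>
  define G where "G = (\<lambda>x. integral {A - 1..x} f)"
  have G0: "G x = 0" if "x \<le> A" for x
    unfolding G_def using z that integral_cong[of "{A - 1..x}" f "\<lambda>_. 0"] by simp
  have "(G has_real_derivative f x) (at x)" for x
  proof (cases "x \<le> A - 1 / 2")
    case True
    have "((\<lambda>_. 0) has_real_derivative 0) (at x)" by simp
    then have "(G has_real_derivative 0) (at x)"
      by (rule has_field_derivative_transform_within_open[of _ _ _ "{..<A}"]) (use True G0 in auto)
    then show ?thesis using z[of x] True by simp
  next
    case False
    have "(G has_vector_derivative f x) (at x within {A - 1..x + 1})"
      unfolding G_def using False
      by (intro integral_has_vector_derivative continuous_on_subset[OF cont]) auto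
    then show ?thesis using False
      by (simp add: at_within_Icc_at has_real_derivative_iff_has_vector_derivative)
  qed
  then show ?thesis using that G0 by blast
qed

lemma test_function_zero_outside:
  assumes "x \<notin> closure {x. \<phi> x \<noteq> 0}"
  shows "(deriv ^^ k) \<phi> x = 0"
  using assms
proof (induction k arbitrary: x)
  case 0
  then show ?case using closure_subset[of "{x. \<phi> x \<noteq> 0}"] by auto
next
  case (Suc k)
  let ?U = "- closure {x. \<phi> x \<noteq> 0}"
  have "((\<lambda>_. 0) has_field_derivative 0) (at x)" by simp
  then have "((deriv ^^ k) \<phi> has_field_derivative 0) (at x)"
    by (rule has_field_derivative_transform_within_open[of _ _ _ ?U]) (use Suc in auto)
  then show ?case by (simp add: DERIV_imp_deriv)
qed

text \<open>Tested against the second difference of an antiderivative of an antiderivative of a narrow bump,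
  the weak equation \<open>u'' = 0\<close> says that the second difference of the mollified \<open>u\<close> vanishes.\<close>

lemma weak_second_deriv_0_imp_second_difference_0:
  fixes u :: "real \<Rightarrow> 'a::euclidean_space"
  assumes cont: "continuous_on {a..b} u"
    and weak: "\<And>\<phi>. test_function {a<..<b} \<phi> \<Longrightarrow> integral {a..b} (\<lambda>x. (deriv ^^ 2) \<phi> x *\<^sub>R u x) = 0"
    and d: "0 < d" "a < z - d" "z + d < b"
  shows "u (z + d) - 2 *\<^sub>R u z + u (z - d) = 0"
proof (rule ccontr)
  let ?w = "u (z + d) - 2 *\<^sub>R u z + u (z - d)"
  assume "?w \<noteq> 0"
  \<comment> \<open>The errors below add up to \<open>4 * e\<close>, so a fifth of
    \<open>norm ?w\<close> leads to a contradiction.\<close>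
  define e where "e = norm ?w / 5"
  have e: "0 < e" using \<open>?w \<noteq> 0\<close> by (simp add: e_def)
  have "uniformly_continuous_on {a..b} u" using cont by (intro compact_uniformly_continuous) auto
  then obtain r where r: "0 < r" and ur: "\<And>x y. x \<in> {a..b} \<Longrightarrow> y \<in> {a..b} \<Longrightarrow> dist y x < r \<Longrightarrow> dist (u y) (u x) < e"
    unfolding uniformly_continuous_on_def using e by metis
  \<comment> \<open>The radius of the bump: below the continuity scale \<open>r\<close>, and small
    enough for the bumps at \<open>z - d\<close>, \<open>z\<close> and \<open>z + d\<close> to lie
    inside the interval.\<close>
  define s where "s = min (r / 2) (min ((z - d - a) / 2) ((b - z - d) / 2))"
  have s: "0 < s" "s < r" "a < z - d - s" "z + d + s < b"
    using r d by (auto simp: s_def min_def field_simps)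
  define \<beta> where "\<beta> = (\<lambda>y. flat 0 (s + y) * flat 0 (s - y))"
  have \<beta>0: "\<beta> y = 0" if "\<bar>y\<bar> \<ge> s" for y using that by (auto simp: \<beta>_def flat_def abs_if split: if_splits)
  have \<beta>pos: "0 < \<beta> y" if "\<bar>y\<bar> < s" for y using that by (auto simp: \<beta>_def flat_def)
  have \<beta>nn: "0 \<le> \<beta> y" for y using \<beta>0[of y] \<beta>pos[of y] by (cases "\<bar>y\<bar> < s") (auto simp: less_imp_le)
  have alg: "flat_algebra (\<lambda>y. \<beta> (y - q))" for q
    using flat_algebra.mult[OF flat_algebra.flat[of 0 1 "s - q"] flat_algebra.flat[of 0 "-1" "s + q"]]
    by (simp add: \<beta>_def algebra_simps)
  have \<beta>c: "continuous_on A (\<lambda>y. \<beta> (y - q))" for A q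
    using flat_algebra_deriv[OF alg[of q]] DERIV_isCont by (metis continuous_at_imp_continuous_on)
  have \<beta>c0: "continuous_on A \<beta>" for A using \<beta>c[of A 0] by simp
  obtain G where G: "\<And>x. (G has_real_derivative \<beta> x) (at x)" "\<And>x. x \<le> - s \<Longrightarrow> G x = 0"
    by (rule antiderivative_of_left_supported[OF \<beta>c0, of "- s"]) (use \<beta>0 in auto)
  have Gc: "continuous_on A G" for A using G(1) DERIV_isCont continuous_at_imp_continuous_on by blast
  obtain H where H: "\<And>x. (H has_real_derivative G x) (at x)" "\<And>x. x \<le> - s \<Longrightarrow> H x = 0"
    by (rule antiderivative_of_left_supported[OF Gc, of "- s"]) (use G in auto)
  have Gr: "G x = G s" if "s \<le> x" for x
  proof (cases "s = x")
    case False
    show ?thesis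
    proof (rule DERIV_isconst_end[OF _ Gc])
      show "s < x" using that False by simp
      show "(G has_real_derivative 0) (at y)" if "s < y" "y < x" for y
        using G(1)[of y] \<beta>0[of y] that by simp
    qed
  qed simp
  \<comment> \<open>Beyond the bump \<open>H\<close> is affine, so its second difference vanishes
    there; this gives \<open>\<phi>0\<close> compact support.\<close>
  have Hr: "H x = H s + G s * (x - s)" if "s \<le> x" for x
  proof (cases "s = x")
    case False
    have D: "((\<lambda>x. H x - G s * x) has_real_derivative (G x - G s)) (at x)" for x
      by (auto intro!: derivative_eq_intros H)
    have "H x - G s * x = H s - G s * s"
    proof (rule DERIV_isconst_end[where f = "\<lambda>x. H x - G s * x"])
      show "s < x" using that False by simp
      show "continuous_on {s..x} (\<lambda>x. H x - G s * x)"
        using D DERIV_isCont continuous_at_imp_continuous_on by blast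
      show "((\<lambda>x. H x - G s * x) has_real_derivative 0) (at y)" if "s < y" "y < x" for y
        using D[of y] Gr[of y] that by simp
    qed
    then show ?thesis by (simp add: algebra_simps)
  qed simp
  have G0: "0 < G s"
  proof -
    have "G (- s) < G s"
    proof (rule DERIV_pos_imp_increasing_open[OF _ _ Gc])
      show "\<exists>y. (G has_real_derivative y) (at x) \<and> 0 < y" if "- s < x" "x < s" for x
        using G(1)[of x] \<beta>pos[of x] that by (intro exI[of _ "\<beta> x"]) auto
    qed (use s in simp)
    then show ?thesis using G(2)[of "- s"] by simp
  qed
  define \<phi>0 where "\<phi>0 = (\<lambda>y. H (y - (z + d)) + ((- 2) * H (y - z) + H (y - (z - d))))"
  define \<phi>1 where "\<phi>1 = (\<lambda>y. G (y - (z + d)) + ((- 2) * G (y - z) + G (y - (z - d))))"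
  define \<phi>2 where "\<phi>2 = (\<lambda>y. \<beta> (y - (z + d)) + ((- 2) * \<beta> (y - z) + \<beta> (y - (z - d))))"
  have shift: "((\<lambda>y. f (y - q)) has_real_derivative f' (y - q)) (at y)"
    if "\<And>x. (f has_real_derivative f' x) (at x)" for f f' and q y :: real
    by (rule DERIV_cong[OF DERIV_chain2[OF that]]) (auto intro!: derivative_eq_intros)
  have d01: "(\<phi>0 has_real_derivative \<phi>1 y) (at y)" for y
    unfolding \<phi>0_def \<phi>1_def by (intro DERIV_add DERIV_cmult shift H)
  have d12: "(\<phi>1 has_real_derivative \<phi>2 y) (at y)" for y
    unfolding \<phi>1_def \<phi>2_def by (intro DERIV_add DERIV_cmult shift G)
  have alg2: "flat_algebra \<phi>2" unfolding \<phi>2_def by (intro flat_algebra.add flat_algebra.mult flat_algebra.const alg)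
  have "(deriv ^^ k) \<phi>0 field_differentiable (at x)" for k x
  proof (rule iterated_deriv_differentiable[of _ "{\<phi>0, \<phi>1} \<union> Collect flat_algebra"])
    show "\<exists>g'\<in>{\<phi>0, \<phi>1} \<union> Collect flat_algebra. \<forall>x. (g has_real_derivative g' x) (at x)"
      if "g \<in> {\<phi>0, \<phi>1} \<union> Collect flat_algebra" for g
      using that d01 d12 alg2 flat_algebra_deriv[of g] by auto
  qed simp
  moreover have supp: "{x. \<phi>0 x \<noteq> 0} \<subseteq> {z - d - s..z + d + s}"
  proof
    fix x assume "x \<in> {x. \<phi>0 x \<noteq> 0}"
    moreover have "\<phi>0 x = 0" if "x < z - d - s"
      using that d by (simp add: \<phi>0_def H)
    moreover have "\<phi>0 x = 0" if "z + d + s < x"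
      using that d Hr[of "x - (z + d)"] Hr[of "x - z"] Hr[of "x - (z - d)"] by (simp add: \<phi>0_def algebra_simps)
    ultimately show "x \<in> {z - d - s..z + d + s}" by force
  qed
  then have "closure {x. \<phi>0 x \<noteq> 0} \<subseteq> {z - d - s..z + d + s}" by (rule closure_minimal) simp
  moreover have "bounded {x. \<phi>0 x \<noteq> 0}" using supp by (rule bounded_subset[OF bounded_closed_interval])
  ultimately have "test_function {a<..<b} \<phi>0"
    unfolding test_function_def compact_closure using s by fastforce
  moreover have "(deriv ^^ 2) \<phi>0 = \<phi>2"
  proof -
    have "deriv \<phi>0 = \<phi>1" "deriv \<phi>1 = \<phi>2" using d01 d12 by (auto intro: DERIV_imp_deriv)
    then show ?thesis by (simp add: numeral_2_eq_2)
  qed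
  ultimately have zero: "integral {a..b} (\<lambda>x. \<phi>2 x *\<^sub>R u x) = 0" using weak by metis
  define K where "K = (\<lambda>q. integral {a..b} (\<lambda>y. \<beta> (y - q) *\<^sub>R u y))"
  have Kint: "((\<lambda>y. \<beta> (y - q) *\<^sub>R u y) has_integral K q) {a..b}" for q
    unfolding K_def by (intro integrable_integral integrable_continuous_real continuous_intros \<beta>c cont)
  have "((\<lambda>y. \<beta> (y - (z + d)) *\<^sub>R u y + ((- 2) *\<^sub>R (\<beta> (y - z) *\<^sub>R u y) + \<beta> (y - (z - d)) *\<^sub>R u y))
      has_integral (K (z + d) + ((- 2) *\<^sub>R K z + K (z - d)))) {a..b}"
    by (intro has_integral_add has_integral_cmul Kint)
  then have "((\<lambda>x. \<phi>2 x *\<^sub>R u x) has_integral (K (z + d) + ((- 2) *\<^sub>R K z + K (z - d)))) {a..b}"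
    by (rule has_integral_eq[rotated]) (simp add: \<phi>2_def algebra_simps)
  then have K0: "K (z + d) + ((- 2) *\<^sub>R K z + K (z - d)) = 0"
    using zero by (metis integral_unique)
  \<comment> \<open>\<open>G s\<close> is the mass of the bump, so \<open>K q\<close> is
    \<open>G s\<close> times an average of \<open>u\<close> near \<open>q\<close>.\<close>
  have close: "norm (K q - G s *\<^sub>R u q) \<le> e * G s" if q: "z - d \<le> q" "q \<le> z + d" for q
  proof -
    have "((\<lambda>y. \<beta> (y - q)) has_integral (G (b - q) - G (a - q))) {a..b}"
      using d shift[OF G(1), of q]
      by (intro fundamental_theorem_of_calculus)
        (auto simp flip: has_real_derivative_iff_has_vector_derivative intro: has_field_derivative_at_within)
    then have I: "((\<lambda>y. \<beta> (y - q)) has_integral G s) {a..b}"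
      using Gr[of "b - q"] G(2)[of "a - q"] s q by simp
    have "((\<lambda>y. \<beta> (y - q) *\<^sub>R u y - \<beta> (y - q) *\<^sub>R u q) has_integral (K q - G s *\<^sub>R u q)) {a..b}"
      by (intro has_integral_diff Kint has_integral_scaleR_left I)
    moreover have "norm (\<beta> (y - q) *\<^sub>R u y - \<beta> (y - q) *\<^sub>R u q) \<le> \<beta> (y - q) * e" if y: "y \<in> {a..b}" for y
    proof (cases "\<bar>y - q\<bar> < s")
      case True
      have "dist (u y) (u q) < e" using True y q d s by (intro ur) (auto simp: dist_real_def)
      then have "\<beta> (y - q) * norm (u y - u q) \<le> \<beta> (y - q) * e"
        using \<beta>nn by (intro mult_left_mono) (auto simp: dist_norm)
      then show ?thesis using \<beta>nn by (simp flip: scaleR_diff_right)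
    qed (simp add: \<beta>0)
    ultimately have "norm (K q - G s *\<^sub>R u q) \<le> G s * e"
      using integral_norm_bound_integral[of "\<lambda>y. \<beta> (y - q) *\<^sub>R u y - \<beta> (y - q) *\<^sub>R u q" "{a..b}" "\<lambda>y. \<beta> (y - q) * e"]
        has_integral_mult_left[OF I, of e] e by (simp add: has_integral_iff)
    then show ?thesis by (simp add: mult.commute)
  qed
  let ?r = "\<lambda>q. K q - G s *\<^sub>R u q"
  have "G s *\<^sub>R ?w = (2 *\<^sub>R ?r z - ?r (z + d)) - ?r (z - d)"
    using K0 by (simp add: algebra_simps)
  also have "norm \<dots> \<le> 2 * norm (?r z) + norm (?r (z + d)) + norm (?r (z - d))"
    using norm_triangle_ineq4[of "2 *\<^sub>R ?r z - ?r (z + d)" "?r (z - d)"] norm_triangle_ineq4[of "2 *\<^sub>R ?r z" "?r (z + d)"]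
    by simp
  also have "\<dots> \<le> 4 * (e * G s)" using close[of z] close[of "z + d"] close[of "z - d"] d by simp
  finally have "G s * norm ?w \<le> G s * (4 * e)" using G0 by (simp add: mult_ac)
  then have "norm ?w \<le> 4 * e" using G0 by simp
  then show False using e by (simp add: e_def)
qed

section \<open>Weak derivatives of indefinite integrals\<close>

lemma absolutely_integrable_scaleR_continuous:
  fixes v :: "real \<Rightarrow> 'a::euclidean_space" and \<phi> :: "real \<Rightarrow> real"
  assumes "v absolutely_integrable_on {a..b}" "continuous_on {a..b} \<phi>"
  shows "(\<lambda>x. \<phi> x *\<^sub>R v x) absolutely_integrable_on {a..b}"
proof (rule absolutely_integrable_bounded_measurable_product[of "(*\<^sub>R)"])
  show "bilinear ((*\<^sub>R) :: real \<Rightarrow> 'a \<Rightarrow> 'a)"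
    by (simp add: bilinear_conv_bounded_bilinear bounded_bilinear_scaleR)
  show "\<phi> \<in> borel_measurable (lebesgue_on {a..b})"
    using assms by (intro continuous_imp_measurable_on_sets_lebesgue) auto
  show "bounded (\<phi> ` {a..b})"
    using assms by (intro compact_imp_bounded compact_continuous_image) auto
qed (use assms in auto)

text \<open>Integration by parts where \<open>V\<close> is only an indefinite integral: the defect is bounded on short
  intervals by a small multiple of an additive interval function.\<close>

lemma integration_by_parts_indefinite_integral:
  fixes V v :: "real \<Rightarrow> 'a::euclidean_space" and \<phi> \<phi>' :: "real \<Rightarrow> real"
  assumes ab: "a \<le> b" and v: "v absolutely_integrable_on {a..b}"
    and V: "\<And>x y. a \<le> x \<Longrightarrow> x \<le> y \<Longrightarrow> y \<le> b \<Longrightarrow> (v has_integral V y - V x) {x..y}"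
    and \<phi>: "\<And>x. x \<in> {a..b} \<Longrightarrow> (\<phi> has_real_derivative \<phi>' x) (at x within {a..b})"
    and \<phi>': "continuous_on {a..b} \<phi>'"
  shows "((\<lambda>x. \<phi> x *\<^sub>R v x + \<phi>' x *\<^sub>R V x) has_integral (\<phi> b *\<^sub>R V b - \<phi> a *\<^sub>R V a)) {a..b}"
proof -
  have vint: "v integrable_on {a..b}" using v by (rule set_lebesgue_integral_eq_integral(1))
  have c\<phi>: "continuous_on {a..b} \<phi>" using \<phi> by (rule DERIV_continuous_on)
  have cV: "continuous_on {a..b} V"
  proof -
    have "continuous_on {a..b} (\<lambda>x. V a + integral {a..x} v)"
      by (intro continuous_intros indefinite_integral_continuous_1 vint)
    moreover have "V a + integral {a..x} v = V x" if "x \<in> {a..b}" for x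
      using V[of a x] that by (simp add: integral_unique)
    ultimately show ?thesis by (rule continuous_on_eq)
  qed
  define w where "w = (\<lambda>x. \<phi> x *\<^sub>R v x + \<phi>' x *\<^sub>R V x)"
  have "w absolutely_integrable_on {a..b}" unfolding w_def
    by (intro set_integral_add absolutely_integrable_scaleR_continuous v c\<phi> absolutely_integrable_continuous_real
      continuous_intros \<phi>' cV)
  then have wint: "w integrable_on {a..b}" by (rule set_lebesgue_integral_eq_integral(1))
  define m where "m = (\<lambda>x. norm (v x) + \<bar>\<phi>' x\<bar>)"
  have "(\<lambda>x. norm (v x)) integrable_on {a..b}" using v by (simp add: absolutely_integrable_on_def)
  moreover have "(\<lambda>x. \<bar>\<phi>' x\<bar>) integrable_on {a..b}"
    by (intro integrable_continuous_real continuous_intros \<phi>')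
  ultimately have mint: "m integrable_on {a..b}" unfolding m_def by (rule integrable_add)
  \<comment> \<open>\<open>B\<close> measures the defect in the formula; the aim is that it takes
    the same value at both ends.\<close>
  define B where "B = (\<lambda>x. \<phi> x *\<^sub>R V x - integral {a..x} w)"
  define A where "A = (\<lambda>x. integral {a..x} m)"
  have small: "norm (B b - B a) \<le> e * (A b - A a)" if e: "0 < e" for e
  proof -
    have "uniformly_continuous_on {a..b} \<phi>" using c\<phi> by (rule compact_uniformly_continuous) simp
    then obtain d1 where d1: "0 < d1" "\<And>x y. x \<in> {a..b} \<Longrightarrow> y \<in> {a..b} \<Longrightarrow> dist y x < d1 \<Longrightarrow> dist (\<phi> y) (\<phi> x) < e"
      using uniformly_continuous_onE[OF _ e] by metis
    have "uniformly_continuous_on {a..b} V" using cV by (rule compact_uniformly_continuous) simp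
    then obtain d2 where d2: "0 < d2" "\<And>x y. x \<in> {a..b} \<Longrightarrow> y \<in> {a..b} \<Longrightarrow> dist y x < d2 \<Longrightarrow> dist (V y) (V x) < e"
      using uniformly_continuous_onE[OF _ e] by metis
    define d where "d = min d1 d2"
    have step: "norm (B y - B x) \<le> e * (A y - A x)" if xy: "a \<le> x" "x \<le> y" "y \<le> b" "y - x < d" for x y
    proof -
      have sub: "{x..y} \<subseteq> {a..b}" using xy by auto
      have \<phi>int: "(\<phi>' has_integral (\<phi> y - \<phi> x)) {x..y}"
        using \<phi> sub xy by (intro fundamental_theorem_of_calculus)
          (auto simp flip: has_real_derivative_iff_has_vector_derivative intro: DERIV_subset[OF _ sub])
      have mxy: "(m has_integral (A y - A x)) {x..y}"
      proof -
        have "integral {a..x} m + integral {x..y} m = integral {a..y} m"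
          using xy by (intro Henstock_Kurzweil_Integration.integral_combine integrable_on_subinterval[OF mint]) auto
        then show ?thesis using integrable_on_subinterval[OF mint sub] by (simp add: A_def has_integral_iff algebra_simps)
      qed
      have wxy: "(w has_integral (integral {a..y} w - integral {a..x} w)) {x..y}"
      proof -
        have "integral {a..x} w + integral {x..y} w = integral {a..y} w"
          using xy by (intro Henstock_Kurzweil_Integration.integral_combine integrable_on_subinterval[OF wint]) auto
        then show ?thesis using integrable_on_subinterval[OF wint sub] by (simp add: has_integral_iff algebra_simps)
      qed
      \<comment> \<open>Freezing \<open>\<phi>\<close> at the left end and \<open>V\<close> at the
        right end makes the integral exact; the remaining difference to \<open>w\<close> has
        coefficients that vary by less than \<open>e\<close>.\<close>
      have "((\<lambda>s. (\<phi> x *\<^sub>R v s + \<phi>' s *\<^sub>R V y) - w s) has_integral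
          (\<phi> x *\<^sub>R (V y - V x) + (\<phi> y - \<phi> x) *\<^sub>R V y) - (integral {a..y} w - integral {a..x} w)) {x..y}"
        using xy by (intro has_integral_diff has_integral_add has_integral_cmul has_integral_scaleR_left \<phi>int wxy V) auto
      moreover have "(\<phi> x *\<^sub>R (V y - V x) + (\<phi> y - \<phi> x) *\<^sub>R V y) - (integral {a..y} w - integral {a..x} w) = B y - B x"
        by (simp add: B_def algebra_simps)
      ultimately have "((\<lambda>s. (\<phi> x *\<^sub>R v s + \<phi>' s *\<^sub>R V y) - w s) has_integral (B y - B x)) {x..y}" by simp
      moreover have "norm ((\<phi> x *\<^sub>R v s + \<phi>' s *\<^sub>R V y) - w s) \<le> e * m s" if s: "s \<in> {x..y}" for s
      proof -
        have "(\<phi> x *\<^sub>R v s + \<phi>' s *\<^sub>R V y) - w s = (\<phi> x - \<phi> s) *\<^sub>R v s + \<phi>' s *\<^sub>R (V y - V s)"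
          by (simp add: w_def algebra_simps)
        also have "norm \<dots> \<le> \<bar>\<phi> x - \<phi> s\<bar> * norm (v s) + \<bar>\<phi>' s\<bar> * norm (V y - V s)"
          by (rule order_trans[OF norm_triangle_ineq]) simp
        also have "\<dots> \<le> e * norm (v s) + \<bar>\<phi>' s\<bar> * e"
          using d1(2)[of s x] d2(2)[of s y] s xy
          by (intro add_mono mult_mono) (auto simp: dist_norm d_def)
        finally show ?thesis by (simp add: m_def algebra_simps)
      qed
      ultimately show ?thesis
        using integral_norm_bound_integral[of "\<lambda>s. (\<phi> x *\<^sub>R v s + \<phi>' s *\<^sub>R V y) - w s" "{x..y}" "\<lambda>s. e * m s"]
          has_integral_mult_right[OF mxy, of e] by (auto simp: has_integral_iff)
    qed
    have d: "0 < d" using d1 d2 by (simp add: d_def)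
    obtain n :: nat where n: "(b - a) / d < real n" using reals_Archimedean2 by blast
    then have n0: "0 < n" using ab d by (cases n) (auto simp: divide_less_0_iff)
    define x where "x = (\<lambda>k::nat. a + real k * ((b - a) / real n))"
    have xb: "x k \<le> b" if "k \<le> n" for k
    proof -
      have "real k * ((b - a) / real n) \<le> real n * ((b - a) / real n)"
        using that ab by (intro mult_right_mono) auto
      then show ?thesis using n0 by (simp add: x_def)
    qed
    have xs: "x (Suc k) - x k = (b - a) / real n" for k by (simp add: x_def distrib_right del: times_divide_eq_right)
    have hn: "0 \<le> (b - a) / real n" using ab by simp
    then have xa: "a \<le> x k" for k unfolding x_def by (intro add_increasing2 mult_nonneg_nonneg) auto
    have "(b - a) / real n < d" using n n0 d by (simp add: field_simps)
    then have "norm (B (x (Suc k)) - B (x k)) \<le> e * (A (x (Suc k)) - A (x k))" if k: "k < n" for k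
    proof (intro step)
      show "x k \<le> x (Suc k)" using xs[of k] hn by linarith
      show "x (Suc k) \<le> b" using k by (intro xb) simp
    qed (use xa xs[of k] in auto)
    then have "(\<Sum>k<n. norm (B (x (Suc k)) - B (x k))) \<le> (\<Sum>k<n. e * (A (x (Suc k)) - A (x k)))"
      by (intro sum_mono) auto
    also have "\<dots> = e * (A (x n) - A (x 0))"
      unfolding sum_distrib_left[symmetric] sum_lessThan_telescope[of "\<lambda>k. A (x k)"] ..
    finally have "norm (\<Sum>k<n. B (x (Suc k)) - B (x k)) \<le> e * (A (x n) - A (x 0))"
      by (rule order_trans[OF norm_sum])
    then show ?thesis
      unfolding sum_lessThan_telescope[of "\<lambda>k. B (x k)"] using n0 by (simp add: x_def)
  qed
  have "B b = B a"
  proof (rule ccontr)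
    assume "B b \<noteq> B a"
    then have pos: "0 < norm (B b - B a)" by simp
    define q where "q = \<bar>A b - A a\<bar> + 1"
    have q: "0 < q" unfolding q_def by (intro add_nonneg_pos) auto
    define e where "e = norm (B b - B a) / (2 * q)"
    have e: "0 < e" unfolding e_def using pos q by simp
    have "norm (B b - B a) \<le> e * q"
      using e by (intro order_trans[OF small[OF e]] mult_left_mono) (auto simp: q_def)
    also have "\<dots> = norm (B b - B a) / 2" using q by (simp add: e_def)
    finally show False using pos by simp
  qed
  then show ?thesis using wint by (simp add: B_def has_integral_iff w_def[symmetric] algebra_simps)
qed

section \<open>Integration by parts against test functions\<close>

lemma test_function_DERIV:
  "test_function I \<phi> \<Longrightarrow> ((deriv ^^ k) \<phi> has_real_derivative (deriv ^^ Suc k) \<phi> x) (at x)"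
  unfolding test_function_def by (auto simp: field_differentiable_derivI)

lemma test_function_continuous:
  assumes "test_function I \<phi>"
  shows "continuous_on A ((deriv ^^ k) \<phi>)"
  using test_function_DERIV[OF assms] DERIV_isCont continuous_at_imp_continuous_on by blast

text \<open>The boundary terms vanish because the support of the test function, and with it that of
  its derivatives, avoids the end points.\<close>

lemma test_function_by_parts:
  fixes g G :: "real \<Rightarrow> 'a::euclidean_space"
  assumes ab: "a \<le> b" and \<phi>: "test_function {a<..<b} \<phi>"
    and G: "\<And>x y. a \<le> x \<Longrightarrow> x \<le> y \<Longrightarrow> y \<le> b \<Longrightarrow> (g has_integral G y - G x) {x..y}"
    and g: "g absolutely_integrable_on {a..b}" and cG: "continuous_on {a..b} G"
  shows "integral {a..b} (\<lambda>x. (deriv ^^ Suc k) \<phi> x *\<^sub>R G x) = - integral {a..b} (\<lambda>x. (deriv ^^ k) \<phi> x *\<^sub>R g x)"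
proof -
  have "a \<notin> closure {x. \<phi> x \<noteq> 0}" "b \<notin> closure {x. \<phi> x \<noteq> 0}" using \<phi> by (auto simp: test_function_def)
  then have z: "(deriv ^^ k) \<phi> a = 0" "(deriv ^^ k) \<phi> b = 0" by (auto intro: test_function_zero_outside)
  have "((\<lambda>x. (deriv ^^ k) \<phi> x *\<^sub>R g x + (deriv ^^ Suc k) \<phi> x *\<^sub>R G x) has_integral
      ((deriv ^^ k) \<phi> b *\<^sub>R G b - (deriv ^^ k) \<phi> a *\<^sub>R G a)) {a..b}"
    by (intro integration_by_parts_indefinite_integral ab g G test_function_continuous[OF \<phi>]
      has_field_derivative_at_within[OF test_function_DERIV[OF \<phi>]]) auto
  then have s: "integral {a..b} (\<lambda>x. (deriv ^^ k) \<phi> x *\<^sub>R g x + (deriv ^^ Suc k) \<phi> x *\<^sub>R G x) = 0"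
    using z by (simp add: integral_unique)
  have "(\<lambda>x. (deriv ^^ k) \<phi> x *\<^sub>R g x) integrable_on {a..b}"
    by (intro set_lebesgue_integral_eq_integral(1) absolutely_integrable_scaleR_continuous[OF g]
      test_function_continuous[OF \<phi>])
  moreover have "(\<lambda>x. (deriv ^^ Suc k) \<phi> x *\<^sub>R G x) integrable_on {a..b}"
    by (intro integrable_continuous_real continuous_on_scaleR test_function_continuous[OF \<phi>] cG)
  ultimately show ?thesis using s by (simp add: integral_add eq_neg_iff_add_eq_0 add.commute)
qed

lemma set_lebesgue_integral_eq_integral_Icc:
  fixes g :: "real \<Rightarrow> 'a::euclidean_space"
  assumes "g absolutely_integrable_on {a..b}" "\<And>x. x \<notin> {a..b} \<Longrightarrow> g x = 0" "{a..b} \<subseteq> S"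
  shows "(LINT x:S|lebesgue. g x) = integral {a..b} g"
proof -
  have "(LINT x:S|lebesgue. g x) = (LINT x:{a..b}|lebesgue. g x)"
    unfolding set_lebesgue_integral_def
    using assms(2,3) by (intro Bochner_Integration.integral_cong) (auto simp: indicator_def)
  then show ?thesis using set_lebesgue_integral_eq_integral(2)[OF assms(1)] by simp
qed

lemma weak_derivs_of_indefinite_integral:
  fixes c T v :: "real \<Rightarrow> 'a::euclidean_space"
  assumes L: "0 < L" and cT: "continuous_on {0..L} T" and v: "v absolutely_integrable_on {0..L}"
    and c: "\<And>z. z \<in> {0..L} \<Longrightarrow> (c has_vector_derivative T z) (at z within {0..L})"
    and T: "\<And>x y. 0 \<le> x \<Longrightarrow> x \<le> y \<Longrightarrow> y \<le> L \<Longrightarrow> (v has_integral T y - T x) {x..y}"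
  shows "has_weak_deriv 1 {0<..<L} c T" "has_weak_deriv 2 {0<..<L} c v"
proof -
  have cc: "continuous_on {0..L} c"
    by (rule continuous_on_vector_derivative) (rule c)
  have c': "(T has_integral c y - c x) {x..y}" if "0 \<le> x" "x \<le> y" "y \<le> L" for x y
    using that by (intro fundamental_theorem_of_calculus has_vector_derivative_within_subset[OF c]) auto
  have loc: "locally_integrable {0<..<L} g" if "g absolutely_integrable_on {0..L}" for g :: "real \<Rightarrow> 'a"
    unfolding locally_integrable_def
  proof (intro allI impI)
    fix K :: "real set" assume K: "compact K \<and> K \<subseteq> {0<..<L}"
    then have "K \<in> sets lebesgue" by (auto intro: fmeasurableD lmeasurable_compact)
    moreover have "K \<subseteq> {0..L}" using K by auto
    ultimately show "set_integrable lebesgue K g" using that by (intro set_integrable_subset[OF that])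
  qed
  have LI: "(LINT x:{0<..<L}|lebesgue. g x) = integral {0..L} g" if g: "g absolutely_integrable_on {0..L}" for g :: "real \<Rightarrow> 'a"
    using set_lebesgue_integral_eq_integral(2)[of "{0<..<L}" g] g
    by (simp add: integral_open_interval_real flip: absolutely_integrable_on_Icc_iff_Ioo)
  have aT: "T absolutely_integrable_on {0..L}" and ac: "c absolutely_integrable_on {0..L}"
    using cT cc by (auto intro: absolutely_integrable_continuous_real)
  show "has_weak_deriv 1 {0<..<L} c T"
    unfolding has_weak_deriv_def
  proof (intro conjI loc aT ac allI impI)
    fix \<phi> assume \<phi>: "test_function {0<..<L} \<phi>"
    have "integral {0..L} (\<lambda>x. (deriv ^^ Suc 0) \<phi> x *\<^sub>R c x) = - integral {0..L} (\<lambda>x. (deriv ^^ 0) \<phi> x *\<^sub>R T x)"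
      using L by (intro test_function_by_parts[OF _ \<phi> c' aT cc]) auto
    then show "(LINT x:{0<..<L}|lebesgue. (deriv ^^ 1) \<phi> x *\<^sub>R c x) = (- 1) ^ 1 *\<^sub>R (LINT x:{0<..<L}|lebesgue. \<phi> x *\<^sub>R T x)"
      using LI[OF absolutely_integrable_scaleR_continuous[OF ac test_function_continuous[OF \<phi>], of 1]]
        LI[OF absolutely_integrable_scaleR_continuous[OF aT test_function_continuous[OF \<phi>], of 0]] by simp
  qed
  show "has_weak_deriv 2 {0<..<L} c v"
    unfolding has_weak_deriv_def
  proof (intro conjI loc v ac allI impI)
    fix \<phi> assume \<phi>: "test_function {0<..<L} \<phi>"
    have "integral {0..L} (\<lambda>x. (deriv ^^ Suc 1) \<phi> x *\<^sub>R c x) = - integral {0..L} (\<lambda>x. (deriv ^^ 1) \<phi> x *\<^sub>R T x)"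
      using L by (intro test_function_by_parts[OF _ \<phi> c' aT cc]) auto
    moreover have "integral {0..L} (\<lambda>x. (deriv ^^ Suc 0) \<phi> x *\<^sub>R T x) = - integral {0..L} (\<lambda>x. (deriv ^^ 0) \<phi> x *\<^sub>R v x)"
      using L by (intro test_function_by_parts[OF _ \<phi> T v cT]) auto
    ultimately show "(LINT x:{0<..<L}|lebesgue. (deriv ^^ 2) \<phi> x *\<^sub>R c x) = (- 1) ^ 2 *\<^sub>R (LINT x:{0<..<L}|lebesgue. \<phi> x *\<^sub>R v x)"
      using LI[OF absolutely_integrable_scaleR_continuous[OF ac test_function_continuous[OF \<phi>], of 2]]
        LI[OF absolutely_integrable_scaleR_continuous[OF v test_function_continuous[OF \<phi>], of 0]]
      by (simp add: numeral_2_eq_2)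
  qed
qed

section \<open>Functions with a weak second derivative\<close>

text \<open>After subtracting the chord, look at the leftmost point where the norm is maximal.\<close>

lemma second_difference_0_imp_affine:
  fixes u :: "real \<Rightarrow> 'a::real_normed_vector"
  assumes cont: "continuous_on {a..b} u" and ab: "a < b"
    and sd: "\<And>z d. 0 < d \<Longrightarrow> a \<le> z - d \<Longrightarrow> z + d \<le> b \<Longrightarrow> u (z + d) - 2 *\<^sub>R u z + u (z - d) = 0"
    and x: "x \<in> {a..b}"
  shows "u x = u a + (x - a) *\<^sub>R ((1 / (b - a)) *\<^sub>R (u b - u a))"
proof -
  define B where "B = (1 / (b - a)) *\<^sub>R (u b - u a)"
  define l where "l = (\<lambda>x. u x - u a - (x - a) *\<^sub>R B)"
  have la: "l a = 0" and lb: "l b = 0" using ab by (auto simp: l_def B_def)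
  have cl: "continuous_on {a..b} l" unfolding l_def by (intro continuous_intros cont)
  have lsd: "l (z + d) + l (z - d) = 2 *\<^sub>R l z" if "0 < d" "a \<le> z - d" "z + d \<le> b" for z d
  proof -
    have "u (z + d) + u (z - d) - (u z + u z) = u (z + d) - 2 *\<^sub>R u z + u (z - d)"
      by (simp add: scaleR_2)
    also have "\<dots> = 0" by (rule sd[OF that])
    finally have "u (z + d) + u (z - d) - (u z + u z) = 0" .
    moreover have "l (z + d) + l (z - d) - (l z + l z) = u (z + d) + u (z - d) - (u z + u z)"
      by (simp add: l_def algebra_simps)
    ultimately show ?thesis by (simp add: scaleR_2)
  qed
  have cn: "continuous_on {a..b} (\<lambda>x. norm (l x))" using cl by (rule continuous_on_norm)
  have "{a..b} \<noteq> {}" using ab by simp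
  then obtain m where m: "m \<in> {a..b}" and max: "\<And>x. x \<in> {a..b} \<Longrightarrow> norm (l x) \<le> norm (l m)"
    using continuous_attains_sup[OF compact_Icc _ cn] by blast
  have "norm (l m) = 0"
  proof (rule ccontr)
    assume n0: "norm (l m) \<noteq> 0"
    define S where "S = {x \<in> {a..b}. norm (l x) = norm (l m)}"
    have "closed S" unfolding S_def
      by (intro continuous_closed_preimage_constant cn) simp
    moreover have "bounded S" unfolding S_def by (rule bounded_subset[OF bounded_closed_interval[of a b]]) auto
    ultimately have cS: "compact S" by (simp add: compact_eq_bounded_closed)
    have "S \<noteq> {}" using m by (auto simp: S_def)
    then obtain x0 where x0: "x0 \<in> S" "\<And>x. x \<in> S \<Longrightarrow> x0 \<le> x" using compact_attains_inf[OF cS] by blast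
    have "x0 \<noteq> a" "x0 \<noteq> b" using x0(1) la lb n0 by (auto simp: S_def)
    define d where "d = min (x0 - a) (b - x0)"
    have d: "0 < d" "a \<le> x0 - d" "x0 + d \<le> b"
      using x0(1) \<open>x0 \<noteq> a\<close> \<open>x0 \<noteq> b\<close> by (auto simp: S_def d_def)
    have "x0 - d \<notin> S" using x0(2)[of "x0 - d"] d by auto
    then have "norm (l (x0 - d)) < norm (l m)" using max[of "x0 - d"] d by (auto simp: S_def)
    moreover have "norm (l (x0 + d)) \<le> norm (l m)" using d by (intro max) auto
    moreover have "norm (2 *\<^sub>R l x0) \<le> norm (l (x0 + d)) + norm (l (x0 - d))"
      unfolding lsd[OF d, symmetric] by (rule norm_triangle_ineq)
    moreover have "norm (l x0) = norm (l m)" using x0(1) by (simp add: S_def)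
    ultimately show False by simp
  qed
  then have "l x = 0" using max[OF x] by simp
  then show ?thesis by (simp add: l_def B_def algebra_simps)
qed

lemma test_function_mono: "test_function I \<phi> \<Longrightarrow> I \<subseteq> J \<Longrightarrow> test_function J \<phi>"
  by (auto simp: test_function_def)

text \<open>Subtracting from \<open>c\<close> a double primitive of \<open>v\<close> leaves a
  continuous function with vanishing weak second derivative, which is affine. The slightly larger
  interval \<open>{p..q}\<close> leaves room for the bumps. Local integrability controls
  \<open>v\<close> only on compact parts of the open interval, so 0 and \<open>L\<close> stay out of
  reach here.\<close>

lemma weak_second_deriv_classical:
  fixes c v :: "real \<Rightarrow> 'a::euclidean_space"
  assumes wd: "has_weak_deriv 2 {0<..<L} c v" and cc: "continuous_on {0..L} c"
    and ab: "0 < a" "a < b" "b < L"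
  obtains T where "\<And>x. x \<in> {a..b} \<Longrightarrow> (c has_vector_derivative T x) (at x within {a..b})"
    "\<And>x y. a \<le> x \<Longrightarrow> x \<le> y \<Longrightarrow> y \<le> b \<Longrightarrow> (v has_integral T y - T x) {x..y}"
    "v absolutely_integrable_on {a..b}"
proof -
  define p where "p = a / 2"
  define q where "q = (b + L) / 2"
  have pq: "0 < p" "p < a" "b < q" "q < L" using ab by (auto simp: p_def q_def)
  have v: "v absolutely_integrable_on {p..q}"
  proof -
    have "locally_integrable {0<..<L} v" using wd by (simp add: has_weak_deriv_def)
    then show ?thesis using pq unfolding locally_integrable_def by (auto dest!: spec[of _ "{p..q}"])
  qed
  have vint: "v integrable_on {p..q}" using v by (rule set_lebesgue_integral_eq_integral(1))
  have cpq: "continuous_on {p..q} c" using pq by (intro continuous_on_subset[OF cc]) auto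
  define V where "V = (\<lambda>x. integral {p..x} v)"
  define W where "W = (\<lambda>x. integral {p..x} V)"
  have cV: "continuous_on {p..q} V" unfolding V_def by (rule indefinite_integral_continuous_1[OF vint])
  have dW: "(W has_vector_derivative V x) (at x within {p..q})" if "x \<in> {p..q}" for x
    unfolding W_def by (rule integral_has_vector_derivative[OF cV that])
  have cW: "continuous_on {p..q} W"
    by (rule continuous_on_vector_derivative) (rule dW)
  have Vi: "(v has_integral V y - V x) {x..y}" if "p \<le> x" "x \<le> y" "y \<le> q" for x y
  proof -
    have "integral {p..x} v + integral {x..y} v = integral {p..y} v"
      using that by (intro Henstock_Kurzweil_Integration.integral_combine integrable_on_subinterval[OF vint]) auto
    moreover have "v integrable_on {x..y}" using that by (intro integrable_on_subinterval[OF vint]) auto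
    ultimately show ?thesis by (simp add: V_def has_integral_iff algebra_simps)
  qed
  have Wi: "(V has_integral W y - W x) {x..y}" if "p \<le> x" "x \<le> y" "y \<le> q" for x y
    using that by (intro fundamental_theorem_of_calculus has_vector_derivative_within_subset[OF dW]) auto
  define u where "u = (\<lambda>x. c x - W x)"
  have cu: "continuous_on {p..q} u" unfolding u_def by (intro continuous_intros cpq cW)
  have weak: "integral {p..q} (\<lambda>x. (deriv ^^ 2) \<phi> x *\<^sub>R u x) = 0" if \<phi>: "test_function {p<..<q} \<phi>" for \<phi>
  proof -
    have out: "(deriv ^^ k) \<phi> x = 0" if "x \<notin> {p..q}" for k x
      using \<phi> that by (intro test_function_zero_outside) (auto simp: test_function_def)
    note cont = test_function_continuous[OF \<phi>]
    have ac: "(\<lambda>x. (deriv ^^ 2) \<phi> x *\<^sub>R c x) absolutely_integrable_on {p..q}"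
      and aW: "(\<lambda>x. (deriv ^^ 2) \<phi> x *\<^sub>R W x) absolutely_integrable_on {p..q}"
      by (intro absolutely_integrable_continuous_real continuous_on_scaleR cont cpq cW)+
    have av: "(\<lambda>x. \<phi> x *\<^sub>R v x) absolutely_integrable_on {p..q}"
      using absolutely_integrable_scaleR_continuous[OF v cont[of _ 0]] by simp
    have "(LINT x:{0<..<L}|lebesgue. (deriv ^^ 2) \<phi> x *\<^sub>R c x) = (LINT x:{0<..<L}|lebesgue. \<phi> x *\<^sub>R v x)"
    proof -
      have "{p<..<q} \<subseteq> {0<..<L}" using pq by (auto simp: greaterThanLessThan_def)
      then have "test_function {0<..<L} \<phi>" by (rule test_function_mono[OF \<phi>])
      then show ?thesis using wd by (auto simp: has_weak_deriv_def)
    qed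
    moreover have "(LINT x:{0<..<L}|lebesgue. (deriv ^^ 2) \<phi> x *\<^sub>R c x) = integral {p..q} (\<lambda>x. (deriv ^^ 2) \<phi> x *\<^sub>R c x)"
      using pq out by (intro set_lebesgue_integral_eq_integral_Icc ac) auto
    moreover have "(LINT x:{0<..<L}|lebesgue. \<phi> x *\<^sub>R v x) = integral {p..q} (\<lambda>x. \<phi> x *\<^sub>R v x)"
      using pq out[of _ 0] by (intro set_lebesgue_integral_eq_integral_Icc av) auto
    moreover have "integral {p..q} (\<lambda>x. (deriv ^^ Suc 1) \<phi> x *\<^sub>R W x) = - integral {p..q} (\<lambda>x. (deriv ^^ 1) \<phi> x *\<^sub>R V x)"
      using pq ab by (intro test_function_by_parts[OF _ \<phi> Wi] absolutely_integrable_continuous_real cV cW) auto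
    moreover have "integral {p..q} (\<lambda>x. (deriv ^^ Suc 0) \<phi> x *\<^sub>R V x) = - integral {p..q} (\<lambda>x. (deriv ^^ 0) \<phi> x *\<^sub>R v x)"
      using pq ab by (intro test_function_by_parts[OF _ \<phi> Vi] v cV) auto
    ultimately have "integral {p..q} (\<lambda>x. (deriv ^^ 2) \<phi> x *\<^sub>R c x) = integral {p..q} (\<lambda>x. (deriv ^^ 2) \<phi> x *\<^sub>R W x)"
      by (simp add: numeral_2_eq_2)
    then show ?thesis unfolding u_def scaleR_right_diff_distrib
      using ac aW by (subst integral_diff) (auto dest: set_lebesgue_integral_eq_integral(1))
  qed
  have sd: "u (z + d) - 2 *\<^sub>R u z + u (z - d) = 0" if "0 < d" "a \<le> z - d" "z + d \<le> b" for z d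
    using weak_second_deriv_0_imp_second_difference_0[OF cu weak, of d z] that pq by simp
  have cab: "continuous_on {a..b} u" using pq by (intro continuous_on_subset[OF cu]) auto
  define B where "B = (1 / (b - a)) *\<^sub>R (u b - u a)"
  have B: "u x = u a + (x - a) *\<^sub>R B" if "x \<in> {a..b}" for x
    unfolding B_def using cab ab(2) sd that by (rule second_difference_0_imp_affine)
  show ?thesis
  proof (rule that[of "\<lambda>x. V x + B"])
    fix x assume x: "x \<in> {a..b}"
    have "((\<lambda>x. W x + (u a + (x - a) *\<^sub>R B)) has_vector_derivative (V x + (0 + B))) (at x within {a..b})"
      using x pq by (intro has_vector_derivative_add has_vector_derivative_within_subset[OF dW])
        (auto intro!: derivative_eq_intros)
    then have "((\<lambda>x. W x + (u a + (x - a) *\<^sub>R B)) has_vector_derivative (V x + B)) (at x within {a..b})" by simp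
    then show "(c has_vector_derivative V x + B) (at x within {a..b})"
    proof (rule has_vector_derivative_transform[OF x, rotated])
      show "c y = W y + (u a + (y - a) *\<^sub>R B)" if "y \<in> {a..b}" for y
        using B[OF that] by (simp add: u_def algebra_simps)
    qed
  next
    show "v absolutely_integrable_on {a..b}" using pq by (intro set_integrable_subset[OF v]) auto
  qed (use Vi pq in auto)
qed

text \<open>Lebesgue differentiation: almost everywhere the value is the limit of the means over
  \<open>{x..x + h}\<close>, all of which vanish.\<close>

lemma zero_integrals_imp_AE_zero:
  fixes w :: "real \<Rightarrow> 'a::euclidean_space"
  assumes w: "w absolutely_integrable_on {a..b}" and z: "\<And>x y. a \<le> x \<Longrightarrow> x \<le> y \<Longrightarrow> y \<le> b \<Longrightarrow> integral {x..y} w = 0"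
  shows "AE x in lebesgue. x \<in> {a<..<b} \<longrightarrow> w x = 0"
proof -
  define f where "f = (\<lambda>x. if x \<in> {a..b} then w x else 0)"
  have fU: "f integrable_on UNIV"
    unfolding f_def using set_lebesgue_integral_eq_integral(1)[OF w]
    by (subst integrable_restrict_UNIV) simp
  have wf: "f absolutely_integrable_on UNIV"
    using w unfolding f_def by (subst absolutely_integrable_restrict_UNIV) simp
  have "f integrable_on cbox x y" for x y
    using integrable_on_subcbox[OF fU] by simp
  then obtain N where N: "negligible N" and lim: "\<And>x e. \<lbrakk>x \<notin> N; 0 < e\<rbrakk> \<Longrightarrow>
      \<exists>d>0. \<forall>h. 0 < h \<and> h < d \<longrightarrow> norm (integral (cbox x (x + h *\<^sub>R One)) f /\<^sub>R h ^ DIM(real) - f x) < e"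
    by (rule integrable_ccontinuous_explicit) blast
  have "w x = 0" if x: "x \<in> {a<..<b}" "x \<notin> N" for x
  proof (rule ccontr)
    assume "w x \<noteq> 0"
    then obtain d where d: "0 < d" "\<And>h. 0 < h \<Longrightarrow> h < d \<Longrightarrow>
        norm (integral (cbox x (x + h *\<^sub>R One)) f /\<^sub>R h ^ DIM(real) - f x) < norm (w x)"
      using lim[OF x(2), of "norm (w x)"] by auto
    define h where "h = min (d / 2) (b - x)"
    have h: "0 < h" "h < d" "x + h \<le> b" using d x by (auto simp: h_def)
    have "integral {x..x + h} f = integral {x..x + h} w"
      using h x by (intro integral_cong) (auto simp: f_def)
    also have "\<dots> = 0" using h x by (intro z) auto
    finally show False using d(2)[OF h(1,2)] x by (simp add: f_def)
  qed
  then show ?thesis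
    using N by (intro AE_I'[of N]) (auto simp: negligible_iff_null_sets)
qed

text \<open>On compact subintervals both densities integrate to the increments of the same classical
  derivative of \<open>c\<close>. The lemma makes the choice inside \<open>weak_deriv\<close>
  immaterial for the energy integral.\<close>

lemma weak_second_deriv_unique:
  fixes c v v' :: "real \<Rightarrow> 'a::euclidean_space"
  assumes v: "has_weak_deriv 2 {0<..<L} c v" and v': "has_weak_deriv 2 {0<..<L} c v'" and cc: "continuous_on {0..L} c"
  shows "AE x in lebesgue. x \<in> {0<..<L} \<longrightarrow> v x = v' x"
proof (cases "0 < L")
  case L: True
  have sub: "AE x in lebesgue. x \<in> {a<..<b} \<longrightarrow> v x = v' x" if ab: "0 < a" "a < b" "b < L" for a b
  proof -
    obtain T where T: "\<And>x. x \<in> {a..b} \<Longrightarrow> (c has_vector_derivative T x) (at x within {a..b})"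
      "\<And>x y. a \<le> x \<Longrightarrow> x \<le> y \<Longrightarrow> y \<le> b \<Longrightarrow> (v has_integral T y - T x) {x..y}" "v absolutely_integrable_on {a..b}"
      using weak_second_deriv_classical[OF v cc ab] by blast
    obtain T' where T': "\<And>x. x \<in> {a..b} \<Longrightarrow> (c has_vector_derivative T' x) (at x within {a..b})"
      "\<And>x y. a \<le> x \<Longrightarrow> x \<le> y \<Longrightarrow> y \<le> b \<Longrightarrow> (v' has_integral T' y - T' x) {x..y}" "v' absolutely_integrable_on {a..b}"
      using weak_second_deriv_classical[OF v' cc ab] by blast
    have "T x = T' x" if "x \<in> {a..b}" for x
      using vector_derivative_within_closed_interval[OF ab(2) that T(1)[OF that]]
        vector_derivative_within_closed_interval[OF ab(2) that T'(1)[OF that]] by simp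
    then have "integral {x..y} (\<lambda>s. v s - v' s) = 0" if "a \<le> x" "x \<le> y" "y \<le> b" for x y
      using has_integral_diff[OF T(2)[OF that] T'(2)[OF that]] that by (simp add: integral_unique)
    then have "AE x in lebesgue. x \<in> {a<..<b} \<longrightarrow> v x - v' x = 0"
      using set_integral_diff(1)[OF T(3) T'(3)] by (intro zero_integrals_imp_AE_zero) auto
    then show ?thesis by simp
  qed
  \<comment> \<open>Countably many intervals exhaust the open one; the 3 keeps each of them
    nonempty.\<close>
  have "AE x in lebesgue. \<forall>n::nat. x \<in> {L / (real n + 3)<..<L - L / (real n + 3)} \<longrightarrow> v x = v' x"
  proof (subst AE_all_countable, rule allI)
    fix n :: nat
    show "AE x in lebesgue. x \<in> {L / (real n + 3)<..<L - L / (real n + 3)} \<longrightarrow> v x = v' x"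
    proof (rule sub)
      have "L / (real n + 3) \<le> L / 3" using L by (intro frac_le) simp_all
      moreover show "0 < L / (real n + 3)" using L by simp
      ultimately show "L / (real n + 3) < L - L / (real n + 3)" "L - L / (real n + 3) < L"
        using L by linarith+
    qed
  qed
  then show ?thesis
  proof eventually_elim
    case (elim x)
    show ?case
    proof
      assume x: "x \<in> {0<..<L}"
      define m where "m = min x (L - x)"
      have m: "0 < m" using x by (simp add: m_def)
      obtain n :: nat where "L / m < real n" using reals_Archimedean2 by blast
      then have "L / m < real n + 3" by simp
      then have "L / (real n + 3) < m" using m by (simp add: divide_less_eq mult.commute)
      then have "L / (real n + 3) < x" "L / (real n + 3) < L - x" by (auto simp: m_def)
      then show "v x = v' x" using elim[rule_format, of n] by auto
    qed
  qed
qed simp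

section \<open>Corners and second differences\<close>

lemma le_tan:
  fixes x :: real
  assumes "0 \<le> x" "x < pi / 2"
  shows "x \<le> tan x"
proof (cases "x = 0")
  case False
  then have "0 < tan x" using assms by (intro tan_gt_zero) auto
  moreover have "arctan (tan x) = x" using assms by (intro arctan_tan) auto
  ultimately show ?thesis using arctan_le_self[of "tan x"] by simp
qed simp

text \<open>For the unit vectors \<open>?u\<close> and \<open>?v\<close>,
  \<open>norm a * norm b * norm (?v - ?u) ^ 2\<close> equals
  \<open>2 * (norm a * norm b - inner a b)\<close>, which falls short of
  \<open>norm (b - a) ^ 2\<close> by the square of \<open>norm a - norm b\<close>.\<close>

lemma normalized_diff_le:
  fixes a b :: "'a::real_inner"
  assumes m: "0 < m" "m \<le> norm a" "m \<le> norm b"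
  shows "norm ((1 / norm b) *\<^sub>R b - (1 / norm a) *\<^sub>R a) \<le> norm (b - a) / m"
proof -
  let ?u = "(1 / norm a) *\<^sub>R a" and ?v = "(1 / norm b) *\<^sub>R b"
  have n: "0 < norm a" "0 < norm b" using m by linarith+
  have unit: "(norm (v - u))\<^sup>2 = 2 - 2 * (u \<bullet> v)" if "norm u = 1" "norm v = 1" for u v :: 'a
    unfolding power2_norm_eq_inner using that
    by (simp add: inner_diff_left inner_diff_right inner_commute norm_eq_1)
  have uv: "(norm (?v - ?u))\<^sup>2 = 2 - 2 * ((a \<bullet> b) / (norm a * norm b))"
    using n by (subst unit) auto
  have "m\<^sup>2 * (norm (?v - ?u))\<^sup>2 \<le> (norm a * norm b) * (norm (?v - ?u))\<^sup>2"
    unfolding power2_eq_square[of m] using m by (intro mult_right_mono mult_mono) auto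
  also have "\<dots> = 2 * (norm a * norm b) - 2 * (a \<bullet> b)"
    unfolding uv using n by (simp add: right_diff_distrib)
  also have "\<dots> \<le> (norm (b - a))\<^sup>2"
  proof -
    have "(norm (b - a))\<^sup>2 = (norm b)\<^sup>2 - 2 * (a \<bullet> b) + (norm a)\<^sup>2"
      unfolding power2_norm_eq_inner by (simp add: inner_diff_left inner_diff_right inner_commute)
    moreover have "0 \<le> (norm a - norm b)\<^sup>2" by simp
    ultimately show ?thesis by (simp add: power2_diff)
  qed
  finally have "(m * norm (?v - ?u))\<^sup>2 \<le> (norm (b - a))\<^sup>2" by (simp add: power_mult_distrib)
  then have "m * norm (?v - ?u) \<le> norm (b - a)" by (rule power2_le_imp_le) simp
  then show ?thesis using m by (simp add: pos_le_divide_eq mult.commute)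
qed

text \<open>Let \<open>q\<close> be the norm of the second difference. For \<open>r\<close> near 1
  the bound is close to \<open>q powr p * d powr (1 - 2 * p)\<close>, the energy of an arc of length
  \<open>d\<close> and curvature \<open>q / d ^ 2\<close>. The power of \<open>r\<close> collects
  three losses: sides known only to be at least \<open>r * d\<close>, \<open>cos (t / 2)\<close>
  known only to be at least \<open>r\<close>, and a tangent length \<open>r ^ 2 * d / 2\<close> kept
  strictly below the half-sides.\<close>

lemma corner_energy_le_diff:
  fixes x y z :: "'a::euclidean_space"
  assumes p: "p > 1" and r: "0 < r" "r < 1" and d: "0 < d"
    and long: "r * d \<le> norm (y - x)" "r * d \<le> norm (z - y)"
    and small: "norm ((z - y) - (y - x)) \<le> 2 * sqrt (1 - r\<^sup>2) * (r * d)"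
  shows "corner_energy p x y z \<le>
    ennreal (norm ((z - y) - (y - x)) powr p * d powr (1 - 2 * p) * r powr (2 - 4 * p))"
proof -
  define t where "t = turning_angle x y z"
  define q where "q = norm ((z - y) - (y - x))"
  define Q where "Q = norm ((1 / norm (z - y)) *\<^sub>R (z - y) - (1 / norm (y - x)) *\<^sub>R (y - x))"
  have rd: "0 < r * d" using r d by simp
  have ne: "x \<noteq> y" "y \<noteq> z" using long rd by auto
  have Qq: "Q \<le> q / (r * d)" unfolding Q_def q_def by (rule normalized_diff_le[OF rd long])
  have Qt: "Q = 2 * sin (t / 2)" unfolding Q_def t_def by (rule norm_diff_le_turning_angle(1)[OF ne])
  have tb: "0 \<le> t" "t \<le> pi" using turning_angle_bounds by (auto simp: t_def)
  \<comment> \<open>The bound on the second difference is tuned to give \<open>sin (t / 2)\<close>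
    at most the square root of \<open>1 - r ^ 2\<close>, hence \<open>cos (t / 2)\<close> at least
    \<open>r\<close>.\<close>
  have "q / (r * d) \<le> 2 * sqrt (1 - r\<^sup>2)" using small rd by (simp add: q_def pos_divide_le_eq)
  then have "sin (t / 2) \<le> sqrt (1 - r\<^sup>2)" using Qq Qt by linarith
  moreover have s0: "0 \<le> sin (t / 2)" using tb by (intro sin_ge_zero) auto
  moreover have "r\<^sup>2 \<le> 1" using r by (simp add: power_le_one)
  ultimately have "(sin (t / 2))\<^sup>2 \<le> 1 - r\<^sup>2"
    by (metis diff_ge_0_iff_ge power_mono real_sqrt_pow2)
  then have "r\<^sup>2 \<le> (cos (t / 2))\<^sup>2" by (simp add: cos_squared_eq)
  moreover have "0 \<le> cos (t / 2)" using tb by (intro cos_ge_zero) auto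
  ultimately have c: "r \<le> cos (t / 2)" by (rule power2_le_imp_le)
  then have "t / 2 \<noteq> pi / 2" using r by (metis cos_pi_half not_le)
  then have tpi: "t < pi" using tb by simp
  have tan: "2 * tan (t / 2) \<le> Q / r"
  proof -
    have "tan (t / 2) \<le> sin (t / 2) / r" unfolding tan_def using c r s0 by (intro divide_left_mono) auto
    then show ?thesis using Qt by simp
  qed
  have tt: "t \<le> 2 * tan (t / 2)" using le_tan[of "t / 2"] tb tpi by simp
  define D where "D = q / (r * d)"
  have D0: "0 \<le> D" using rd by (simp add: D_def q_def)
  have QD: "Q / r \<le> D / r" unfolding D_def using Qq r by (intro divide_right_mono) auto
  have hd: "0 < r\<^sup>2 * d / 2" using r d by simp
  have "r\<^sup>2 * d < r * d" using r d by (simp add: power2_eq_square)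
  then have "corner_energy p x y z \<le> ennreal (t * (tan (t / 2) / (r\<^sup>2 * d / 2)) powr (p - 1))"
    unfolding t_def using hd long tpi by (intro corner_energy_le[OF p]) (auto simp: t_def)
  also have "\<dots> \<le> ennreal ((D / r) * ((D / r) / (r\<^sup>2 * d)) powr (p - 1))"
  proof (intro ennreal_leI mult_mono powr_mono2)
    show "t \<le> D / r" using tt tan QD by linarith
    have "tan (t / 2) / (r\<^sup>2 * d / 2) = 2 * tan (t / 2) / (r\<^sup>2 * d)" by simp
    also have "\<dots> \<le> (D / r) / (r\<^sup>2 * d)" using tan QD r d by (intro divide_right_mono) auto
    finally show "tan (t / 2) / (r\<^sup>2 * d / 2) \<le> (D / r) / (r\<^sup>2 * d)" .
    show "0 \<le> tan (t / 2) / (r\<^sup>2 * d / 2)" using tt tb r d by (intro divide_nonneg_pos) auto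
  qed (use D0 r p in auto)
  also have "(D / r) * ((D / r) / (r\<^sup>2 * d)) powr (p - 1) = q powr p * d powr (1 - 2 * p) * r powr (2 - 4 * p)"
  proof (cases "q = 0")
    case False
    then have q: "0 < q" by (simp add: q_def)
    have rp: "r ^ k = r powr real k" for k using r by (simp add: powr_realpow)
    have dr: "D / r = q * d powr (-1) * r powr (-2)"
      unfolding D_def using r d by (simp add: powr_minus_divide powr_numeral power2_eq_square)
    have "(D / r) / (r\<^sup>2 * d) = q * d powr (-2) * r powr (-4)"
      unfolding D_def using r d by (simp add: powr_minus_divide powr_numeral power2_eq_square power4_eq_xxxx)
    then have "((D / r) / (r\<^sup>2 * d)) powr (p - 1) = q powr (p - 1) * d powr (-2 * (p - 1)) * r powr (-4 * (p - 1))"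
      using q r d by (simp add: powr_mult powr_powr)
    then have "(D / r) * ((D / r) / (r\<^sup>2 * d)) powr (p - 1)
        = (q * q powr (p - 1)) * (d powr (-1) * d powr (-2 * (p - 1))) * (r powr (-2) * r powr (-4 * (p - 1)))"
      unfolding dr by (simp only: ac_simps)
    also have "q * q powr (p - 1) = q powr p" using q powr_mult_base[of q "p - 1"] by simp
    also have "d powr (-1) * d powr (-2 * (p - 1)) = d powr (1 - 2 * p)"
      by (simp only: powr_add[symmetric]) (simp add: algebra_simps)
    also have "r powr (-2) * r powr (-4 * (p - 1)) = r powr (2 - 4 * p)"
      by (simp only: powr_add[symmetric]) (simp add: algebra_simps)
    finally show ?thesis .
  qed (simp add: D_def)
  finally show ?thesis by (simp add: q_def)
qed

text \<open>The second difference of \<open>c\<close> is an average over \<open>s\<close> of increments of \<open>T\<close> over adjacent intervals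
  of length \<open>d\<close>, so two applications of Jensen's inequality suffice.\<close>

lemma sum_second_differences_le:
  fixes c T v :: "real \<Rightarrow> 'a::euclidean_space"
  assumes p: "p > 1" and n: "0 < n" and L: "L = real n * d" and d: "0 < d"
    and cT: "continuous_on {0..L} T"
    and c: "\<And>x y. 0 \<le> x \<Longrightarrow> x \<le> y \<Longrightarrow> y \<le> L \<Longrightarrow> (T has_integral c y - c x) {x..y}"
    and T: "\<And>x y. 0 \<le> x \<Longrightarrow> x \<le> y \<Longrightarrow> y \<le> L \<Longrightarrow> (v has_integral T y - T x) {x..y}"
    and v: "(\<lambda>s. norm (v s) powr p) integrable_on {0..L}"
  defines "t \<equiv> \<lambda>i. real i * d"
  shows "(\<Sum>i<n - 1. norm ((c (t (i + 2)) - c (t (i + 1))) - (c (t (i + 1)) - c (t i))) powr p)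
    \<le> d powr (2 * p - 1) * integral {0..L} (\<lambda>s. norm (v s) powr p)"
proof -
  let ?E = "integral {0..L} (\<lambda>s. norm (v s) powr p)"
  define W where "W = (\<lambda>i s. T (s + t (i + 1)) - T (s + t i))"
  have tS: "t (i + 1) = t i + d" "t (i + 2) = t i + 2 * d" "t (Suc i) = t i + d" "t (Suc (Suc i)) = t i + 2 * d" for i
    by (simp_all add: t_def algebra_simps)
  have t0: "0 \<le> t i" for i using d by (simp add: t_def)
  have tL: "t i \<le> L" if "i \<le> n" for i unfolding t_def L using that d by (intro mult_right_mono) auto
  have tL2: "t i + 2 * d \<le> L" if "i < n - 1" for i using tL[of "i + 2"] tS(2)[of i] that by simp
  have vsub: "(\<lambda>s. norm (v s) powr p) integrable_on {x..y}" if "0 \<le> x" "y \<le> L" for x y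
    using that by (intro integrable_on_subinterval[OF v]) auto
  have cW: "continuous_on {0..d} (W i)" if i: "i < n - 1" for i
    unfolding W_def using tL2[OF i] t0[of i]
    by (intro continuous_intros continuous_on_compose2[OF cT]) (auto simp: tS)
  have Wp: "(\<lambda>s. norm (W i s) powr p) integrable_on {0..d}" if i: "i < n - 1" for i
    using p by (intro integrable_continuous_real continuous_on_powr' continuous_on_norm cW[OF i] continuous_on_const) auto
  have diff: "norm ((c (t (i + 2)) - c (t (i + 1))) - (c (t (i + 1)) - c (t i))) powr p
      \<le> integral {0..d} (\<lambda>s. norm (W i s) powr p) * d powr (p - 1)" if i: "i < n - 1" for i
  proof -
    have A: "(T has_integral c (t (i + 2)) - c (t (i + 1))) {t (i + 1)..t (i + 2)}"
      and B: "(T has_integral c (t (i + 1)) - c (t i)) {t i..t (i + 1)}"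
      using tL2[OF i] t0[of i] d by (intro c; simp add: tS)+
    have "((\<lambda>s. T (s + t (i + 1))) has_integral c (t (i + 2)) - c (t (i + 1))) {0..d}"
      using has_integral_shift_real_ivl[OF A, of "t (i + 1)"] by (simp add: tS)
    moreover have "((\<lambda>s. T (s + t i)) has_integral c (t (i + 1)) - c (t i)) {0..d}"
      using has_integral_shift_real_ivl[OF B, of "t i"] by (simp add: tS)
    ultimately have "(W i has_integral (c (t (i + 2)) - c (t (i + 1))) - (c (t (i + 1)) - c (t i))) {0..d}"
      unfolding W_def by (rule has_integral_diff)
    from norm_integral_powr_le[OF p _ this Wp[OF i]] d show ?thesis by simp
  qed
  \<comment> \<open>For fixed \<open>s\<close> the intervals \<open>{s + t i..s + t (i + 1)}\<close>
    are adjacent, so the energies of \<open>v\<close> on them add up to at most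
    \<open>?E\<close>.\<close>
  have pointwise: "(\<Sum>i<n - 1. norm (W i s) powr p) \<le> d powr (p - 1) * ?E" if s: "s \<in> {0..d}" for s
  proof -
    have "norm (W i s) powr p \<le> integral {s + t i..s + t (i + 1)} (\<lambda>s. norm (v s) powr p) * d powr (p - 1)"
      if i: "i < n - 1" for i
    proof -
      have "(v has_integral W i s) {s + t i..s + t (i + 1)}"
        unfolding W_def using s tL2[OF i] t0[of i] d by (intro T) (auto simp: tS)
      from norm_integral_powr_le[OF p _ this vsub] show ?thesis
        using s tL2[OF i] t0[of i] d by (simp add: tS)
    qed
    then have "(\<Sum>i<n - 1. norm (W i s) powr p)
        \<le> (\<Sum>i<n - 1. integral {s + t i..s + t (i + 1)} (\<lambda>s. norm (v s) powr p) * d powr (p - 1))"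
      by (intro sum_mono) auto
    also have "\<dots> = (\<Sum>i<n - 1. integral {s + t i..s + t (i + 1)} (\<lambda>s. norm (v s) powr p)) * d powr (p - 1)"
      by (simp add: sum_distrib_right)
    also have "(\<Sum>i<n - 1. integral {s + t i..s + t (i + 1)} (\<lambda>s. norm (v s) powr p)) \<le> ?E"
    proof -
      have "((\<lambda>s. norm (v s) powr p) has_integral (\<Sum>i<n - 1. integral {s + t i..s + t (i + 1)} (\<lambda>s. norm (v s) powr p)))
          {s..s + real (n - 1) * d}"
      proof (rule has_integral_uniform_pieces)
        fix i assume i: "i < n - 1"
        show "((\<lambda>s. norm (v s) powr p) has_integral integral {s + t i..s + t (i + 1)} (\<lambda>s. norm (v s) powr p))
          {s + real i * d..s + real (Suc i) * d}"
          using vsub[of "s + t i" "s + t (i + 1)"] s tL2[OF i] t0[of i] d tS(1)[of i]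
          by (simp add: has_integral_iff t_def)
      qed (use d in simp)
      then have "(\<Sum>i<n - 1. integral {s + t i..s + t (i + 1)} (\<lambda>s. norm (v s) powr p))
          = integral {s..s + real (n - 1) * d} (\<lambda>s. norm (v s) powr p)" by (simp add: integral_unique)
      also have "\<dots> \<le> ?E"
      proof -
        have "s + real (n - 1) * d \<le> L" using s n unfolding L by (simp add: of_nat_diff algebra_simps)
        then show ?thesis using s by (intro integral_subset_le vsub v) auto
      qed
      finally show ?thesis .
    qed
    finally show ?thesis by (simp add: mult.commute mult_right_mono)
  qed
  have "(\<Sum>i<n - 1. norm ((c (t (i + 2)) - c (t (i + 1))) - (c (t (i + 1)) - c (t i))) powr p)
      \<le> (\<Sum>i<n - 1. integral {0..d} (\<lambda>s. norm (W i s) powr p) * d powr (p - 1))"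
    using diff by (intro sum_mono) auto
  also have "\<dots> = integral {0..d} (\<lambda>s. \<Sum>i<n - 1. norm (W i s) powr p) * d powr (p - 1)"
    using Wp by (subst integral_sum) (auto simp: sum_distrib_right)
  also have "\<dots> \<le> (d * (d powr (p - 1) * ?E)) * d powr (p - 1)"
  proof (rule mult_right_mono)
    define K where "K = d powr (p - 1) * ?E"
    have "integral {0..d} (\<lambda>s. \<Sum>i<n - 1. norm (W i s) powr p) \<le> integral {0..d} (\<lambda>s. K)"
      unfolding K_def using Wp pointwise by (intro integral_le integrable_sum) auto
    also have "\<dots> = d * K" using d by simp
    finally show "integral {0..d} (\<lambda>s. \<Sum>i<n - 1. norm (W i s) powr p) \<le> d * (d powr (p - 1) * ?E)"
      unfolding K_def .
  qed simp
  also have "\<dots> = (d * (d powr (p - 1) * d powr (p - 1))) * ?E" by (simp only: ac_simps)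
  also have "d * (d powr (p - 1) * d powr (p - 1)) = d powr (2 * p - 1)"
    using d powr_mult_base[of d "2 * (p - 1)"] by (simp add: algebra_simps flip: powr_add)
  finally show ?thesis .
qed

section \<open>The relaxed energy\<close>

text \<open>A tangent shorter than 1 at a point would, by continuity, make \<open>c\<close> contract
  on a small interval.\<close>

lemma tangent_norm_ge_1:
  fixes c T :: "real \<Rightarrow> 'a::euclidean_space"
  assumes al: "arclength_parameterized c L" and L: "0 < L" and cT: "continuous_on {0..L} T"
    and c: "\<And>x y. 0 \<le> x \<Longrightarrow> x \<le> y \<Longrightarrow> y \<le> L \<Longrightarrow> (T has_integral c y - c x) {x..y}"
    and x: "x \<in> {0..L}"
  shows "1 \<le> norm (T x)"
proof (rule ccontr)
  assume "\<not> 1 \<le> norm (T x)"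
  then have n: "norm (T x) < 1" by simp
  define r where "r = (1 + norm (T x)) / 2"
  have r: "norm (T x) < r" "r < 1" using n by (auto simp: r_def)
  then have "0 < r - norm (T x)" by simp
  then obtain d where d: "0 < d" and Td: "\<And>y. y \<in> {0..L} \<Longrightarrow> dist y x < d \<Longrightarrow> dist (T y) (T x) < r - norm (T x)"
    using cT x unfolding continuous_on_iff by blast
  have Tr: "norm (T y) \<le> r" if "y \<in> {0..L}" "dist y x < d" for y
    using Td[OF that] norm_triangle_ineq2[of "T y" "T x"] by (simp add: dist_norm)
  obtain a b where ab: "0 \<le> a" "a < b" "b \<le> L" "\<And>y. y \<in> {a..b} \<Longrightarrow> dist y x < d"
  proof (cases "x < L")
    case True
    then show ?thesis using d x that[of x "min L (x + d / 2)"] by (auto simp: dist_real_def)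
  next
    case False
    then show ?thesis using d x L that[of "max 0 (x - d / 2)" x] by (auto simp: dist_real_def)
  qed
  show False
  proof (rule arclength_no_contraction[OF al ab(1-3) r(2)])
    fix y z assume yz: "a \<le> y" "y \<le> z" "z \<le> b"
    have "norm (c z - c y) \<le> integral {y..z} (\<lambda>_. r)"
      using integral_norm_bound_integral[of T "{y..z}" "\<lambda>_. r"] c[of y z] Tr ab yz
      by (auto simp: has_integral_iff)
    then show "dist (c y) (c z) \<le> r * (z - y)"
      using yz by (simp add: dist_norm norm_minus_commute mult.commute)
  qed
qed

text \<open>The tangent is uniformly continuous, so on fine uniform partitions every corner meets
  the hypotheses of \<open>corner_energy_le_diff\<close> for a given \<open>r < 1\<close>. Summing
  gives the energy of \<open>v\<close> times \<open>r powr (2 - 4 * p)\<close>, and \<open>r\<close>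
  tends to 1 afterwards.\<close>

lemma relaxed_energy_le:
  fixes c T v :: "real \<Rightarrow> 'a::euclidean_space"
  assumes al: "arclength_parameterized c L" and p: "p > 1" and L: "0 < L" and cT: "continuous_on {0..L} T"
    and c: "\<And>x y. 0 \<le> x \<Longrightarrow> x \<le> y \<Longrightarrow> y \<le> L \<Longrightarrow> (T has_integral c y - c x) {x..y}"
    and T: "\<And>x y. 0 \<le> x \<Longrightarrow> x \<le> y \<Longrightarrow> y \<le> L \<Longrightarrow> (v has_integral T y - T x) {x..y}"
    and v: "(\<lambda>s. norm (v s) powr p) integrable_on {0..L}"
  shows "relaxed_energy p L c \<le> ennreal (integral {0..L} (\<lambda>s. norm (v s) powr p))"
proof -
  let ?E = "integral {0..L} (\<lambda>s. norm (v s) powr p)"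
  define d where "d = (\<lambda>h::nat. L / real (Suc h))"
  define ts where "ts = (\<lambda>h. map (\<lambda>i. real i * d h) [0..<Suc (Suc h)])"
  have d: "0 < d h" for h using L by (simp add: d_def)
  have dL: "real (Suc h) * d h = L" for h by (simp add: d_def)
  have dlim: "d \<longlonglongrightarrow> 0"
    unfolding d_def using LIMSEQ_Suc[OF lim_const_over_n[of L]] by simp
  have nth: "ts h ! i = real i * d h" if "i < Suc (Suc h)" for h i
    unfolding ts_def using that by (simp add: nth_map_upt del: upt_Suc)
  have len: "length (ts h) = Suc (Suc h)" for h by (simp add: ts_def)
  have tL: "real i * d h \<le> L" if "i \<le> Suc h" for i h
    unfolding dL[of h, symmetric] using that d[of h] by (intro mult_right_mono) auto
  have part: "is_partition 0 L (ts h)" for h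
    unfolding is_partition_def
  proof (intro conjI)
    show ne: "ts h \<noteq> []" using len[of h] by auto
    show "sorted_wrt (<) (ts h)" unfolding sorted_wrt_iff_nth_less len using d[of h] nth by auto
    show "hd (ts h) = 0" using nth[of 0 h] ne by (simp add: hd_conv_nth)
    show "last (ts h) = L" using nth[of "Suc h" h] ne dL[of h] len[of h] by (simp add: last_conv_nth)
  qed
  have cc: "continuous_on {0..L} c" using al by (simp add: arclength_parameterized_def)
  have mod: "0 \<le> modulus c (ts h) \<and> modulus c (ts h) \<le> d h" for h
  proof -
    let ?S = "\<lambda>i. c ` {ts h ! i..ts h ! Suc i}"
    have sub: "{ts h ! i..ts h ! Suc i} \<subseteq> {0..L}" if "i < Suc h" for i
      using tL[of "Suc i" h] d[of h] that nth[of i h] nth[of "Suc i" h] by auto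
    have "diameter (?S i) \<le> d h" if i: "i < Suc h" for i
    proof (rule diameter_le)
      fix y z assume "y \<in> ?S i" "z \<in> ?S i"
      then obtain a b where ab: "y = c a" "z = c b" "a \<in> {ts h ! i..ts h ! Suc i}" "b \<in> {ts h ! i..ts h ! Suc i}" by blast
      have "\<bar>a - b\<bar> \<le> d h" using ab i nth[of i h] nth[of "Suc i" h] by (auto simp: algebra_simps)
      moreover have "dist y z \<le> \<bar>a - b\<bar>"
        using arclength_dist_le[OF al, of a b] arclength_dist_le[OF al, of b a] ab sub[OF i]
        by (cases "a \<le> b") (auto simp: dist_commute)
      ultimately show "norm (y - z) \<le> d h" by (simp add: dist_norm)
    qed (use d[of h] in simp)
    moreover have "0 \<le> diameter (?S 0)"
      by (intro diameter_ge_0 compact_imp_bounded compact_continuous_image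
        continuous_on_subset[OF cc sub]) auto
    moreover have m: "modulus c (ts h) = Max ((\<lambda>i. diameter (?S i)) ` {..<Suc h})"
      by (simp add: modulus_def len)
    have "diameter (?S 0) \<le> modulus c (ts h)" unfolding m by (intro Max_ge) auto
    moreover have "Max ((\<lambda>i. diameter (?S i)) ` {..<Suc h}) \<le> d h" if "\<And>i. i < Suc h \<Longrightarrow> diameter (?S i) \<le> d h"
      using that by (intro Max.boundedI) auto
    ultimately show ?thesis using m by (metis order_trans)
  qed
  have modlim: "(\<lambda>h. modulus c (ts h)) \<longlonglongrightarrow> 0"
    by (rule tendsto_sandwich[OF _ _ tendsto_const dlim]) (use mod in auto)
  have bound: "relaxed_energy p L c \<le> ennreal (?E * r powr (2 - 4 * p))" if r: "0 < r" "r < 1" for r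
  proof -
    have r2: "0 < 1 - r\<^sup>2" using r by (simp add: power_less_one_iff abs_square_less_1)
    \<comment> \<open>The first entry makes chords at least \<open>r * d h\<close>, as the tangent
      has norm at least 1; the second keeps the second differences, at most
      \<open>2 * e * d h\<close>, within the range of \<open>corner_energy_le_diff\<close>.\<close>
    define e where "e = min (1 - r) (sqrt (1 - r\<^sup>2) * r)"
    have e: "0 < e" "e \<le> 1 - r" "e \<le> sqrt (1 - r\<^sup>2) * r" using r r2 by (auto simp: e_def)
    have "uniformly_continuous_on {0..L} T" using cT by (rule compact_uniformly_continuous) simp
    then obtain \<eta> where \<eta>: "0 < \<eta>" and T\<eta>: "\<And>x y. x \<in> {0..L} \<Longrightarrow> y \<in> {0..L} \<Longrightarrow> dist y x < \<eta> \<Longrightarrow> dist (T y) (T x) < e"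
      using uniformly_continuous_onE[OF _ e(1)] by metis
    have lin: "norm (c y - c x - (y - x) *\<^sub>R T z) \<le> e * (y - x)"
      if "0 \<le> x" "x \<le> y" "y \<le> L" "z \<in> {x..y}" "y - x < \<eta>" for x y z
    proof -
      have "((\<lambda>s. T s - T z) has_integral (c y - c x) - (y - x) *\<^sub>R T z) {x..y}"
        using has_integral_const_real[of "T z" x y] that by (intro has_integral_diff c) auto
      moreover have "norm (T s - T z) \<le> e" if "s \<in> {x..y}" for s
        using T\<eta>[of z s] that \<open>z \<in> {x..y}\<close> \<open>0 \<le> x\<close> \<open>y \<le> L\<close> \<open>y - x < \<eta>\<close>
        by (force simp: dist_norm less_imp_le)
      ultimately show ?thesis
        using integral_norm_bound_integral[of "\<lambda>s. T s - T z" "{x..y}" "\<lambda>_. e"]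
          has_integral_const_real[of e x y] that
        by (simp add: has_integral_iff mult.commute)
    qed
    have "\<forall>\<^sub>F h in sequentially. d h < \<eta>" using order_tendstoD(2)[OF dlim \<eta>] .
    then have ev: "\<forall>\<^sub>F h in sequentially. optimal_rotation p (map c (ts h)) \<le> ennreal (?E * r powr (2 - 4 * p))"
    proof eventually_elim
      case (elim h)
      define t where "t = (\<lambda>i. real i * d h)"
      have tS: "t (i + 1) = t i + d h" "t (Suc i) = t i + d h" for i by (simp_all add: t_def algebra_simps)
      have t0: "0 \<le> t i" for i using d[of h] by (simp add: t_def)
      have tL': "t i \<le> L" if "i \<le> Suc h" for i using tL[OF that] by (simp add: t_def)
      have chord: "r * d h \<le> norm (c (t (Suc i)) - c (t i))" if i: "i < Suc h" for i
      proof -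
        have "norm (c (t (Suc i)) - c (t i) - d h *\<^sub>R T (t i)) \<le> e * d h"
          using lin[of "t i" "t (Suc i)" "t i"] t0[of i] tL'[of "Suc i"] i elim d[of h] by (simp add: tS)
        moreover have "d h * 1 \<le> norm (d h *\<^sub>R T (t i))"
          using tangent_norm_ge_1[OF al L cT c, of "t i"] t0[of i] tL'[of i] i d[of h]
          by (simp add: mult_left_mono)
        moreover have "norm (d h *\<^sub>R T (t i)) \<le> norm (c (t (Suc i)) - c (t i)) + norm (c (t (Suc i)) - c (t i) - d h *\<^sub>R T (t i))"
          using norm_triangle_ineq4[of "c (t (Suc i)) - c (t i)" "c (t (Suc i)) - c (t i) - d h *\<^sub>R T (t i)"] by simp
        moreover have "e * d h \<le> (1 - r) * d h" using e d[of h] by (intro mult_right_mono) auto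
        ultimately show ?thesis by (simp add: algebra_simps)
      qed
      have V: "map c (ts h) ! i = c (t i)" if "i < Suc (Suc h)" for i
        using nth[OF that] len[of h] that by (simp add: t_def)
      \<comment> \<open>Chords have positive length, so \<open>remdups_adj\<close> merges nothing
        and the corners are those of the uniform partition.\<close>
      have "distinct_adj (map c (ts h))"
        unfolding distinct_adj_conv_nth
      proof (intro allI impI)
        fix i assume i: "Suc i < length (map c (ts h))"
        then have "i < Suc h" using len[of h] by simp
        from chord[OF this] have "c (t (Suc i)) \<noteq> c (t i)" using r d[of h] by (auto simp: mult_le_0_iff)
        then show "map c (ts h) ! i \<noteq> map c (ts h) ! Suc i" using V[of i] V[of "Suc i"] i len[of h] by simp
      qed
      then have rd: "remdups_adj (map c (ts h)) = map c (ts h)" by (simp add: distinct_adj_altdef)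
      let ?D = "\<lambda>i. norm ((c (t (i + 2)) - c (t (i + 1))) - (c (t (i + 1)) - c (t i)))"
      have corner: "corner_energy p (c (t i)) (c (t (i + 1))) (c (t (i + 2)))
          \<le> ennreal (?D i powr p * d h powr (1 - 2 * p) * r powr (2 - 4 * p))" if i: "i < h" for i
      proof (rule corner_energy_le_diff[OF p r d])
        show "r * d h \<le> norm (c (t (i + 1)) - c (t i))" using chord[of i] i by simp
        show "r * d h \<le> norm (c (t (i + 2)) - c (t (i + 1)))" using chord[of "Suc i"] i by simp
        have "norm (c (t (i + 2)) - c (t (i + 1)) - d h *\<^sub>R T (t (i + 1))) \<le> e * d h"
          using lin[of "t (i + 1)" "t (Suc (Suc i))" "t (i + 1)"] t0[of "Suc i"] tL'[of "Suc (Suc i)"] i elim d[of h]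
          by (simp add: tS)
        moreover have "norm (c (t (i + 1)) - c (t i) - d h *\<^sub>R T (t (i + 1))) \<le> e * d h"
          using lin[of "t i" "t (i + 1)" "t (i + 1)"] t0[of i] tL'[of "Suc i"] i elim d[of h]
          by (simp add: tS)
        moreover have "?D i \<le> norm (c (t (i + 2)) - c (t (i + 1)) - d h *\<^sub>R T (t (i + 1)))
            + norm (c (t (i + 1)) - c (t i) - d h *\<^sub>R T (t (i + 1)))"
          using norm_triangle_ineq4[of "c (t (i + 2)) - c (t (i + 1)) - d h *\<^sub>R T (t (i + 1))"
            "c (t (i + 1)) - c (t i) - d h *\<^sub>R T (t (i + 1))"] by (simp add: algebra_simps)
        moreover have "e * d h \<le> (sqrt (1 - r\<^sup>2) * r) * d h" using e d[of h] by (intro mult_right_mono) auto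
        ultimately show "?D i \<le> 2 * sqrt (1 - r\<^sup>2) * (r * d h)" by (simp add: mult.assoc)
      qed
      have "optimal_rotation p (map c (ts h)) = (\<Sum>i<h. corner_energy p (c (t i)) (c (t (i + 1))) (c (t (i + 2))))"
        unfolding optimal_rotation_def Let_def rd using len[of h] V by (simp add: nth_map)
      also have "\<dots> \<le> (\<Sum>i<h. ennreal (?D i powr p * d h powr (1 - 2 * p) * r powr (2 - 4 * p)))"
        using corner by (intro sum_mono) auto
      also have "\<dots> = ennreal ((\<Sum>i<h. ?D i powr p) * (d h powr (1 - 2 * p) * r powr (2 - 4 * p)))"
        by (subst sum_ennreal) (auto simp: sum_distrib_right mult.assoc)
      also have "\<dots> \<le> ennreal ((d h powr (2 * p - 1) * ?E) * (d h powr (1 - 2 * p) * r powr (2 - 4 * p)))"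
        using sum_second_differences_le[OF p zero_less_Suc dL[symmetric] d cT c T v, of h]
        by (intro ennreal_leI mult_right_mono) (auto simp: t_def)
      also have "(d h powr (2 * p - 1) * ?E) * (d h powr (1 - 2 * p) * r powr (2 - 4 * p))
          = (d h powr (2 * p - 1) * d h powr (1 - 2 * p)) * (?E * r powr (2 - 4 * p))"
        by (simp only: ac_simps)
      also have "d h powr (2 * p - 1) * d h powr (1 - 2 * p) = 1"
        using d[of h] by (simp flip: powr_add)
      finally show ?case by simp
    qed
    have "relaxed_energy p L c \<le> liminf (\<lambda>h. optimal_rotation p (map c (ts h)))"
      unfolding relaxed_energy_def using part modlim by (intro Inf_lower) blast
    also have "\<dots> \<le> ennreal (?E * r powr (2 - 4 * p))" using ev by (rule Liminf_le[OF sequentially_bot])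
    finally show ?thesis .
  qed
  have "((\<lambda>r. ennreal (?E * r powr (2 - 4 * p))) \<longlongrightarrow> ennreal (?E * 1 powr (2 - 4 * p))) (at_left 1)"
    by (intro tendsto_ennrealI tendsto_intros tendsto_ident_at) auto
  moreover have "\<forall>\<^sub>F r in at_left (1::real). relaxed_energy p L c \<le> ennreal (?E * r powr (2 - 4 * p))"
    unfolding eventually_at_left_field using bound by (intro exI[of _ 0]) auto
  ultimately have "relaxed_energy p L c \<le> ennreal (?E * 1 powr (2 - 4 * p))"
    by (rule tendsto_lowerbound) simp
  then show ?thesis by simp
qed

section \<open>Finite energy and membership in the Sobolev space\<close>

lemma finite_energy_density:
  fixes c :: "real \<Rightarrow> 'a::euclidean_space"
  assumes al: "arclength_parameterized c L" and p: "p > 1" and L: "0 < L"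
    and M: "relaxed_energy p L c < ennreal M"
  obtains T v :: "real \<Rightarrow> 'a" where "continuous_on {0..L} T" "v absolutely_integrable_on {0..L}"
    "has_weak_deriv 1 {0<..<L} c T" "has_weak_deriv 2 {0<..<L} c v"
    "(\<lambda>s. norm (v s) powr p) integrable_on {0..L}" "integral {0..L} (\<lambda>s. norm (v s) powr p) \<le> M"
proof (rule tangent_of_finite_energy[OF al p L M])
  fix T :: "real \<Rightarrow> 'a"
  assume dc: "\<And>z. z \<in> {0..L} \<Longrightarrow> (c has_vector_derivative T z) (at z within {0..L})"
    and cT: "continuous_on {0..L} T"
    and R: "\<And>n (x :: nat \<Rightarrow> real). 0 \<le> x 0 \<Longrightarrow> x n \<le> L \<Longrightarrow> (\<And>j. j < n \<Longrightarrow> x j < x (Suc j)) \<Longrightarrow>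
      (\<Sum>j<n. norm (T (x (Suc j)) - T (x j)) powr p / (x (Suc j) - x j) powr (p - 1)) \<le> M"
  have Ru: "(\<Sum>k<n. norm (T (real (Suc k) * (L / real n)) - T (real k * (L / real n))) powr p)
      \<le> M * (L / real n) powr (p - 1)" if n: "0 < n" for n
  proof -
    define x where "x = (\<lambda>k::nat. real k * (L / real n))"
    have h: "0 < L / real n" using n L by simp
    have xS: "x (Suc k) - x k = L / real n" for k
      by (simp add: x_def distrib_right del: times_divide_eq_right)
    have "(\<Sum>j<n. norm (T (x (Suc j)) - T (x j)) powr p / (x (Suc j) - x j) powr (p - 1)) \<le> M"
    proof (rule R)
      show "x j < x (Suc j)" for j using xS[of j] h by linarith
    qed (use n in \<open>auto simp: x_def\<close>)
    then have "(\<Sum>j<n. norm (T (x (Suc j)) - T (x j)) powr p) / (L / real n) powr (p - 1) \<le> M"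
      unfolding xS sum_divide_distrib[symmetric] .
    then have "(\<Sum>j<n. norm (T (x (Suc j)) - T (x j)) powr p) \<le> M * (L / real n) powr (p - 1)"
      by (rule iffD1[OF pos_divide_le_eq, rotated]) (use L n in simp)
    then show ?thesis by (simp only: x_def)
  qed
  show ?thesis
  proof (rule riesz_density[OF p L cT Ru])
    fix v assume v: "v absolutely_integrable_on {0..L}"
      "\<And>x y. 0 \<le> x \<Longrightarrow> x \<le> y \<Longrightarrow> y \<le> L \<Longrightarrow> (v has_integral T y - T x) {x..y}"
      "(\<lambda>s. norm (v s) powr p) integrable_on {0..L}" "integral {0..L} (\<lambda>s. norm (v s) powr p) \<le> M"
    have "has_weak_deriv 1 {0<..<L} c T" "has_weak_deriv 2 {0<..<L} c v"
      using weak_derivs_of_indefinite_integral[OF L cT v(1)] dc v(2) by blast+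
    then show ?thesis using that cT v by blast
  qed
qed

lemma in_Lp_of_integrable:
  fixes g :: "real \<Rightarrow> 'a::euclidean_space"
  assumes g: "g integrable_on {0..L}" and gp: "(\<lambda>s. norm (g s) powr p) integrable_on {0..L}"
  shows "in_Lp p {0<..<L} g"
  unfolding in_Lp_def
proof
  have "g integrable_on {0<..<L}" using g by (auto simp: integrable_on_def has_integral_Icc_iff_Ioo)
  then show "g \<in> borel_measurable (lebesgue_on {0<..<L})" by (rule has_integral_measurable) simp
  have "(\<lambda>s. norm (g s) powr p) integrable_on {0<..<L}"
    using gp by (auto simp: integrable_on_def has_integral_Icc_iff_Ioo)
  then have "(\<lambda>s. norm (g s) powr p) absolutely_integrable_on {0<..<L}"
    by (subst absolutely_integrable_on_iff_nonneg) auto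
  then show "integrable (lebesgue_on {0<..<L}) (\<lambda>s. norm (g s) powr p)"
    by (simp add: set_integrable_def integrable_restrict_space)
qed

lemma integrable_of_in_Lp:
  fixes v :: "real \<Rightarrow> 'a::euclidean_space"
  assumes p: "p > 1" and v: "in_Lp p {0<..<L} v"
  shows "(\<lambda>s. norm (v s) powr p) integrable_on {0..L}" "v integrable_on {0..L}"
proof -
  have vp: "(\<lambda>s. norm (v s) powr p) integrable_on {0<..<L}"
    using v by (intro integrable_on_lebesgue_on) (auto simp: in_Lp_def)
  then show "(\<lambda>s. norm (v s) powr p) integrable_on {0..L}"
    by (auto simp: integrable_on_def has_integral_Icc_iff_Ioo)
  have "v absolutely_integrable_on {0<..<L}"
  proof (rule measurable_bounded_by_integrable_imp_absolutely_integrable)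
    show "(\<lambda>s. 1 + norm (v s) powr p) integrable_on {0<..<L}"
      by (intro integrable_add vp integrable_on_const) auto
    show "norm (v s) \<le> 1 + norm (v s) powr p" for s
    proof (cases "norm (v s) \<le> 1")
      case False
      then have "norm (v s) powr 1 \<le> norm (v s) powr p" using p by (intro powr_mono) auto
      then show ?thesis using False by simp
    qed (simp add: add_increasing2)
  qed (use v in \<open>auto simp: in_Lp_def\<close>)
  then have "v integrable_on {0<..<L}" by (rule set_lebesgue_integral_eq_integral(1))
  then show "v integrable_on {0..L}" by (auto simp: integrable_on_def has_integral_Icc_iff_Ioo)
qed

text \<open>\<open>weak_second_deriv_classical\<close> only reaches compact subintervals, where the
  derivative of \<open>c\<close> differs from the primitive \<open>V\<close> of \<open>v\<close> by
  a constant. As \<open>v\<close> is integrable up to 0 and \<open>L\<close>, \<open>V\<close> is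
  continuous on all of \<open>{0..L}\<close>, and the fundamental theorem with interior derivatives
  carries the formula to the end points.\<close>

lemma relaxed_energy_le_weak:
  fixes c v :: "real \<Rightarrow> 'a::euclidean_space"
  assumes al: "arclength_parameterized c L" and p: "p > 1" and L: "0 < L"
    and wd: "has_weak_deriv 2 {0<..<L} c v" and v: "in_Lp p {0<..<L} v"
  shows "relaxed_energy p L c \<le> ennreal (integral {0..L} (\<lambda>s. norm (v s) powr p))"
proof -
  have cc: "continuous_on {0..L} c" using al by (simp add: arclength_parameterized_def)
  note vi = integrable_of_in_Lp[OF p v]
  define V where "V = (\<lambda>x. integral {0..x} v)"
  have cV: "continuous_on {0..L} V" unfolding V_def by (rule indefinite_integral_continuous_1[OF vi(2)])
  have Vi: "(v has_integral V y - V x) {x..y}" if "0 \<le> x" "x \<le> y" "y \<le> L" for x y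
  proof -
    have "integral {0..x} v + integral {x..y} v = integral {0..y} v"
      using that by (intro Henstock_Kurzweil_Integration.integral_combine integrable_on_subinterval[OF vi(2)]) auto
    moreover have "v integrable_on {x..y}" using that by (intro integrable_on_subinterval[OF vi(2)]) auto
    ultimately show ?thesis by (simp add: V_def has_integral_iff algebra_simps)
  qed
  define m where "m = L / 2"
  \<comment> \<open>One constant for all subintervals: each is chosen to contain the midpoint
    \<open>m\<close>, where the constant is read off.\<close>
  define B where "B = vector_derivative c (at m) - V m"
  have der: "(c has_vector_derivative V x + B) (at x)" if x: "x \<in> {0<..<L}" for x
  proof -
    define a where "a = min x m / 2"
    define b where "b = (max x m + L) / 2"
    have ab: "0 < a" "a < b" "b < L" "x \<in> {a<..<b}" "m \<in> {a<..<b}"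
      using x L by (auto simp: a_def b_def m_def min_def max_def)
    obtain T where T: "\<And>x. x \<in> {a..b} \<Longrightarrow> (c has_vector_derivative T x) (at x within {a..b})"
      "\<And>x y. a \<le> x \<Longrightarrow> x \<le> y \<Longrightarrow> y \<le> b \<Longrightarrow> (v has_integral T y - T x) {x..y}"
      "v absolutely_integrable_on {a..b}"
      using weak_second_deriv_classical[OF wd cc ab(1-3)] by blast
    have at: "(c has_vector_derivative T y) (at y)" if "y \<in> {a<..<b}" for y
      using T(1)[of y] that by (auto simp: at_within_Icc_at)
    have "T m = vector_derivative c (at m)" using at[OF ab(5)] by (simp add: vector_derivative_at)
    moreover have "T x - T m = V x - V m"
    proof (cases "x \<le> m")
      case True
      have "T m - T x = V m - V x"
        by (rule has_integral_unique[OF T(2) Vi]) (use True ab L m_def in auto)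
      then show ?thesis by (metis minus_diff_eq)
    next
      case False
      show ?thesis by (rule has_integral_unique[OF T(2) Vi]) (use False ab L m_def in auto)
    qed
    ultimately have "T x = V x + B" by (simp add: B_def algebra_simps)
    then show ?thesis using at[OF ab(4)] by simp
  qed
  show ?thesis
  proof (rule relaxed_energy_le[OF al p L, of "\<lambda>x. V x + B"])
    show "continuous_on {0..L} (\<lambda>x. V x + B)" by (intro continuous_intros cV)
    show "((\<lambda>x. V x + B) has_integral c y - c x) {x..y}" if "0 \<le> x" "x \<le> y" "y \<le> L" for x y
      using that by (intro fundamental_theorem_of_calculus_interior continuous_on_subset[OF cc] der) auto
    show "(v has_integral V y + B - (V x + B)) {x..y}" if "0 \<le> x" "x \<le> y" "y \<le> L" for x y
      using Vi[OF that] by simp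
  qed (rule vi)
qed

text \<open>By uniqueness almost everywhere, any known density computes the integral of the chosen
  one; the two end points form a null set.\<close>

lemma nn_integral_weak_deriv:
  fixes c v :: "real \<Rightarrow> 'a::euclidean_space"
  assumes cc: "continuous_on {0..L} c" and v: "has_weak_deriv 2 {0<..<L} c v"
    and vp: "(\<lambda>s. norm (v s) powr p) integrable_on {0..L}"
  shows "(\<integral>\<^sup>+s\<in>{0<..<L}. ennreal (norm (weak_deriv 2 {0<..<L} c s) powr p) \<partial>lebesgue)
    = ennreal (integral {0..L} (\<lambda>s. norm (v s) powr p))"
proof -
  have "has_weak_deriv 2 {0<..<L} c (weak_deriv 2 {0<..<L} c)"
    using someI[of "has_weak_deriv 2 {0<..<L} c" v] v by (simp add: weak_deriv_def)
  from weak_second_deriv_unique[OF this v cc]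
  have "(\<integral>\<^sup>+s\<in>{0<..<L}. ennreal (norm (weak_deriv 2 {0<..<L} c s) powr p) \<partial>lebesgue)
      = (\<integral>\<^sup>+s\<in>{0<..<L}. ennreal (norm (v s) powr p) \<partial>lebesgue)"
    by (intro nn_integral_cong_AE, elim eventually_mono) (auto simp: indicator_def)
  also have "\<dots> = ennreal (integral {0<..<L} (\<lambda>s. norm (v s) powr p))"
    using vp by (intro set_nn_integral_eq_integral) (auto simp: integrable_on_def has_integral_Icc_iff_Ioo)
  finally show ?thesis by (simp add: integral_open_interval_real)
qed

theorem theorem6p3:
  fixes c :: "real \<Rightarrow> real ^ 'n" and N :: nat and L p :: real
  assumes "N \<ge> 1" and "CARD('n) = N + 1"
    and "arclength_parameterized c L"
    and "c 0 \<noteq> c L"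
    and "p > 1"
  shows "(relaxed_energy p L c < \<infinity> \<longleftrightarrow> c \<in> sobolev 2 p {0<..<L}) \<and>
    (c \<in> sobolev 2 p {0<..<L} \<longrightarrow>
       relaxed_energy p L c =
         (\<integral>\<^sup>+s\<in>{0<..<L}. ennreal (norm (weak_deriv 2 {0<..<L} c s) powr p) \<partial>lebesgue))"
proof -
  have al: "arclength_parameterized c L" and p: "p > 1" by fact+
  \<comment> \<open>\<open>L = 0\<close> would force \<open>c 0 = c L\<close>.\<close>
  have L: "0 < L" using assms(3,4) by (cases "L = 0") (auto simp: arclength_parameterized_def)
  have cc: "continuous_on {0..L} c" using al by (simp add: arclength_parameterized_def)
  have Lp: "in_Lp p {0<..<L} g" if "continuous_on {0..L} g" for g :: "real \<Rightarrow> real ^ 'n"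
    using p that by (intro in_Lp_of_integrable integrable_continuous_real continuous_on_powr'
      continuous_on_norm continuous_on_const) auto
  have fwd: "c \<in> sobolev 2 p {0<..<L}" if fin: "relaxed_energy p L c < \<infinity>"
  proof -
    obtain r where "relaxed_energy p L c = ennreal r" "0 \<le> r"
      using fin by (cases "relaxed_energy p L c") auto
    \<comment> \<open>\<open>finite_energy_density\<close> asks for a strict bound, hence
      \<open>r + 1\<close>.\<close>
    then have "relaxed_energy p L c < ennreal (r + 1)" by (simp add: ennreal_less_iff)
    then obtain T v where Tv: "continuous_on {0..L} T" "v absolutely_integrable_on {0..L}"
      "has_weak_deriv 1 {0<..<L} c T" "has_weak_deriv 2 {0<..<L} c v" "(\<lambda>s. norm (v s) powr p) integrable_on {0..L}"
      by (rule finite_energy_density[OF al p L])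
    have "in_Lp p {0<..<L} v"
      using Tv(2,5) by (intro in_Lp_of_integrable) (auto dest: set_lebesgue_integral_eq_integral(1))
    moreover have "{1..2::nat} = {1, 2}" by auto
    ultimately show ?thesis unfolding sobolev_def using Lp[OF cc] Lp[OF Tv(1)] Tv(3,4) by auto
  qed
  have "relaxed_energy p L c < \<infinity> \<and> relaxed_energy p L c =
         (\<integral>\<^sup>+s\<in>{0<..<L}. ennreal (norm (weak_deriv 2 {0<..<L} c s) powr p) \<partial>lebesgue)"
    if sob: "c \<in> sobolev 2 p {0<..<L}"
  proof -
    obtain v where v: "has_weak_deriv 2 {0<..<L} c v" "in_Lp p {0<..<L} v"
      using sob by (auto simp: sobolev_def dest!: bspec[of _ _ 2])
    let ?E = "integral {0..L} (\<lambda>s. norm (v s) powr p)"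
    have le: "relaxed_energy p L c \<le> ennreal ?E" by (rule relaxed_energy_le_weak[OF al p L v])
    note eq = nn_integral_weak_deriv[OF cc v(1) integrable_of_in_Lp(1)[OF p v(2)]]
    \<comment> \<open>An energy below \<open>?E\<close> would give a density with energy at most
      some \<open>M\<close> below \<open>?E\<close>; but two weak second derivatives agree almost
      everywhere and so have the same energy.\<close>
    have "\<not> relaxed_energy p L c < ennreal ?E"
    proof
      assume "relaxed_energy p L c < ennreal ?E"
      then obtain M' where M': "relaxed_energy p L c < M'" "M' < ennreal ?E" using dense by blast
      then obtain M where M: "M' = ennreal M" "0 \<le> M" by (cases M') auto
      have "relaxed_energy p L c < ennreal M" using M' M by simp
      then obtain w where w: "has_weak_deriv 2 {0<..<L} c w" "(\<lambda>s. norm (w s) powr p) integrable_on {0..L}"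
        "integral {0..L} (\<lambda>s. norm (w s) powr p) \<le> M"
        by (rule finite_energy_density[OF al p L])
      have "ennreal ?E \<le> ennreal M"
        using trans[OF eq[symmetric] nn_integral_weak_deriv[OF cc w(1,2)]] ennreal_leI[OF w(3)] by simp
      from leD[OF this] M'(2)[unfolded M(1)] show False by blast
    qed
    then have "relaxed_energy p L c = ennreal ?E" using le by (simp add: order_le_less)
    then show ?thesis using eq by simp
  qed
  then show ?thesis using fwd by blast
qed

end
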